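(* Assume there exists $0<p<1$ such that $\sum_{j\ge1}\|\psi_j\|_{L^\infty(\Omega)}^p<\infty$, and let the $\psi_j$ be ordered such that $\|\psi_1\|_{L^\infty(\Omega)}\ge\|\psi_2\|_{L^\infty(\Omega)}\ge\|\psi_3\|_{L^\infty(\Omega)}\ge\cdots$. Then there is a constant $C>0$, independent of $s$, $z$ and $u_0$, such that for every $z\in L^2(\Omega)$ and every $s\in\mathbb N$ the truncated adjoint solution $q_s$ satisfies $$\left\|\int_\Xi\big(q(\cdot,\boldsymbol y,z)-q_s(\cdot,\boldsymbol y,z)\big)\,\mathrm d\boldsymbol y\right\|_{L^2(\Omega)}\le C\big(\|z\|_{L^2(\Omega)}+\|u_0\|_{L^2(\Omega)}\big)\,s^{-\left(\frac2p-1\right)}.$$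
   Context: $d\in\{1,2,3\}$, $\Omega\subset\mathbb R^d$ is a bounded domain with Lipschitz boundary, $u_0\in L^2(\Omega)$, and $\langle\cdot,\cdot\rangle$ is the $L^2(\Omega)$ inner product. $\Xi=[-\frac12,\frac12]^{\mathbb N}$ carries the uniform product probability measure $\mathrm d\boldsymbol y$. The coefficient is $a(\boldsymbol x,\boldsymbol y)=\bar a(\boldsymbol x)+\sum_{j\ge1}y_j\psi_j(\boldsymbol x)$ with $\bar a\in L^\infty(\Omega)$, $\sum_j\|\psi_j\|_{L^\infty(\Omega)}<\infty$ and $0<a_{\min}\le a(\boldsymbol x,\boldsymbol y)\le a_{\max}<\infty$ for all $\boldsymbol x\in\Omega$, $\boldsymbol y\in\Xi$. Put $b(\boldsymbol y;w,v):=\int_\Omega a(\boldsymbol x,\boldsymbol y)\nabla w(\boldsymbol x)\cdot\nabla v(\boldsymbol x)\,\mathrm d\boldsymbol x$ for $w,v\in H_0^1(\Omega)$. For $\boldsymbol y\in\Xi$ and $z\in L^2(\Omega)$, the state $u(\cdot,\boldsymbol y,z)\in H_0^1(\Omega)$ is the unique solution of $b(\boldsymbol y;u(\cdot,\boldsymbol y,z),v)=\langle z,v\rangle$ for all $v\in H_0^1(\Omega)$, and the adjoint state $q(\cdot,\boldsymbol y,z)\in H_0^1(\Omega)$ is the unique solution of $b(\boldsymbol y;q(\cdot,\boldsymbol y,z),w)=\langle u(\cdot,\boldsymbol y,z)-u_0,w\rangle$ for all $w\in H_0^1(\Omega)$. The dimensionally truncated adjoint state is $q_s(\cdot,\boldsymbol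 y,z):=q(\cdot,(y_1,\dots,y_s,0,0,\dots),z)$. *)

theory Defs
  imports "HOL-Probability.Probability"
begin

section \<open>The Hilbert space of square-integrable functions\<close>

text \<open>
  Elements of type \<open>('a, 'b) L2\<close> are almost-everywhere classes of square-integrable functions on the
  whole Euclidean space. Making this a type in the classes \<open>real_inner\<close>, \<open>banach\<close> and
  \<open>second_countable_topology\<close> gives access to the library's Bochner integral of functions with values
  in it. The space over a domain is the subspace \<open>L2_on\<close> of classes vanishing off the domain.
\<close>

definition square_integrable :: "('a::euclidean_space \<Rightarrow> 'b::euclidean_space) \<Rightarrow> bool" where
  "square_integrable f \<longleftrightarrow>
     f \<in> borel_measurable lebesgue \<and> integrable lebesgue (\<lambda>x. (norm (f x))\<^sup>2)"

definition L2_eq :: "('a::euclidean_space \<Rightarrow> 'b::euclidean_space) \<Rightarrow> ('a \<Rightarrow> 'b) \<Rightarrow> bool" where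
  "L2_eq f g \<longleftrightarrow> square_integrable f \<and> square_integrable g \<and> (AE x in lebesgue. f x = g x)"

lemma square_integrable_measurable [measurable_dest]:
  "square_integrable f \<Longrightarrow> f \<in> borel_measurable lebesgue"
  by (simp add: square_integrable_def)

lemma square_integrable_0: "square_integrable (\<lambda>x. 0)"
  by (simp add: square_integrable_def)

lemma square_integrable_bound:
  assumes "f \<in> borel_measurable lebesgue" "integrable lebesgue w"
    and "AE x in lebesgue. (norm (f x))\<^sup>2 \<le> w x"
  shows "square_integrable f"
  unfolding square_integrable_def
  using assms by (auto intro!: Bochner_Integration.integrable_bound[OF assms(2)] elim!: eventually_mono)

lemma square_integrable_add:
  assumes f: "square_integrable f" and g: "square_integrable g"
  shows "square_integrable (\<lambda>x. f x + g x)"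
proof (rule square_integrable_bound)
  show "(\<lambda>x. f x + g x) \<in> borel_measurable lebesgue"
    using f g by measurable
  show "integrable lebesgue (\<lambda>x. 2 * (norm (f x))\<^sup>2 + 2 * (norm (g x))\<^sup>2)"
    using f g by (auto simp: square_integrable_def)
  have "(norm (f x + g x))\<^sup>2 \<le> 2 * (norm (f x))\<^sup>2 + 2 * (norm (g x))\<^sup>2" for x
  proof -
    have "(norm (f x + g x))\<^sup>2 \<le> (norm (f x) + norm (g x))\<^sup>2"
      by (intro power_mono norm_triangle_ineq norm_ge_zero)
    also have "\<dots> \<le> 2 * (norm (f x))\<^sup>2 + 2 * (norm (g x))\<^sup>2"
      using sum_squares_ge_zero[of "norm (f x) - norm (g x)" 0]
      by (simp add: power2_eq_square algebra_simps)
    finally show ?thesis .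
  qed
  then show "AE x in lebesgue. (norm (f x + g x))\<^sup>2 \<le> 2 * (norm (f x))\<^sup>2 + 2 * (norm (g x))\<^sup>2"
    by simp
qed

lemma square_integrable_scaleR:
  "square_integrable f \<Longrightarrow> square_integrable (\<lambda>x. c *\<^sub>R f x)"
  by (auto simp: square_integrable_def power_mult_distrib)

lemma square_integrable_uminus:
  "square_integrable f \<Longrightarrow> square_integrable (\<lambda>x. - f x)"
  using square_integrable_scaleR[of f "-1"] by simp

lemma square_integrable_diff:
  "square_integrable f \<Longrightarrow> square_integrable g \<Longrightarrow> square_integrable (\<lambda>x. f x - g x)"
  using square_integrable_add[of f "\<lambda>x. - g x"] square_integrable_uminus[of g] by simp

lemma square_integrable_inner:
  assumes f: "square_integrable f" and g: "square_integrable g"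
  shows "integrable lebesgue (\<lambda>x. f x \<bullet> g x)"
proof (rule Bochner_Integration.integrable_bound)
  show "integrable lebesgue (\<lambda>x. (norm (f x))\<^sup>2 + (norm (g x))\<^sup>2)"
    using f g by (auto simp: square_integrable_def)
  show "(\<lambda>x. f x \<bullet> g x) \<in> borel_measurable lebesgue"
    using f g by measurable
  have "\<bar>f x \<bullet> g x\<bar> \<le> (norm (f x))\<^sup>2 + (norm (g x))\<^sup>2" for x
  proof -
    have "\<bar>f x \<bullet> g x\<bar> \<le> norm (f x) * norm (g x)"
      by (rule Cauchy_Schwarz_ineq2)
    also have "\<dots> \<le> (norm (f x))\<^sup>2 + (norm (g x))\<^sup>2"
    proof -
      have "0 \<le> (norm (f x) - norm (g x))\<^sup>2 + (norm (f x))\<^sup>2 + (norm (g x))\<^sup>2"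
        by simp
      then show ?thesis
        by (simp add: power2_eq_square algebra_simps)
    qed
    finally show ?thesis .
  qed
  then show "AE x in lebesgue. norm (f x \<bullet> g x) \<le> norm ((norm (f x))\<^sup>2 + (norm (g x))\<^sup>2)"
    by simp
qed

lemma part_equivp_L2_eq: "part_equivp L2_eq"
proof (rule part_equivpI)
  show "\<exists>f::'a \<Rightarrow> 'b. L2_eq f f"
    by (rule exI[of _ "\<lambda>x. 0"]) (simp add: L2_eq_def square_integrable_0)
  show "symp (L2_eq :: ('a \<Rightarrow> 'b) \<Rightarrow> _)"
    by (auto intro!: sympI simp: L2_eq_def)
  show "transp (L2_eq :: ('a \<Rightarrow> 'b) \<Rightarrow> _)"
    by (auto intro!: transpI simp: L2_eq_def)
qed

quotient_type (overloaded) ('a, 'b) L2 = "'a::euclidean_space \<Rightarrow> 'b::euclidean_space" / partial: L2_eq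
  morphisms L2_fun L2_class
  by (rule part_equivp_L2_eq)

lemma square_integrable_L2_fun [simp]: "square_integrable (L2_fun u)"
  using Quotient3_rep_reflp[OF Quotient3_L2, of u] by (simp add: L2_eq_def)

lemma L2_fun_measurable [measurable]: "L2_fun u \<in> borel_measurable lebesgue"
  by (rule square_integrable_measurable) simp

lemma L2_class_L2_fun [simp]: "L2_class (L2_fun u) = u"
  using Quotient3_abs_rep[OF Quotient3_L2] .

lemma L2_class_eqI: "L2_eq f g \<Longrightarrow> L2_class f = L2_class g"
  using Quotient3_rel_abs[OF Quotient3_L2] .

lemma L2_fun_L2_class:
  "square_integrable f \<Longrightarrow> AE x in lebesgue. L2_fun (L2_class f) x = f x"
  using Quotient3_rep_abs[OF Quotient3_L2, of f] by (simp add: L2_eq_def)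

lemma L2_eqI:
  "(AE x in lebesgue. L2_fun u x = L2_fun v x) \<Longrightarrow> u = v"
  using L2_class_eqI[of "L2_fun u" "L2_fun v"] by (simp add: L2_eq_def)

instantiation L2 :: (euclidean_space, euclidean_space) real_inner
begin

lift_definition zero_L2 :: "('a, 'b) L2" is "\<lambda>x. 0"
  by (simp add: L2_eq_def square_integrable_0)

lift_definition plus_L2 :: "('a, 'b) L2 \<Rightarrow> ('a, 'b) L2 \<Rightarrow> ('a, 'b) L2"
  is "\<lambda>f g x. f x + g x"
  by (auto simp: L2_eq_def square_integrable_add)

lift_definition minus_L2 :: "('a, 'b) L2 \<Rightarrow> ('a, 'b) L2 \<Rightarrow> ('a, 'b) L2"
  is "\<lambda>f g x. f x - g x"
  by (auto simp: L2_eq_def square_integrable_diff)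

lift_definition uminus_L2 :: "('a, 'b) L2 \<Rightarrow> ('a, 'b) L2"
  is "\<lambda>f x. - f x"
  by (auto simp: L2_eq_def square_integrable_uminus)

lift_definition scaleR_L2 :: "real \<Rightarrow> ('a, 'b) L2 \<Rightarrow> ('a, 'b) L2"
  is "\<lambda>c f x. c *\<^sub>R f x"
  by (auto simp: L2_eq_def square_integrable_scaleR)

lift_definition inner_L2 :: "('a, 'b) L2 \<Rightarrow> ('a, 'b) L2 \<Rightarrow> real"
  is "\<lambda>f g. \<integral>x. f x \<bullet> g x \<partial>lebesgue"
proof (rule integral_cong_AE)
  fix f1 f2 g1 g2 :: "'a \<Rightarrow> 'b"
  assume "L2_eq f1 f2" "L2_eq g1 g2"
  then have [measurable]: "f1 \<in> borel_measurable lebesgue" "f2 \<in> borel_measurable lebesgue"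
      "g1 \<in> borel_measurable lebesgue" "g2 \<in> borel_measurable lebesgue"
    by (auto simp: L2_eq_def square_integrable_def)
  show "(\<lambda>x. f1 x \<bullet> g1 x) \<in> borel_measurable lebesgue"
    by measurable
  show "(\<lambda>x. f2 x \<bullet> g2 x) \<in> borel_measurable lebesgue"
    by measurable
  show "AE x in lebesgue. f1 x \<bullet> g1 x = f2 x \<bullet> g2 x"
    using \<open>L2_eq f1 f2\<close> \<open>L2_eq g1 g2\<close> by (auto simp: L2_eq_def)
qed

definition norm_L2 :: "('a, 'b) L2 \<Rightarrow> real" where
  "norm_L2 u = sqrt (u \<bullet> u)"

definition dist_L2 :: "('a, 'b) L2 \<Rightarrow> ('a, 'b) L2 \<Rightarrow> real" where
  "dist_L2 u v = norm (u - v)"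

definition sgn_L2 :: "('a, 'b) L2 \<Rightarrow> ('a, 'b) L2" where
  "sgn_L2 u = inverse (norm u) *\<^sub>R u"

definition uniformity_L2 :: "(('a, 'b) L2 \<times> ('a, 'b) L2) filter" where
  "uniformity_L2 = (INF e\<in>{0 <..}. principal {(u, v). dist u v < e})"

definition open_L2 :: "('a, 'b) L2 set \<Rightarrow> bool" where
  "open_L2 S \<longleftrightarrow> (\<forall>u\<in>S. \<forall>\<^sub>F (u', v) in uniformity. u' = u \<longrightarrow> v \<in> S)"

instance
proof
  fix u v w :: "('a, 'b) L2" and c d :: real and S :: "('a, 'b) L2 set"
  show "u + v + w = u + (v + w)"
    by transfer (auto simp: L2_eq_def add.assoc square_integrable_add)
  show "u + v = v + u"
    by transfer (auto simp: L2_eq_def add.commute square_integrable_add)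
  show "0 + u = u"
    by transfer (auto simp: L2_eq_def)
  show "- u + u = 0"
    by transfer (auto simp: L2_eq_def square_integrable_0)
  show "u - v = u + - v"
    by transfer (auto simp: L2_eq_def square_integrable_diff)
  show "c *\<^sub>R (u + v) = c *\<^sub>R u + c *\<^sub>R v"
    by transfer (auto simp: L2_eq_def scaleR_add_right
        intro!: square_integrable_add square_integrable_scaleR)
  show "(c + d) *\<^sub>R u = c *\<^sub>R u + d *\<^sub>R u"
    by transfer (auto simp: L2_eq_def scaleR_add_left
        intro!: square_integrable_add square_integrable_scaleR)
  show "c *\<^sub>R d *\<^sub>R u = (c * d) *\<^sub>R u"
    by transfer (auto simp: L2_eq_def intro!: square_integrable_scaleR)
  show "1 *\<^sub>R u = u"
    by transfer (auto simp: L2_eq_def)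
  show "u \<bullet> v = v \<bullet> u"
    by transfer (simp add: inner_commute)
  show "(u + v) \<bullet> w = u \<bullet> w + v \<bullet> w"
    by transfer (auto simp: L2_eq_def inner_add_left square_integrable_inner
        intro!: Bochner_Integration.integral_add)
  show "(c *\<^sub>R u) \<bullet> v = c * (u \<bullet> v)"
    by transfer (auto simp: L2_eq_def)
  show "0 \<le> u \<bullet> u"
    by transfer simp
  show "(u \<bullet> u = 0) = (u = 0)"
  proof (transfer, goal_cases)
    case (1 f)
    then have "square_integrable f"
      by (simp add: L2_eq_def)
    then have "(\<integral>x. f x \<bullet> f x \<partial>lebesgue) = 0 \<longleftrightarrow> (AE x in lebesgue. f x \<bullet> f x = 0)"
      by (intro integral_nonneg_eq_0_iff_AE square_integrable_inner) auto
    with \<open>square_integrable f\<close> show ?case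
      by (simp add: L2_eq_def square_integrable_0)
  qed
qed (auto simp: norm_L2_def dist_L2_def sgn_L2_def uniformity_L2_def open_L2_def)

end

lemma L2_fun_zero: "AE x in lebesgue. L2_fun 0 x = 0"
  unfolding zero_L2_def by (simp add: L2_fun_L2_class square_integrable_0)

lemma L2_class_add:
  "square_integrable f \<Longrightarrow> square_integrable g \<Longrightarrow>
     L2_class (\<lambda>x. f x + g x) = L2_class f + L2_class g"
  by (simp add: plus_L2.abs_eq L2_eq_def)

lemma L2_class_diff:
  "square_integrable f \<Longrightarrow> square_integrable g \<Longrightarrow>
     L2_class (\<lambda>x. f x - g x) = L2_class f - L2_class g"
  by (simp add: minus_L2.abs_eq L2_eq_def)

lemma L2_class_scaleR:
  "square_integrable f \<Longrightarrow> L2_class (\<lambda>x. c *\<^sub>R f x) = c *\<^sub>R L2_class f"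
  by (simp add: scaleR_L2.abs_eq L2_eq_def)

lemma L2_class_0: "L2_class (\<lambda>x. 0) = 0"
  by (simp add: zero_L2_def)

lemma inner_L2_class:
  "square_integrable f \<Longrightarrow> square_integrable g \<Longrightarrow>
     L2_class f \<bullet> L2_class g = (\<integral>x. f x \<bullet> g x \<partial>lebesgue)"
  by (simp add: inner_L2.abs_eq L2_eq_def)

lemma inner_L2_fun: "u \<bullet> v = (\<integral>x. L2_fun u x \<bullet> L2_fun v x \<partial>lebesgue)"
  using inner_L2_class[of "L2_fun u" "L2_fun v"] by simp

lemma norm_L2_class:
  "square_integrable f \<Longrightarrow> (norm (L2_class f))\<^sup>2 = (\<integral>x. (norm (f x))\<^sup>2 \<partial>lebesgue)"
  by (simp add: power2_norm_eq_inner inner_L2_class)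

lemma norm_L2_fun: "(norm u)\<^sup>2 = (\<integral>x. (norm (L2_fun u x))\<^sup>2 \<partial>lebesgue)"
  using norm_L2_class[of "L2_fun u"] by simp

lemma L2_fun_diff: "AE x in lebesgue. L2_fun (u - v) x = L2_fun u x - L2_fun v x"
  using L2_fun_L2_class[of "\<lambda>x. L2_fun u x - L2_fun v x"]
  by (simp add: L2_class_diff square_integrable_diff)

lemma L2_fun_add: "AE x in lebesgue. L2_fun (u + v) x = L2_fun u x + L2_fun v x"
  using L2_fun_L2_class[of "\<lambda>x. L2_fun u x + L2_fun v x"]
  by (simp add: L2_class_add square_integrable_add)

lemma L2_fun_scaleR: "AE x in lebesgue. L2_fun (c *\<^sub>R u) x = c *\<^sub>R L2_fun u x"
  using L2_fun_L2_class[of "\<lambda>x. c *\<^sub>R L2_fun u x"]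
  by (simp add: L2_class_scaleR square_integrable_scaleR)

lemma norm_diff_L2:
  "(norm (u - v))\<^sup>2 = (\<integral>x. (norm (L2_fun u x - L2_fun v x))\<^sup>2 \<partial>lebesgue)"
  using norm_L2_class[of "\<lambda>x. L2_fun u x - L2_fun v x"]
  by (simp add: L2_class_diff square_integrable_diff)

instance L2 :: (euclidean_space, euclidean_space) banach
proof
  fix X :: "nat \<Rightarrow> ('a, 'b) L2"
  assume "Cauchy X"
  then have "\<forall>k. \<exists>N. \<forall>m\<ge>N. \<forall>n\<ge>N. norm (X m - X n) < (1/4)^k"
    by (auto simp: Cauchy_def dist_norm)
  then obtain N where N: "\<And>k m n. m \<ge> N k \<Longrightarrow> n \<ge> N k \<Longrightarrow> norm (X m - X n) < (1/4)^k"
    by metis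
  define r where "r k = (\<Sum>i\<le>k. N i)" for k
  have r_ge: "N k \<le> r j" if "k \<le> j" for k j
    unfolding r_def using that by (intro member_le_sum) auto
  define f where "f k = L2_fun (X (r k))" for k
  define d where "d k x = norm (f (Suc k) x - f k x)" for k x
  have [measurable]: "f k \<in> borel_measurable lebesgue" for k
    unfolding f_def by measurable
  have [measurable]: "d k \<in> borel_measurable lebesgue" for k
    unfolding d_def by measurable
  have sq_f: "square_integrable (f k)" for k
    unfolding f_def by simp
  have d_int: "integrable lebesgue (\<lambda>x. (d k x)\<^sup>2)" for k
    using square_integrable_diff[OF sq_f sq_f, of "Suc k" k]
    by (simp add: d_def square_integrable_def)
  have d_bound: "(\<integral>x. (d k x)\<^sup>2 \<partial>lebesgue) \<le> (1/16)^k" for k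
  proof -
    have "(\<integral>x. (d k x)\<^sup>2 \<partial>lebesgue) = (norm (X (r (Suc k)) - X (r k)))\<^sup>2"
      by (simp add: norm_diff_L2 d_def f_def)
    also have "\<dots> \<le> ((1/4)^k)\<^sup>2"
      using N[of k "r (Suc k)" "r k"] r_ge[of k "Suc k"] r_ge[of k k]
      by (intro power_mono) auto
    also have "\<dots> = (1/16)^k"
      by (simp add: power2_eq_square flip: power_mult_distrib)
    finally show ?thesis .
  qed
  have "(\<integral>\<^sup>+x. (\<Sum>k. ennreal (4^k * (d k x)\<^sup>2)) \<partial>lebesgue)
      = (\<Sum>k. \<integral>\<^sup>+x. ennreal (4^k * (d k x)\<^sup>2) \<partial>lebesgue)"
    by (rule nn_integral_suminf) measurable
  also have "\<dots> \<le> (\<Sum>k. ennreal ((1/4)^k))"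
  proof (rule suminf_le)
    fix k
    have "(\<integral>\<^sup>+x. ennreal (4^k * (d k x)\<^sup>2) \<partial>lebesgue) = ennreal (\<integral>x. 4^k * (d k x)\<^sup>2 \<partial>lebesgue)"
      using d_int by (intro nn_integral_eq_integral) auto
    also have "\<dots> \<le> ennreal (4^k * (1/16)^k)"
      using d_bound[of k] by (intro ennreal_leI) simp
    also have "4^k * (1/16)^k = (1/4::real)^k"
      by (simp flip: power_mult_distrib)
    finally show "(\<integral>\<^sup>+x. ennreal (4^k * (d k x)\<^sup>2) \<partial>lebesgue) \<le> ennreal ((1/4)^k)" .
  qed auto
  also have "\<dots> = ennreal (\<Sum>k. (1/4)^k)"
    by (intro suminf_ennreal2) (auto intro!: summable_geometric)
  also have "\<dots> < \<infinity>"
    by simp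
  finally have "AE x in lebesgue. (\<Sum>k. ennreal (4^k * (d k x)\<^sup>2)) \<noteq> \<infinity>"
    by (intro nn_integral_PInf_AE) auto
  then have "AE x in lebesgue. convergent (\<lambda>k. f k x)"
  proof (rule eventually_mono)
    fix x
    assume fin: "(\<Sum>k. ennreal (4^k * (d k x)\<^sup>2)) \<noteq> \<infinity>"
    define S where "S = (\<Sum>k. ennreal (4^k * (d k x)\<^sup>2))"
    have "S \<noteq> \<infinity>"
      using fin unfolding S_def .
    then obtain B where "S = ennreal B" and "0 \<le> B"
      by (cases S) auto
    then have B: "(\<Sum>k. ennreal (4^k * (d k x)\<^sup>2)) = ennreal B" "0 \<le> B"
      unfolding S_def .
    have "norm (f (Suc k) x - f k x) \<le> sqrt B * (1/2)^k" for k
    proof -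
      have "(\<Sum>k\<in>{k}. ennreal (4^k * (d k x)\<^sup>2)) \<le> (\<Sum>k. ennreal (4^k * (d k x)\<^sup>2))"
        by (rule sum_le_suminf[OF summableI]) auto
      then have "ennreal (4^k * (d k x)\<^sup>2) \<le> ennreal B"
        unfolding B(1) by simp
      then have "4^k * (d k x)\<^sup>2 \<le> B"
        using B by simp
      moreover have "(2^k)\<^sup>2 = (4::real)^k"
        by (simp add: power2_eq_square flip: power_mult_distrib)
      ultimately have "(2^k * d k x)\<^sup>2 \<le> B"
        by (simp add: power_mult_distrib)
      then have "2^k * d k x \<le> sqrt B"
        by (rule real_le_rsqrt)
      then show ?thesis
        by (simp add: d_def field_simps)
    qed
    moreover have "summable (\<lambda>k. sqrt B * (1/2)^k)"
      by (intro summable_mult summable_geometric) simp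
    ultimately have "summable (\<lambda>k. f (Suc k) x - f k x)"
      using summable_comparison_test'[of "\<lambda>k. sqrt B * (1/2)^k" 0 "\<lambda>k. f (Suc k) x - f k x"]
      by blast
    then have "convergent (\<lambda>n. \<Sum>k<n. f (Suc k) x - f k x)"
      by (simp add: summable_iff_convergent)
    then have "convergent (\<lambda>n. f n x - f 0 x)"
      unfolding sum_lessThan_telescope[of "\<lambda>k. f k x"] .
    from convergent_add[OF this convergent_const[of "f 0 x"]] show "convergent (\<lambda>k. f k x)"
      by simp
  qed
  then have f_lim: "AE x in lebesgue. (\<lambda>k. f k x) \<longlonglongrightarrow> lim (\<lambda>k. f k x)"
    by (simp add: convergent_LIMSEQ_iff)
  define g where "g x = lim (\<lambda>k. f k x)" for x
  have [measurable]: "g \<in> borel_measurable lebesgue"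
    unfolding g_def by measurable
  have g_bound: "(\<integral>\<^sup>+x. ennreal ((norm (f n x - g x))\<^sup>2) \<partial>lebesgue) \<le> ennreal (((1/4)^n)\<^sup>2)" for n
  proof -
    have "(\<integral>\<^sup>+x. ennreal ((norm (f n x - g x))\<^sup>2) \<partial>lebesgue)
        = (\<integral>\<^sup>+x. liminf (\<lambda>m. ennreal ((norm (f n x - f m x))\<^sup>2)) \<partial>lebesgue)"
      using f_lim
    proof (intro nn_integral_cong_AE, elim eventually_mono)
      fix x
      assume "(\<lambda>k. f k x) \<longlonglongrightarrow> lim (\<lambda>k. f k x)"
      then have "(\<lambda>m. ennreal ((norm (f n x - f m x))\<^sup>2)) \<longlonglongrightarrow> ennreal ((norm (f n x - g x))\<^sup>2)"
        unfolding g_def by (intro tendsto_intros) auto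
      from lim_imp_Liminf[OF trivial_limit_sequentially this]
      show "ennreal ((norm (f n x - g x))\<^sup>2) = liminf (\<lambda>m. ennreal ((norm (f n x - f m x))\<^sup>2))"
        by (rule sym)
    qed
    also have "\<dots> \<le> liminf (\<lambda>m. \<integral>\<^sup>+x. ennreal ((norm (f n x - f m x))\<^sup>2) \<partial>lebesgue)"
      by (rule nn_integral_liminf) measurable
    also have "\<dots> \<le> ennreal (((1/4)^n)\<^sup>2)"
    proof (rule Liminf_le)
      have "(\<integral>\<^sup>+x. ennreal ((norm (f n x - f m x))\<^sup>2) \<partial>lebesgue) \<le> ennreal (((1/4)^n)\<^sup>2)" if "m \<ge> n" for m
      proof -
        have "(\<integral>\<^sup>+x. ennreal ((norm (f n x - f m x))\<^sup>2) \<partial>lebesgue)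
            = ennreal (\<integral>x. (norm (f n x - f m x))\<^sup>2 \<partial>lebesgue)"
          using square_integrable_diff[OF sq_f sq_f, of n m]
          by (intro nn_integral_eq_integral) (auto simp: square_integrable_def)
        also have "\<dots> = ennreal ((norm (X (r n) - X (r m)))\<^sup>2)"
          by (simp add: norm_diff_L2 f_def)
        also have "\<dots> \<le> ennreal (((1/4)^n)\<^sup>2)"
          using N[of n "r n" "r m"] r_ge[of n n] r_ge[of n m] that
          by (intro ennreal_leI power_mono) auto
        finally show ?thesis .
      qed
      then show "\<forall>\<^sub>F m in sequentially.
          (\<integral>\<^sup>+x. ennreal ((norm (f n x - f m x))\<^sup>2) \<partial>lebesgue) \<le> ennreal (((1/4)^n)\<^sup>2)"
        by (auto simp: eventually_sequentially)
    qed auto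
    finally show ?thesis .
  qed
  have sq_diff: "square_integrable (\<lambda>x. f n x - g x)" for n
    unfolding square_integrable_def
  proof
    show "integrable lebesgue (\<lambda>x. (norm (f n x - g x))\<^sup>2)"
      using g_bound[of n] by (intro integrableI_bounded) (auto intro: le_less_trans)
  qed measurable
  have sq_g: "square_integrable g"
    using square_integrable_diff[OF sq_f sq_diff, of 0 0] by simp
  define u where "u = L2_class g"
  have norm_u: "norm (X (r n) - u) \<le> (1/4)^n" for n
  proof -
    have "X (r n) - u = L2_class (\<lambda>x. f n x - g x)"
      by (simp add: L2_class_diff sq_f sq_g u_def) (simp add: f_def)
    then have "(norm (X (r n) - u))\<^sup>2 = (\<integral>x. (norm (f n x - g x))\<^sup>2 \<partial>lebesgue)"
      by (simp add: norm_L2_class sq_diff)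
    moreover have "ennreal (\<integral>x. (norm (f n x - g x))\<^sup>2 \<partial>lebesgue) \<le> ennreal (((1/4)^n)\<^sup>2)"
      using g_bound[of n] sq_diff[of n]
      by (subst nn_integral_eq_integral[symmetric]) (auto simp: square_integrable_def)
    ultimately have "(norm (X (r n) - u))\<^sup>2 \<le> ((1/4)^n)\<^sup>2"
      by (simp add: ennreal_le_iff)
    then show ?thesis
      by (rule power2_le_imp_le) simp
  qed
  have "X \<longlonglongrightarrow> u"
  proof (rule LIMSEQ_I)
    fix e :: real
    assume "e > 0"
    then obtain k where k: "(1/4::real)^k < e / 2"
      using real_arch_pow_inv[of "e/2" "1/4"] by auto
    have "norm (X n - u) < e" if "n \<ge> N k" for n
    proof -
      have "norm (X n - u) \<le> norm (X n - X (r k)) + norm (X (r k) - u)"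
        using norm_triangle_ineq[of "X n - X (r k)" "X (r k) - u"] by simp
      also have "\<dots> < e"
        using N[of k n "r k"] r_ge[of k k] that norm_u[of k] k by simp
      finally show ?thesis .
    qed
    then show "\<exists>no. \<forall>n\<ge>no. norm (X n - u) < e"
      by blast
  qed
  then show "convergent X"
    by (rule convergentI)
qed

lemma L2_dominated_convergence:
  fixes f :: "'a::euclidean_space \<Rightarrow> 'b::euclidean_space"
  assumes f: "square_integrable f" and s: "\<And>n. square_integrable (s n)"
    and lim: "AE x in lebesgue. (\<lambda>n. s n x) \<longlonglongrightarrow> f x"
    and w: "integrable lebesgue w"
    and bound: "\<And>n. AE x in lebesgue. (norm (s n x - f x))\<^sup>2 \<le> w x"
  shows "(\<lambda>n. L2_class (s n)) \<longlonglongrightarrow> L2_class f"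
proof -
  have [measurable]: "f \<in> borel_measurable lebesgue" "s n \<in> borel_measurable lebesgue" for n
    using f s by auto
  have eq: "(norm (L2_class (s n) - L2_class f))\<^sup>2 = (\<integral>x. (norm (s n x - f x))\<^sup>2 \<partial>lebesgue)" for n
    using f s by (simp add: norm_L2_class square_integrable_diff flip: L2_class_diff)
  have "(\<lambda>n. \<integral>x. (norm (s n x - f x))\<^sup>2 \<partial>lebesgue) \<longlonglongrightarrow> (\<integral>x. 0 \<partial>(lebesgue :: 'a measure))"
  proof (rule integral_dominated_convergence[OF _ _ w])
    show "AE x in lebesgue. (\<lambda>n. (norm (s n x - f x))\<^sup>2) \<longlonglongrightarrow> 0"
      using lim
    proof (rule eventually_mono)
      fix x assume "(\<lambda>n. s n x) \<longlonglongrightarrow> f x"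
      then have "(\<lambda>n. (norm (s n x - f x))\<^sup>2) \<longlonglongrightarrow> (norm (f x - f x))\<^sup>2"
        by (intro tendsto_intros)
      then show "(\<lambda>n. (norm (s n x - f x))\<^sup>2) \<longlonglongrightarrow> 0"
        by simp
    qed
  qed (use bound in \<open>auto elim!: eventually_mono\<close>)
  then have "(\<lambda>n. (norm (L2_class (s n) - L2_class f))\<^sup>2) \<longlonglongrightarrow> 0"
    by (simp add: eq)
  then have "(\<lambda>n. sqrt ((norm (L2_class (s n) - L2_class f))\<^sup>2)) \<longlonglongrightarrow> sqrt 0"
    by (intro tendsto_intros)
  then show ?thesis
    by (simp add: LIM_zero_iff tendsto_norm_zero_iff)
qed

text \<open>Rational combinations of indicators of finite unions of rational boxes; used only to show
  separability.\<close>

definition step_gen :: "('a::euclidean_space, 'b::euclidean_space) L2 set" where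
  "step_gen = (\<lambda>(F, b). L2_class (\<lambda>x. indicat_real (\<Union>F) x *\<^sub>R b)) `
     ({F. finite F \<and> F \<subseteq> {box c d |c d. (\<forall>i\<in>Basis. c \<bullet> i \<in> \<rat> \<and> d \<bullet> i \<in> \<rat>)}} \<times> Basis)"

lemma countable_rational_points: "countable {c::'a::euclidean_space. \<forall>i\<in>Basis. c \<bullet> i \<in> \<rat>}"
proof (rule countable_subset)
  show "{c::'a. \<forall>i\<in>Basis. c \<bullet> i \<in> \<rat>} \<subseteq> (\<lambda>f. \<Sum>i\<in>Basis. f i *\<^sub>R i) ` (Basis \<rightarrow>\<^sub>E \<rat>)"
  proof
    fix c :: 'a
    assume "c \<in> {c. \<forall>i\<in>Basis. c \<bullet> i \<in> \<rat>}"
    then show "c \<in> (\<lambda>f. \<Sum>i\<in>Basis. f i *\<^sub>R i) ` (Basis \<rightarrow>\<^sub>E \<rat>)"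
      by (intro image_eqI[of _ _ "restrict (\<lambda>i. c \<bullet> i) Basis"])
         (auto simp: euclidean_representation)
  qed
  show "countable ((\<lambda>f. \<Sum>i\<in>(Basis::'a set). f i *\<^sub>R i) ` (Basis \<rightarrow>\<^sub>E \<rat>))"
    by (intro countable_image countable_PiE) (auto simp: countable_rat)
qed

lemma countable_rational_boxes:
  "countable {box c d |c d :: 'a::euclidean_space. (\<forall>i\<in>Basis. c \<bullet> i \<in> \<rat> \<and> d \<bullet> i \<in> \<rat>)}"
proof (rule countable_subset)
  let ?R = "{c::'a. \<forall>i\<in>Basis. c \<bullet> i \<in> \<rat>}"
  show "{box c d |c d :: 'a. (\<forall>i\<in>Basis. c \<bullet> i \<in> \<rat> \<and> d \<bullet> i \<in> \<rat>)} \<subseteq> (\<lambda>(c, d). box c d) ` (?R \<times> ?R)"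
    by auto
  show "countable ((\<lambda>(c, d). box c d) ` (?R \<times> ?R))"
    by (intro countable_image countable_SIGMA countable_rational_points)
qed

lemma countable_step_gen: "countable (step_gen :: ('a::euclidean_space, 'b::euclidean_space) L2 set)"
  unfolding step_gen_def
  by (intro countable_image countable_SIGMA countable_Collect_finite_subset countable_rational_boxes)
     (simp add: countable_finite)

definition step_dense :: "('a::euclidean_space, 'b::euclidean_space) L2 set" where
  "step_dense = (\<lambda>xs. \<Sum>(r, g)\<leftarrow>xs. r *\<^sub>R g) ` lists (\<rat> \<times> step_gen)"

lemma countable_step_dense:
  "countable (step_dense :: ('a::euclidean_space, 'b::euclidean_space) L2 set)"
  unfolding step_dense_def
  by (intro countable_image countable_lists countable_SIGMA countable_rat countable_step_gen)

lemma step_dense_add: "u \<in> step_dense \<Longrightarrow> v \<in> step_dense \<Longrightarrow> u + v \<in> step_dense"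
proof -
  assume "u \<in> step_dense" "v \<in> step_dense"
  then obtain xs ys where xs: "xs \<in> lists (\<rat> \<times> step_gen)" "u = (\<Sum>(r, g)\<leftarrow>xs. r *\<^sub>R g)"
    and ys: "ys \<in> lists (\<rat> \<times> step_gen)" "v = (\<Sum>(r, g)\<leftarrow>ys. r *\<^sub>R g)"
    unfolding step_dense_def by blast
  show ?thesis
    unfolding step_dense_def
    by (rule image_eqI[of _ _ "xs @ ys"]) (use xs ys in auto)
qed

lemma step_dense_scaleR:
  assumes "u \<in> step_dense" and c: "c \<in> \<rat>"
  shows "c *\<^sub>R u \<in> step_dense"
proof -
  obtain xs where xs: "xs \<in> lists (\<rat> \<times> step_gen)" "u = (\<Sum>(r, g)\<leftarrow>xs. r *\<^sub>R g)"
    using assms(1) unfolding step_dense_def by blast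
  have "c *\<^sub>R (\<Sum>(r, g)\<leftarrow>xs. r *\<^sub>R g) = (\<Sum>(r, g)\<leftarrow>map (\<lambda>(r, g). (c * r, g)) xs. r *\<^sub>R g)"
    by (induction xs) (auto simp: scaleR_add_right)
  moreover have "map (\<lambda>(r, g). (c * r, g)) xs \<in> lists (\<rat> \<times> step_gen)"
    using xs(1) c by (induction xs) auto
  ultimately show ?thesis
    unfolding step_dense_def xs(2) by (intro image_eqI)
qed

lemma closure_step_dense_add:
  assumes "u \<in> closure step_dense" "v \<in> closure step_dense"
  shows "u + v \<in> closure step_dense"
proof -
  obtain s t where "\<And>n. s n \<in> step_dense" "s \<longlonglongrightarrow> u" "\<And>n. t n \<in> step_dense" "t \<longlonglongrightarrow> v"
    using assms unfolding closure_sequential by blast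
  then show ?thesis
    unfolding closure_sequential
    by (intro exI[of _ "\<lambda>n. s n + t n"] conjI allI step_dense_add tendsto_add)
qed

lemma closure_step_dense_scaleR:
  assumes "u \<in> closure step_dense"
  shows "c *\<^sub>R u \<in> closure step_dense"
proof -
  obtain s where s: "\<And>n. s n \<in> step_dense" "s \<longlonglongrightarrow> u"
    using assms unfolding closure_sequential by blast
  have "c \<in> closure \<rat>"
    by (simp add: Rats_closure_real)
  then obtain t where t: "\<And>n. t n \<in> \<rat>" "t \<longlonglongrightarrow> c"
    unfolding closure_sequential by blast
  show ?thesis
    unfolding closure_sequential
    using s t by (intro exI[of _ "\<lambda>n. t n *\<^sub>R s n"] conjI allI step_dense_scaleR tendsto_scaleR)
qed

lemma step_gen_in_dense: "g \<in> step_gen \<Longrightarrow> g \<in> step_dense"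
  unfolding step_dense_def by (rule image_eqI[of _ _ "[(1, g)]"]) auto

lemma closure_step_dense_sum:
  assumes "finite A" "\<And>i. i \<in> A \<Longrightarrow> h i \<in> closure step_dense" "A \<noteq> {}"
  shows "(\<Sum>i\<in>A. h i) \<in> closure step_dense"
  using assms(1,3,2) by (induction A rule: finite_ne_induct) (auto intro: closure_step_dense_add)

lemma square_integrable_indicator:
  assumes "A \<in> lmeasurable"
  shows "square_integrable (\<lambda>x. indicat_real A x *\<^sub>R b)"
proof (rule square_integrable_bound)
  show "integrable lebesgue (\<lambda>x. indicat_real A x * (norm b)\<^sup>2)"
    using assms by (intro integrable_mult_left) (auto simp: fmeasurable_def integrable_indicator_iff)
  show "(\<lambda>x. indicat_real A x *\<^sub>R b) \<in> borel_measurable lebesgue"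
    using assms by (intro borel_measurable_scaleR borel_measurable_indicator) auto
qed (auto simp: indicator_def power_mult_distrib)

lemma L2_open_in_closure:
  fixes U :: "'a::euclidean_space set" and b :: "'b::euclidean_space"
  assumes U: "open U" "U \<in> lmeasurable" and b: "b \<in> Basis"
  shows "L2_class (\<lambda>x. indicat_real U x *\<^sub>R b) \<in> closure step_dense"
proof -
  let ?R = "{box c d |c d :: 'a. (\<forall>i\<in>Basis. c \<bullet> i \<in> \<rat> \<and> d \<bullet> i \<in> \<rat>)}"
  define I where "I = {B \<in> ?R. B \<subseteq> U}"
  have "countable I"
    unfolding I_def by (rule countable_subset[OF _ countable_rational_boxes]) auto
  have "{} \<in> I"
  proof -
    have "box 0 0 \<in> ?R" by (auto intro!: exI[of _ 0])
    then show ?thesis by (simp add: I_def)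
  qed
  have UI: "U = \<Union>I"
  proof
    show "U \<subseteq> \<Union>I"
    proof
      fix x assume "x \<in> U"
      then obtain e where e: "e > 0" "ball x e \<subseteq> U"
        using U(1) open_contains_ball by blast
      obtain c d where "\<forall>i\<in>Basis. c \<bullet> i \<in> \<rat> \<and> d \<bullet> i \<in> \<rat>" "x \<in> box c d" "box c d \<subseteq> ball x e"
        using rational_boxes[OF e(1)] by metis
      then show "x \<in> \<Union>I"
        using e by (auto simp: I_def)
    qed
  qed (auto simp: I_def)
  define F where "F n = from_nat_into I ` {..n}" for n
  have range_I: "range (from_nat_into I) = I"
    using \<open>countable I\<close> \<open>{} \<in> I\<close> by (intro range_from_nat_into) auto
  have F: "finite (F n)" "F n \<subseteq> I" for n
    using range_I by (auto simp: F_def)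
  have gen: "L2_class (\<lambda>x. indicat_real (\<Union>(F n)) x *\<^sub>R b) \<in> step_gen" for n
    unfolding step_gen_def
    by (rule image_eqI[of _ _ "(F n, b)"]) (use F[of n] b in \<open>auto simp: I_def\<close>)
  have sub: "\<Union>(F n) \<subseteq> U" for n
    using F(2)[of n] UI by auto
  have meas: "\<Union>(F n) \<in> lmeasurable" for n
  proof (rule fmeasurableI2[OF U(2) sub])
    have "open B" if "B \<in> F n" for B
      using F(2)[of n] that by (auto simp: I_def open_box)
    then have "open (\<Union>(F n))"
      by (intro open_Union ballI)
    then show "\<Union>(F n) \<in> sets lebesgue"
      by (simp add: borel_open)
  qed
  have "(\<lambda>n. L2_class (\<lambda>x. indicat_real (\<Union>(F n)) x *\<^sub>R b))
      \<longlonglongrightarrow> L2_class (\<lambda>x. indicat_real U x *\<^sub>R b)"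
  proof (rule L2_dominated_convergence)
    show "AE x in lebesgue. (\<lambda>n. indicat_real (\<Union>(F n)) x *\<^sub>R b) \<longlonglongrightarrow> indicat_real U x *\<^sub>R b"
    proof (rule AE_I2, rule tendsto_eventually)
      fix x
      show "\<forall>\<^sub>F n in sequentially. indicat_real (\<Union>(F n)) x *\<^sub>R b = indicat_real U x *\<^sub>R b"
      proof (cases "x \<in> U")
        case True
        then obtain k where "x \<in> from_nat_into I k"
          using UI range_I by (metis UnionE rangeE)
        then have "x \<in> \<Union>(F n)" if "n \<ge> k" for n
          using that by (auto simp: F_def)
        then have "indicat_real (\<Union>(F n)) x *\<^sub>R b = indicat_real U x *\<^sub>R b" if "n \<ge> k" for n
          using True that by (simp add: indicator_def)
        then show ?thesis
          unfolding eventually_sequentially by blast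
      next
        case False
        then have "x \<notin> \<Union>(F n)" for n
          using sub[of n] by blast
        then show ?thesis
          using False by (simp add: indicator_def)
      qed
    qed
    show "integrable lebesgue (indicat_real U)"
      using U by (auto simp: fmeasurable_def integrable_indicator_iff)
    show "AE x in lebesgue. (norm (indicat_real (\<Union>(F n)) x *\<^sub>R b - indicat_real U x *\<^sub>R b))\<^sup>2
        \<le> indicat_real U x" for n
      using sub[of n] b by (intro AE_I2) (auto simp: indicator_def)
  qed (use U meas in \<open>auto intro: square_integrable_indicator\<close>)
  moreover have "L2_class (\<lambda>x. indicat_real (\<Union>(F n)) x *\<^sub>R b) \<in> step_dense" for n
    using gen by (rule step_gen_in_dense)
  ultimately show ?thesis
    unfolding closure_sequential
    by (intro exI[of _ "\<lambda>n. L2_class (\<lambda>x. indicat_real (\<Union>(F n)) x *\<^sub>R b)"] conjI allI)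
qed

lemma L2_indicator_Basis_in_closure:
  fixes A :: "'a::euclidean_space set" and b :: "'b::euclidean_space"
  assumes A: "A \<in> lmeasurable" and b: "b \<in> Basis"
  shows "L2_class (\<lambda>x. indicat_real A x *\<^sub>R b) \<in> closure step_dense"
proof -
  have "\<exists>v\<in>closure step_dense. dist v (L2_class (\<lambda>x. indicat_real A x *\<^sub>R b)) < e" if "e > 0" for e
  proof -
    obtain T where T: "open T" "A \<subseteq> T" "T - A \<in> lmeasurable" "emeasure lebesgue (T - A) < ennreal (e\<^sup>2)"
      using sets_lebesgue_outer_open[of A "e\<^sup>2"] A \<open>e > 0\<close> by (auto simp: fmeasurable_def)
    have "T \<in> lmeasurable"
    proof -
      have "A \<union> (T - A) = T" using T by auto
      then show ?thesis using fmeasurable.Un[OF A T(3)] by simp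
    qed
    have eq: "L2_class (\<lambda>x. indicat_real T x *\<^sub>R b) - L2_class (\<lambda>x. indicat_real A x *\<^sub>R b)
        = L2_class (\<lambda>x. indicat_real (T - A) x *\<^sub>R b)"
    proof (subst L2_class_diff[symmetric])
      show "L2_class (\<lambda>x. indicat_real T x *\<^sub>R b - indicat_real A x *\<^sub>R b)
          = L2_class (\<lambda>x. indicat_real (T - A) x *\<^sub>R b)"
        using T(2) by (intro arg_cong[where f=L2_class] ext) (auto simp: indicator_def)
    qed (use \<open>T \<in> lmeasurable\<close> A in \<open>auto intro: square_integrable_indicator\<close>)
    have "(norm (indicat_real (T - A) x *\<^sub>R b))\<^sup>2 = indicat_real (T - A) x" for x
      using b by (auto simp: indicator_def)
    then have "(norm (L2_class (\<lambda>x. indicat_real (T - A) x *\<^sub>R b)))\<^sup>2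
        = (\<integral>x. indicat_real (T - A) x \<partial>lebesgue)"
      by (simp only: norm_L2_class[OF square_integrable_indicator[OF T(3)]])
    also have "\<dots> = measure lebesgue (T - A)"
      using T(3) by simp
    also have "\<dots> < e\<^sup>2"
      using T(3,4) \<open>e > 0\<close> by (simp add: emeasure_eq_measure2 ennreal_less_iff)
    finally have "norm (L2_class (\<lambda>x. indicat_real (T - A) x *\<^sub>R b)) < e"
      using \<open>e > 0\<close> by (simp add: power2_less_imp_less)
    then show ?thesis
      using L2_open_in_closure[OF T(1) \<open>T \<in> lmeasurable\<close> b]
      by (intro bexI) (simp_all only: dist_norm eq)
  qed
  then have "L2_class (\<lambda>x. indicat_real A x *\<^sub>R b) \<in> closure (closure step_dense)"
    unfolding closure_approachable[of _ "closure step_dense"] by (intro allI impI)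
  then show ?thesis
    by simp
qed

lemma L2_class_sum:
  assumes "finite A" "\<And>i. i \<in> A \<Longrightarrow> square_integrable (h i)"
  shows "L2_class (\<lambda>x. \<Sum>i\<in>A. h i x) = (\<Sum>i\<in>A. L2_class (h i))
      \<and> square_integrable (\<lambda>x. \<Sum>i\<in>A. h i x)"
  using assms
  by (induction A rule: finite_induct)
     (auto simp: L2_class_0 square_integrable_0 L2_class_add square_integrable_add)

lemma L2_indicator_in_closure:
  fixes A :: "'a::euclidean_space set" and c :: "'b::euclidean_space"
  assumes A: "A \<in> lmeasurable"
  shows "L2_class (\<lambda>x. indicat_real A x *\<^sub>R c) \<in> closure step_dense"
proof -
  have "(\<lambda>x. indicat_real A x *\<^sub>R c) = (\<lambda>x. \<Sum>b\<in>Basis. (c \<bullet> b) *\<^sub>R (indicat_real A x *\<^sub>R b))"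
  proof
    fix x
    have "indicat_real A x *\<^sub>R c = indicat_real A x *\<^sub>R (\<Sum>b\<in>Basis. (c \<bullet> b) *\<^sub>R b)"
      by (simp add: euclidean_representation)
    also have "\<dots> = (\<Sum>b\<in>Basis. (c \<bullet> b) *\<^sub>R (indicat_real A x *\<^sub>R b))"
      by (simp add: scaleR_sum_right mult.commute)
    finally show "indicat_real A x *\<^sub>R c = (\<Sum>b\<in>Basis. (c \<bullet> b) *\<^sub>R (indicat_real A x *\<^sub>R b))" .
  qed
  moreover have "L2_class (\<lambda>x. \<Sum>b\<in>Basis. (c \<bullet> b) *\<^sub>R (indicat_real A x *\<^sub>R b))
      = (\<Sum>b\<in>Basis. (c \<bullet> b) *\<^sub>R L2_class (\<lambda>x. indicat_real A x *\<^sub>R b))"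
    using A by (subst L2_class_sum[THEN conjunct1])
      (auto intro!: sum.cong square_integrable_scaleR square_integrable_indicator L2_class_scaleR
        simp del: scaleR_scaleR)
  ultimately show ?thesis
    using A by (auto intro!: closure_step_dense_sum closure_step_dense_scaleR
        L2_indicator_Basis_in_closure)
qed

lemma closure_step_dense: "closure step_dense = (UNIV :: ('a::euclidean_space, 'b::euclidean_space) L2 set)"
proof -
  have "u \<in> closure step_dense" for u :: "('a, 'b) L2"
  proof -
    define f where "f = L2_fun u"
    have [measurable]: "f \<in> borel_measurable lebesgue"
      unfolding f_def by measurable
    have sq: "square_integrable f"
      by (simp add: f_def)
    obtain s where s: "\<And>i. simple_function lebesgue (s i)"
        "\<And>x. (\<lambda>i. s i x) \<longlonglongrightarrow> f x" "\<And>i x. norm (s i x) \<le> 2 * norm (f x)"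
      using borel_measurable_implies_sequence_metric[of f lebesgue 0] by (auto simp: dist_norm)
    have [measurable]: "s i \<in> borel_measurable lebesgue" for i
      using s(1) by (rule borel_measurable_simple_function)
    have int: "integrable lebesgue (\<lambda>x. (norm (f x))\<^sup>2)"
      using sq by (simp add: square_integrable_def)
    have sq_s: "square_integrable (s i)" for i
    proof (rule square_integrable_bound)
      show "integrable lebesgue (\<lambda>x. 4 * (norm (f x))\<^sup>2)"
        using int by simp
      show "AE x in lebesgue. (norm (s i x))\<^sup>2 \<le> 4 * (norm (f x))\<^sup>2"
        using power_mono[OF s(3)[of i], of _ 2] by (intro AE_I2) (auto simp: power_mult_distrib)
    qed measurable
    have "(\<lambda>i. L2_class (s i)) \<longlonglongrightarrow> L2_class f"
    proof (rule L2_dominated_convergence[OF sq sq_s])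
      show "AE x in lebesgue. (\<lambda>n. s n x) \<longlonglongrightarrow> f x"
        using s(2) by simp
      show "integrable lebesgue (\<lambda>x. 9 * (norm (f x))\<^sup>2)"
        using int by simp
      have "norm (s i x - f x) \<le> 3 * norm (f x)" for i x
        using norm_triangle_ineq4[of "s i x" "f x"] s(3)[of i x] by simp
      then show "AE x in lebesgue. (norm (s i x - f x))\<^sup>2 \<le> 9 * (norm (f x))\<^sup>2" for i
        using power_mono[of "norm (s i x - f x)" "3 * norm (f x)" 2 for x]
        by (intro AE_I2) (auto simp: power_mult_distrib)
    qed
    moreover have "L2_class (s i) \<in> closure step_dense" for i
    proof -
      define A where "A c = s i -` {c}" for c
      have fin: "finite (range (s i))"
        using s(1)[of i] by (simp add: simple_function_def)
      have A_sets: "A c \<in> sets lebesgue" if "c \<in> range (s i)" for c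
        using s(1)[of i] that by (auto simp: simple_function_def A_def)
      have piece: "square_integrable (\<lambda>x. indicat_real (A c) x *\<^sub>R c)
          \<and> L2_class (\<lambda>x. indicat_real (A c) x *\<^sub>R c) \<in> closure step_dense" if "c \<in> range (s i)" for c
      proof (cases "c = 0")
        case True
        have "L2_class (\<lambda>x. indicat_real {} x *\<^sub>R 0) \<in> closure step_dense"
          by (rule L2_indicator_in_closure) simp
        then show ?thesis
          using True by (simp add: square_integrable_0)
      next
        case False
        have "integrable lebesgue (indicat_real (A c))"
        proof (rule Bochner_Integration.integrable_bound)
          show "integrable lebesgue (\<lambda>x. (norm (s i x))\<^sup>2 / (norm c)\<^sup>2)"
            using sq_s[of i] by (simp add: square_integrable_def)
          show "AE x in lebesgue. norm (indicat_real (A c) x) \<le> norm ((norm (s i x))\<^sup>2 / (norm c)\<^sup>2)"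
            using False by (intro AE_I2) (auto simp: A_def indicator_def)
        qed (use A_sets[OF that] in auto)
        then have "A c \<in> lmeasurable"
          using A_sets[OF that] by (auto simp: fmeasurable_def integrable_indicator_iff)
        then show ?thesis
          by (auto intro: L2_indicator_in_closure square_integrable_indicator)
      qed
      have "s i x = (\<Sum>c\<in>range (s i). indicat_real (A c) x *\<^sub>R c)" for x
      proof -
        have "(\<Sum>c\<in>range (s i). indicat_real (A c) x *\<^sub>R c) = (\<Sum>c\<in>{s i x}. indicat_real (A c) x *\<^sub>R c)"
          using fin by (intro sum.mono_neutral_right) (auto simp: A_def indicator_def)
        then show ?thesis
          by (simp add: A_def)
      qed
      then have "s i = (\<lambda>x. \<Sum>c\<in>range (s i). indicat_real (A c) x *\<^sub>R c)"
        by (rule ext)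
      then have "L2_class (s i) = L2_class (\<lambda>x. \<Sum>c\<in>range (s i). indicat_real (A c) x *\<^sub>R c)"
        by (rule arg_cong)
      also have "\<dots> = (\<Sum>c\<in>range (s i). L2_class (\<lambda>x. indicat_real (A c) x *\<^sub>R c))"
        using fin piece by (intro L2_class_sum[THEN conjunct1]) auto
      also have "\<dots> \<in> closure step_dense"
        using fin piece by (intro closure_step_dense_sum) auto
      finally show ?thesis .
    qed
    ultimately have "L2_class f \<in> closure (closure step_dense)"
      unfolding closure_sequential[of _ "closure step_dense"]
      by (intro exI[of _ "\<lambda>i. L2_class (s i)"] conjI allI)
    then show ?thesis
      by (simp add: f_def)
  qed
  then show ?thesis
    by auto
qed

instance L2 :: (euclidean_space, euclidean_space) second_countable_topology
proof
  define B :: "('a, 'b) L2 set set" where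
    "B = (\<lambda>(d, n). ball d (1 / real (Suc n))) ` (step_dense \<times> UNIV)"
  have "countable B"
    unfolding B_def by (intro countable_image countable_SIGMA countable_step_dense) auto
  moreover have "topological_basis B"
  proof (rule topological_basisI)
    fix O' :: "('a, 'b) L2 set" and u
    assume "open O'" "u \<in> O'"
    then obtain e where e: "e > 0" "ball u e \<subseteq> O'"
      using open_contains_ball by blast
    obtain n where n: "1 / real (Suc n) < e / 2"
      using e(1) nat_approx_posE[of "e/2"] by auto
    have "u \<in> closure step_dense"
      by (simp add: closure_step_dense)
    then obtain d where d: "d \<in> step_dense" "dist d u < 1 / real (Suc n)"
      unfolding closure_approachable by (meson of_nat_0_less_iff zero_less_Suc zero_less_divide_1_iff)
    have "ball d (1 / real (Suc n)) \<subseteq> ball u e"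
    proof
      fix v assume "v \<in> ball d (1 / real (Suc n))"
      then have "dist u v < 1 / real (Suc n) + 1 / real (Suc n)"
        using d(2) dist_triangle[of u v d] by (simp add: dist_commute)
      then show "v \<in> ball u e"
        using n by simp
    qed
    moreover have "ball d (1 / real (Suc n)) \<in> B"
      unfolding B_def by (rule image_eqI[of _ _ "(d, n)"]) (use d in auto)
    ultimately show "\<exists>B'\<in>B. u \<in> B' \<and> B' \<subseteq> O'"
      using d(2) e(2) by (intro bexI[of _ "ball d (1 / real (Suc n))"]) (auto simp: dist_commute)
  qed (auto simp: B_def)
  ultimately show "\<exists>B::('a, 'b) L2 set set. countable B \<and> open = generate_topology B"
    using topological_basis_imp_subbasis by blast
qed

section \<open>Function spaces on a domain\<close>

text \<open>Extension by zero identifies the square-integrable functions on \<open>\<Omega>\<close> isometrically with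
  \<open>L2_on \<Omega>\<close>; norm and inner product are the ambient ones.\<close>

definition L2_on :: "'a::euclidean_space set \<Rightarrow> ('a, 'b::euclidean_space) L2 set" where
  "L2_on \<Omega> = {u. AE x in lebesgue. x \<notin> \<Omega> \<longrightarrow> L2_fun u x = 0}"

definition Linf :: "'a::euclidean_space set \<Rightarrow> ('a \<Rightarrow> real) \<Rightarrow> bool" where
  "Linf \<Omega> f \<longleftrightarrow> f \<in> borel_measurable (lebesgue_on \<Omega>)
     \<and> esssup (lebesgue_on \<Omega>) (\<lambda>x. ereal \<bar>f x\<bar>) < \<infinity>"

definition Linf_norm :: "'a::euclidean_space set \<Rightarrow> ('a \<Rightarrow> real) \<Rightarrow> real" where
  "Linf_norm \<Omega> f = real_of_ereal (esssup (lebesgue_on \<Omega>) (\<lambda>x. ereal \<bar>f x\<bar>))"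

text \<open>Near each boundary point the domain is, in suitably rotated coordinates, the strict epigraph of
  a Lipschitz function \<open>\<gamma>\<close> on the hyperplane orthogonal to the unit vector \<open>e\<close>.\<close>

definition lipschitz_boundary :: "'a::euclidean_space set \<Rightarrow> bool" where
  "lipschitz_boundary \<Omega> \<longleftrightarrow> (\<forall>x0\<in>frontier \<Omega>. \<exists>e r L \<gamma>.
     norm e = 1 \<and> 0 < r \<and> L-lipschitz_on {v. v \<bullet> e = 0} \<gamma> \<and>
     \<Omega> \<inter> ball x0 r = {x \<in> ball x0 r. \<gamma> (x - (x \<bullet> e) *\<^sub>R e) < x \<bullet> e})"

definition bounded_lipschitz_domain :: "'a::euclidean_space set \<Rightarrow> bool" where
  "bounded_lipschitz_domain \<Omega> \<longleftrightarrow>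
     open \<Omega> \<and> connected \<Omega> \<and> \<Omega> \<noteq> {} \<and> bounded \<Omega> \<and> lipschitz_boundary \<Omega>"

primrec C_k :: "nat \<Rightarrow> ('a::euclidean_space \<Rightarrow> real) \<Rightarrow> bool" where
  "C_k 0 f \<longleftrightarrow> continuous_on UNIV f"
| "C_k (Suc k) f \<longleftrightarrow>
     (\<forall>x. f differentiable at x) \<and> (\<forall>v. C_k k (\<lambda>x. frechet_derivative f (at x) v))"

definition test_functions :: "'a::euclidean_space set \<Rightarrow> ('a \<Rightarrow> real) set" where
  "test_functions \<Omega> = {\<phi>. (\<forall>k. C_k k \<phi>)
     \<and> compact (closure {x. \<phi> x \<noteq> 0}) \<and> closure {x. \<phi> x \<noteq> 0} \<subseteq> \<Omega>}"

definition has_weak_gradient ::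
  "'a::euclidean_space set \<Rightarrow> ('a, real) L2 \<Rightarrow> ('a, 'a) L2 \<Rightarrow> bool" where
  "has_weak_gradient \<Omega> w g \<longleftrightarrow> (\<forall>\<phi>\<in>test_functions \<Omega>. \<forall>i\<in>Basis.
     (LINT x:\<Omega>|lebesgue. L2_fun w x * frechet_derivative \<phi> (at x) i)
       = - (LINT x:\<Omega>|lebesgue. (L2_fun g x \<bullet> i) * \<phi> x))"

definition H1 :: "'a::euclidean_space set \<Rightarrow> ('a, real) L2 set" where
  "H1 \<Omega> = {w \<in> L2_on \<Omega>. \<exists>g\<in>L2_on \<Omega>. has_weak_gradient \<Omega> w g}"

text \<open>The gradient on \<open>\<Omega>\<close>, extended by zero; for \<open>w\<close> in \<open>H1 \<Omega>\<close> and open \<open>\<Omega>\<close> it is unique by the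
  fundamental lemma of the calculus of variations.\<close>

definition weak_grad :: "'a::euclidean_space set \<Rightarrow> ('a, real) L2 \<Rightarrow> ('a, 'a) L2" where
  "weak_grad \<Omega> w = (THE g. g \<in> L2_on \<Omega> \<and> has_weak_gradient \<Omega> w g)"

definition H1_norm :: "'a::euclidean_space set \<Rightarrow> ('a, real) L2 \<Rightarrow> real" where
  "H1_norm \<Omega> w = sqrt ((norm w)\<^sup>2 + (norm (weak_grad \<Omega> w))\<^sup>2)"

definition H10 :: "'a::euclidean_space set \<Rightarrow> ('a, real) L2 set" where
  "H10 \<Omega> = {w \<in> H1 \<Omega>. \<forall>\<epsilon>>0. \<exists>\<phi>\<in>test_functions \<Omega>. H1_norm \<Omega> (w - L2_class \<phi>) < \<epsilon>}"

section \<open>The parametric problem\<close>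

text \<open>Coordinates are numbered from \<open>0\<close>, so \<open>y j\<close> and \<open>\<psi> j\<close> stand for \<open>y\<^sub>j\<^sub>+\<^sub>1\<close> and
  \<open>\<psi>\<^sub>j\<^sub>+\<^sub>1\<close>, and the first \<open>s\<close> coordinates are those with \<open>j < s\<close>.\<close>

definition parameters :: "(nat \<Rightarrow> real) set" where
  "parameters = {y. \<forall>j. y j \<in> {-1/2..1/2}}"

text \<open>The interval has length one, so Lebesgue measure on it is the uniform distribution.\<close>

definition parameter_measure :: "(nat \<Rightarrow> real) measure" where
  "parameter_measure = PiM UNIV (\<lambda>_. restrict_space lborel {-1/2..1/2})"

lemma space_parameter_measure: "space parameter_measure = parameters"
  by (auto simp: parameter_measure_def parameters_def space_PiM space_restrict_space PiE_def)

lemma prob_space_parameter_measure: "prob_space parameter_measure"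
  unfolding parameter_measure_def
  by (intro prob_space_PiM prob_spaceI) (simp add: space_restrict_space emeasure_restrict_space)

definition truncation :: "nat \<Rightarrow> (nat \<Rightarrow> real) \<Rightarrow> (nat \<Rightarrow> real)" where
  "truncation s y = (\<lambda>j. if j < s then y j else 0)"

definition diffusion ::
  "('a \<Rightarrow> real) \<Rightarrow> (nat \<Rightarrow> 'a \<Rightarrow> real) \<Rightarrow> (nat \<Rightarrow> real) \<Rightarrow> 'a \<Rightarrow> real" where
  "diffusion abar \<psi> y x = abar x + (\<Sum>j. y j * \<psi> j x)"

definition bform :: "'a::euclidean_space set \<Rightarrow> ('a \<Rightarrow> real) \<Rightarrow> ('a, real) L2 \<Rightarrow> ('a, real) L2 \<Rightarrow> real"
  where "bform \<Omega> a w v =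
    (LINT x:\<Omega>|lebesgue. a x * (L2_fun (weak_grad \<Omega> w) x \<bullet> L2_fun (weak_grad \<Omega> v) x))"

definition state :: "'a::euclidean_space set \<Rightarrow> ('a \<Rightarrow> real) \<Rightarrow> ('a, real) L2 \<Rightarrow> ('a, real) L2" where
  "state \<Omega> a z = (THE u. u \<in> H10 \<Omega> \<and> (\<forall>v\<in>H10 \<Omega>. bform \<Omega> a u v = z \<bullet> v))"

definition adjoint_state ::
  "'a::euclidean_space set \<Rightarrow> ('a \<Rightarrow> real) \<Rightarrow> ('a, real) L2 \<Rightarrow> ('a, real) L2 \<Rightarrow> ('a, real) L2" where
  "adjoint_state \<Omega> a u0 z =
     (THE q. q \<in> H10 \<Omega> \<and> (\<forall>w\<in>H10 \<Omega>. bform \<Omega> a q w = (state \<Omega> a z - u0) \<bullet> w))"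

end

theory Submission
  imports Defs
begin

text \<open>The coordinates are released one at a time. Let \<open>q y\<close> be the adjoint state, let \<open>\<beta> n\<close> be the
supremum norm of \<open>\<psi> n\<close>, and let \<open>F n\<close> be the mean of \<open>q (truncation n y)\<close>. From \<open>F n\<close> to \<open>F (n + 1)\<close>
only coordinate \<open>n\<close> changes: it was \<open>0\<close> and becomes a random number \<open>t\<close> whose law is invariant under
\<open>t \<mapsto> - t\<close>. Replacing \<open>q\<close> at \<open>t\<close> by the average of its values at \<open>t\<close> and \<open>- t\<close> does not change the mean, so
\<open>F (n + 1) - F n\<close> is half the mean of a symmetric second difference of \<open>q\<close> in that coordinate
(\<open>reflection_symmetrization\<close>). The coefficient is affine in \<open>t\<close>. Subtracting the weak equations shows
that a first difference of the state solves the same equation with a load of size \<open>\<beta> n\<close>, and a second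
difference one with a load of size \<open>\<beta> n\<close> times a first difference; the adjoint state inherits
this. Hence \<open>F (n + 1) - F n\<close> is of order \<open>(\<beta> n)\<^sup>2\<close> with a constant depending only on
\<open>amin\<close> and the Poincare constant (\<open>norm_D_adj_second_diff\<close>), and
telescoping bounds the truncation error by the tail \<open>\<Sum>j\<ge>s. (\<beta> j)\<^sup>2\<close> (\<open>dimension_truncation\<close>). Cancellation
by symmetry is used in each coordinate separately, so no Taylor expansion in infinitely many variables
appears, and two orders of smoothness suffice whatever the value of \<open>p\<close>.

The rate is then elementary. Since \<open>\<beta>\<close> decreases and \<open>A = \<Sum>j. \<beta> j powr p\<close> is finite,
\<open>\<beta> j \<le> (A / s) powr (1 / p)\<close> for \<open>j \<ge> s\<close>, and writing \<open>(\<beta> j)\<^sup>2\<close> as \<open>\<beta> j powr (2 - p) * \<beta> j powr p\<close>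
gives a tail of order \<open>s powr (- (2 / p - 1))\<close> (\<open>tail_sum_squares_rate\<close>).

What remains is to see that the objects are the expected ones. Weak gradients are unique by the fundamental
lemma of the calculus of variations, for which explicit smooth bumps on boxes are built. The Poincare
inequality makes the gradient norm equivalent to the full norm on \<open>H10 \<Omega>\<close> and \<open>H10 \<Omega>\<close> complete for it
(\<open>H10_energy_space\<close>), so minimising the energy yields the state and the adjoint state
(\<open>weak_solution_exists\<close>). Finally \<open>q\<close> is Lipschitz for the distance \<open>\<Sum>j. \<beta> j * \<bar>y j - y' j\<bar>\<close>,
which is continuous for the product topology on \<open>parameters\<close>; therefore \<open>q\<close> is measurable and, being bounded,
integrable (\<open>measurable_of_weighted_lipschitz\<close>).\<close>

section \<open>Symmetric elliptic problems and their second differences\<close>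

text \<open>Abstractly, \<open>V\<close> is a space of functions with energy norm \<open>norm (D u)\<close>. The ambient norm of
\<open>'h\<close> enters only through the Poincare inequality, and completeness is required for the energy norm alone.\<close>

locale energy_space =
  fixes V :: "'h::real_inner set" and D :: "'h \<Rightarrow> 'g::real_inner" and K :: real
  assumes subspace_V: "subspace V"
    and D_add: "\<And>u v. u \<in> V \<Longrightarrow> v \<in> V \<Longrightarrow> D (u + v) = D u + D v"
    and D_scaleR: "\<And>c u. u \<in> V \<Longrightarrow> D (c *\<^sub>R u) = c *\<^sub>R D u"
    and poincare: "\<And>u. u \<in> V \<Longrightarrow> norm u \<le> K * norm (D u)"
    and K_pos: "0 < K"
    and complete_D: "\<And>x. (\<And>k. x k \<in> V) \<Longrightarrow> Cauchy (\<lambda>k::nat. D (x k))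
      \<Longrightarrow> \<exists>u\<in>V. (\<lambda>k. D (x k)) \<longlonglongrightarrow> D u"
begin

lemma V_add: "u \<in> V \<Longrightarrow> v \<in> V \<Longrightarrow> u + v \<in> V"
  and V_scaleR: "u \<in> V \<Longrightarrow> c *\<^sub>R u \<in> V"
  and V_diff: "u \<in> V \<Longrightarrow> v \<in> V \<Longrightarrow> u - v \<in> V"
  and V_0: "0 \<in> V"
  using subspace_V by (auto simp: subspace_add subspace_mul subspace_diff subspace_0)

lemma D_diff: "u \<in> V \<Longrightarrow> v \<in> V \<Longrightarrow> D (u - v) = D u - D v"
  using D_add[of u "(-1) *\<^sub>R v"] D_scaleR[of v "-1"] V_scaleR[of v "-1"] by simp

text \<open>Coercivity is demanded on gradients only. The multiplication operators used later vanish off the domain,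
so they are not coercive on the whole space of vector fields.\<close>

definition elliptic :: "real \<Rightarrow> ('g \<Rightarrow> 'g) \<Rightarrow> bool" where
  "elliptic \<alpha> A \<longleftrightarrow> 0 < \<alpha> \<and> bounded_linear A \<and> (\<forall>g h. A g \<bullet> h = g \<bullet> A h)
     \<and> (\<forall>v\<in>V. \<alpha> * (norm (D v))\<^sup>2 \<le> A (D v) \<bullet> D v)"

text \<open>Every a priori bound below is this one, applied to a solution or to a difference of solutions. The load has a part
\<open>f\<close> acting on functions and a part \<open>r\<close> acting on gradients; the latter is where a perturbation of
the coefficient ends up.\<close>

lemma energy_estimate:
  assumes A: "elliptic \<alpha> A" and e: "e \<in> V"
    and test: "A (D e) \<bullet> D e = f \<bullet> e + r \<bullet> D e"
  shows "norm (D e) \<le> (K * norm f + norm r) / \<alpha>"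
proof (cases "D e = 0")
  case True
  have "0 \<le> K * norm f" using K_pos by simp
  then show ?thesis using A True by (simp add: elliptic_def)
next
  case False
  have "\<alpha> * (norm (D e))\<^sup>2 \<le> f \<bullet> e + r \<bullet> D e"
    using A e test by (auto simp: elliptic_def)
  also have "\<dots> \<le> norm f * norm e + norm r * norm (D e)"
    by (intro add_mono norm_cauchy_schwarz)
  also have "\<dots> \<le> norm f * (K * norm (D e)) + norm r * norm (D e)"
    using poincare[OF e] by (intro add_mono mult_left_mono) auto
  finally have "(\<alpha> * norm (D e)) * norm (D e) \<le> (K * norm f + norm r) * norm (D e)"
    by (simp add: power2_eq_square algebra_simps)
  then have "\<alpha> * norm (D e) \<le> K * norm f + norm r"
    using False by simp
  then show ?thesis
    using A by (simp add: elliptic_def field_simps)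
qed

definition sol :: "('g \<Rightarrow> 'g) \<Rightarrow> 'h \<Rightarrow> 'h" where
  "sol A f = (THE u. u \<in> V \<and> (\<forall>v\<in>V. A (D u) \<bullet> D v = f \<bullet> v))"

text \<open>The operator is symmetric, so the solution is the minimiser of the energy \<open>A (D v) \<bullet> D v - 2 * (f \<bullet> v)\<close>. A
minimising sequence is Cauchy in the energy norm, and the first variation at its limit is the weak equation.\<close>

lemma weak_solution_exists:
  assumes A: "elliptic \<alpha> A"
  shows "\<exists>u\<in>V. \<forall>v\<in>V. A (D u) \<bullet> D v = f \<bullet> v"
proof -
  define B where "B u v = A (D u) \<bullet> D v" for u v
  define J where "J v = B v v - 2 * (f \<bullet> v)" for v
  have \<alpha>: "0 < \<alpha>" and coer: "\<alpha> * (norm (D v))\<^sup>2 \<le> B v v" if "v \<in> V" for v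
    using A that by (auto simp: elliptic_def B_def)
  note \<alpha> = \<alpha>[OF V_0]
  have bl: "bounded_linear A" and sym: "A g \<bullet> h = g \<bullet> A h" for g h
    using A by (auto simp: elliptic_def)
  interpret A: bounded_linear A by (rule bl)
  have B_sym: "B u v = B v u" for u v
    unfolding B_def by (metis sym inner_commute)
  have B_add: "B (u + w) v = B u v + B w v" if "u \<in> V" "w \<in> V" for u w v
    using that by (simp add: B_def D_add A.add inner_add_left)
  have B_add': "B v (u + w) = B v u + B v w" if "u \<in> V" "w \<in> V" for u w v
    using that by (simp add: B_def D_add inner_add_right)
  have B_scale: "B (c *\<^sub>R u) v = c * B u v" "B v (c *\<^sub>R u) = c * B v u" if "u \<in> V" for c u v
    using that by (simp_all add: B_def D_scaleR A.scaleR)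
  have B_diff: "B (u - w) v = B u v - B w v" "B v (u - w) = B v u - B v w"
    if "u \<in> V" "w \<in> V" for u w v
    using that by (simp_all add: B_def D_diff A.diff inner_diff_left inner_diff_right)
  define L where "L = norm f * K"
  have f_le: "\<bar>f \<bullet> v\<bar> \<le> L * norm (D v)" if "v \<in> V" for v
  proof -
    have "\<bar>f \<bullet> v\<bar> \<le> norm f * norm v" by (rule Cauchy_Schwarz_ineq2)
    also have "\<dots> \<le> norm f * (K * norm (D v))"
      using poincare[OF that] by (intro mult_left_mono) auto
    finally show ?thesis by (simp add: L_def mult.assoc)
  qed
  \<comment> \<open>Complete the square: the quadratic part outweighs the linear one.\<close>
  have J_lower: "- (L\<^sup>2 / \<alpha>) \<le> J v" if "v \<in> V" for v
  proof -
    have "0 \<le> (\<alpha> * norm (D v) - L)\<^sup>2 / \<alpha>" using \<alpha> by simp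
    also have "\<dots> = \<alpha> * (norm (D v))\<^sup>2 - 2 * (L * norm (D v)) + L\<^sup>2 / \<alpha>"
      using \<alpha> by (simp add: power2_eq_square field_simps)
    also have "\<dots> \<le> J v + L\<^sup>2 / \<alpha>"
      using coer[OF that] f_le[OF that] by (simp add: J_def)
    finally show ?thesis by simp
  qed
  define m where "m = Inf (J ` V)"
  have bdd: "bdd_below (J ` V)"
    using J_lower by (auto intro!: bdd_belowI)
  have m_le: "m \<le> J v" if "v \<in> V" for v
    unfolding m_def using bdd that by (intro cInf_lower) auto
  have "\<exists>v\<in>V. J v < m + 1 / real (Suc k)" for k
    using cInf_lessD[of "J ` V" "m + 1 / real (Suc k)"] V_0 by (auto simp: m_def)
  then obtain x where x: "\<And>k. x k \<in> V" "\<And>k. J (x k) < m + 1 / real (Suc k)"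
    by metis
  \<comment> \<open>The parallelogram identity turns almost-minimality into closeness in the energy norm.\<close>
  have close: "\<alpha> / 2 * (norm (D u - D v))\<^sup>2 \<le> J u + J v - 2 * m" if "u \<in> V" "v \<in> V" for u v
  proof -
    have mid: "(1/2) *\<^sub>R (u + v) \<in> V" using that by (intro V_scaleR V_add)
    have "J u + J v - 2 * J ((1/2) *\<^sub>R (u + v)) = B (u - v) (u - v) / 2"
      using that B_sym[of u v]
      by (simp add: J_def B_add B_add' B_scale B_diff V_add V_diff V_scaleR inner_add_right algebra_simps)
    moreover have "\<alpha> * (norm (D u - D v))\<^sup>2 \<le> B (u - v) (u - v)"
      using coer[OF V_diff[OF that]] that by (simp add: D_diff)
    ultimately show ?thesis using m_le[OF mid] by simp
  qed
  have "Cauchy (\<lambda>k. D (x k))"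
  proof (rule CauchyI)
    fix e :: real assume e: "e > 0"
    obtain N where N: "1 / real (Suc N) < \<alpha> / 4 * e\<^sup>2"
      using nat_approx_posE[of "\<alpha> / 4 * e\<^sup>2"] \<alpha> e by auto
    have "norm (D (x i) - D (x j)) < e" if "i \<ge> N" "j \<ge> N" for i j
    proof -
      have le: "1 / real (Suc i) \<le> 1 / real (Suc N)" "1 / real (Suc j) \<le> 1 / real (Suc N)"
        using that by (auto intro!: divide_left_mono)
      have "\<alpha> / 2 * (norm (D (x i) - D (x j)))\<^sup>2 < \<alpha> / 2 * e\<^sup>2"
        using close[OF x(1) x(1), of i j] x(2)[of i] x(2)[of j] le N by simp
      then have "(norm (D (x i) - D (x j)))\<^sup>2 < e\<^sup>2" using \<alpha> by simp
      then show ?thesis using e by (simp add: power2_less_imp_less)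
    qed
    then show "\<exists>M. \<forall>m\<ge>M. \<forall>n\<ge>M. norm (D (x m) - D (x n)) < e" by blast
  qed
  then obtain u where u: "u \<in> V" and lim: "(\<lambda>k. D (x k)) \<longlonglongrightarrow> D u"
    using complete_D x(1) by blast
  have "(\<lambda>k. f \<bullet> (x k - u)) \<longlonglongrightarrow> 0"
  proof (rule Lim_null_comparison)
    show "\<forall>\<^sub>F k in sequentially. norm (f \<bullet> (x k - u)) \<le> L * norm (D (x k) - D u)"
      using f_le[OF V_diff[OF x(1) u]] by (simp add: D_diff x u)
    show "(\<lambda>k. L * norm (D (x k) - D u)) \<longlonglongrightarrow> 0"
      using lim by (intro tendsto_mult_right_zero) (simp add: LIM_zero tendsto_norm_zero)
  qed
  then have "(\<lambda>k. f \<bullet> x k) \<longlonglongrightarrow> f \<bullet> u"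
    by (simp add: inner_diff_right LIM_zero_iff)
  moreover have "(\<lambda>k. B (x k) (x k)) \<longlonglongrightarrow> B u u"
    unfolding B_def by (intro tendsto_inner A.tendsto lim)
  ultimately have "(\<lambda>k. J (x k)) \<longlonglongrightarrow> J u"
    unfolding J_def by (intro tendsto_diff tendsto_mult_left)
  moreover have "(\<lambda>k. m + 1 / real (Suc k)) \<longlonglongrightarrow> m + 0"
    by (intro tendsto_intros LIMSEQ_Suc[OF lim_1_over_n])
  ultimately have "J u \<le> m"
    using x(2) by (intro LIMSEQ_le[of "\<lambda>k. J (x k)" _ "\<lambda>k. m + 1 / real (Suc k)"])
      (auto intro: less_imp_le)
  have "B u v = f \<bullet> v" if v: "v \<in> V" for v
  proof -
    define c where "c = B u v - f \<bullet> v"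
    \<comment> \<open>A parabola through the origin that is nonnegative has slope \<open>0\<close> there.\<close>
    have var: "0 \<le> 2 * t * c + t\<^sup>2 * B v v" for t
    proof -
      have "J (u + t *\<^sub>R v) = J u + 2 * t * c + t\<^sup>2 * B v v"
        using u v B_sym[of u v]
        by (simp add: J_def c_def B_add B_add' B_scale V_scaleR inner_add_right
            power2_eq_square algebra_simps)
      then show ?thesis
        using m_le[OF V_add[OF u V_scaleR[OF v]], of t] \<open>J u \<le> m\<close> by simp
    qed
    have "c = 0"
    proof (cases "B v v = 0")
      case True
      then have "c\<^sup>2 \<le> 0" using var[of "-c"] by (simp add: power2_eq_square)
      then show ?thesis by simp
    next
      case False
      moreover have "0 \<le> B v v" using coer[OF v] \<alpha> by (smt (verit) zero_le_mult_iff zero_le_power2)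
      ultimately have pos: "0 < B v v" by simp
      have "2 * (- c / B v v) * c + (- c / B v v)\<^sup>2 * B v v = - (c\<^sup>2 / B v v)"
        using pos by (simp add: power2_eq_square field_simps)
      then have "c\<^sup>2 / B v v \<le> 0" using var[of "- c / B v v"] by simp
      then have "c\<^sup>2 \<le> 0" using pos by (simp add: divide_le_0_iff)
      then show ?thesis by simp
    qed
    then show ?thesis by (simp add: c_def)
  qed
  then show ?thesis using u unfolding B_def by blast
qed

lemma sol_in_V: "elliptic \<alpha> A \<Longrightarrow> sol A f \<in> V"
  and sol_eq: "elliptic \<alpha> A \<Longrightarrow> v \<in> V \<Longrightarrow> A (D (sol A f)) \<bullet> D v = f \<bullet> v"
proof -
  assume A: "elliptic \<alpha> A"
  interpret A: bounded_linear A using A by (simp add: elliptic_def)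
  have "\<exists>!u. u \<in> V \<and> (\<forall>v\<in>V. A (D u) \<bullet> D v = f \<bullet> v)"
  proof (rule ex_ex1I)
    show "\<exists>u. u \<in> V \<and> (\<forall>v\<in>V. A (D u) \<bullet> D v = f \<bullet> v)"
      using weak_solution_exists[OF A] by blast
    fix u w assume u: "u \<in> V \<and> (\<forall>v\<in>V. A (D u) \<bullet> D v = f \<bullet> v)"
      and w: "w \<in> V \<and> (\<forall>v\<in>V. A (D w) \<bullet> D v = f \<bullet> v)"
    then have uw: "u - w \<in> V" by (simp add: V_diff)
    have "A (D (u - w)) \<bullet> g = A (D u) \<bullet> g - A (D w) \<bullet> g" for g
      using u w by (simp add: D_diff A.diff inner_diff_left)
    then have "norm (D (u - w)) \<le> (K * norm (0::'h) + norm (0::'g)) / \<alpha>"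
      using u w uw by (intro energy_estimate[OF A uw]) simp
    then have "norm (u - w) \<le> 0" using poincare[OF uw] by simp
    then show "u = w" by simp
  qed
  from theI'[OF this] show "sol A f \<in> V" "v \<in> V \<Longrightarrow> A (D (sol A f)) \<bullet> D v = f \<bullet> v"
    unfolding sol_def by auto
qed

lemma norm_D_sol: "elliptic \<alpha> A \<Longrightarrow> norm (D (sol A f)) \<le> K * norm f / \<alpha>"
  using energy_estimate[OF _ sol_in_V, of \<alpha> A \<alpha> A f f 0] sol_eq[OF _ sol_in_V, of \<alpha> A \<alpha> A f f] by simp

text \<open>The difference of the two solutions solves the problem for \<open>A\<close>, with load \<open>f' - f\<close> and the gradient
load \<open>(A - A') (D (sol A' f'))\<close>.\<close>

lemma norm_D_sol_diff:
  assumes A: "elliptic \<alpha> A" and A': "elliptic \<alpha> A'"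
    and pert: "\<And>g. norm (A' g - A g) \<le> \<delta> * norm g"
  shows "norm (D (sol A' f' - sol A f))
    \<le> (K * norm (f' - f) + \<delta> * norm (D (sol A' f'))) / \<alpha>"
proof -
  interpret A: bounded_linear A using A by (simp add: elliptic_def)
  define e where "e = sol A' f' - sol A f"
  note in_V = sol_in_V[OF A, of f] sol_in_V[OF A', of f']
  have e: "e \<in> V" using in_V by (simp add: e_def V_diff)
  have "A (D e) \<bullet> g = A (D (sol A' f')) \<bullet> g - A (D (sol A f)) \<bullet> g" for g
    using in_V by (simp add: e_def D_diff A.diff inner_diff_left)
  then have "norm (D e) \<le> (K * norm (f' - f) + norm (A (D (sol A' f')) - A' (D (sol A' f')))) / \<alpha>"
    using sol_eq[OF A e, of f] sol_eq[OF A' e, of f']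
    by (intro energy_estimate[OF A e]) (simp add: inner_diff_left)
  also have "\<dots> \<le> (K * norm (f' - f) + \<delta> * norm (D (sol A' f'))) / \<alpha>"
    using A pert[of "D (sol A' f')"] by (intro divide_right_mono) (auto simp: elliptic_def norm_minus_commute)
  finally show ?thesis by (simp add: e_def)
qed

text \<open>If \<open>A\<close> lies midway between \<open>Ap\<close> and \<open>Am\<close>, the first-order terms cancel: the gradient load for the second
difference of the solutions is \<open>A - Ap\<close> applied to a first difference, so it is small of second order.\<close>

lemma norm_D_sol_second_diff:
  assumes A: "elliptic \<alpha> A" and Ap: "elliptic \<alpha> Ap" and Am: "elliptic \<alpha> Am"
    and sym: "\<And>g. Ap g - A g = A g - Am g"
    and pert: "\<And>g. norm (Ap g - A g) \<le> \<delta> * norm g"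
  shows "norm (D (sol Ap fp + sol Am fm - 2 *\<^sub>R sol A f))
    \<le> (K * norm (fp + fm - 2 *\<^sub>R f) + \<delta> * norm (D (sol Ap fp - sol Am fm))) / \<alpha>"
proof -
  interpret A: bounded_linear A using A by (simp add: elliptic_def)
  interpret Ap: bounded_linear Ap using Ap by (simp add: elliptic_def)
  interpret Am: bounded_linear Am using Am by (simp add: elliptic_def)
  define up um u where "up = sol Ap fp" and "um = sol Am fm" and "u = sol A f"
  have V: "up \<in> V" "um \<in> V" "u \<in> V"
    using sol_in_V A Ap Am unfolding up_def um_def u_def by blast+
  define e where "e = up + um - 2 *\<^sub>R u"
  have e: "e \<in> V" using V by (simp add: e_def V_diff V_add V_scaleR)
  have De: "D e = D up + D um - 2 *\<^sub>R D u"
    using V by (simp add: e_def D_diff D_add D_scaleR V_add V_scaleR)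
  define r where "r = A (D (up - um)) - Ap (D (up - um))"
  have r: "r = A (D up) - Ap (D up) + A (D um) - Am (D um)"
    using V sym[of "D um"] by (simp add: r_def D_diff A.diff Ap.diff algebra_simps)
  have eq: "Ap (D up) \<bullet> D e = fp \<bullet> e" "Am (D um) \<bullet> D e = fm \<bullet> e" "A (D u) \<bullet> D e = f \<bullet> e"
    using sol_eq[OF Ap e] sol_eq[OF Am e] sol_eq[OF A e] unfolding up_def um_def u_def by auto
  have "A (D e) \<bullet> D e = A (D up) \<bullet> D e + A (D um) \<bullet> D e - 2 * (A (D u) \<bullet> D e)"
    unfolding De A.diff A.add A.scaleR by (simp add: inner_diff_left inner_add_left)
  also have "\<dots> = (fp + fm - 2 *\<^sub>R f) \<bullet> e + r \<bullet> D e"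
    unfolding r using eq by (simp add: inner_diff_left inner_add_left)
  finally have "norm (D e) \<le> (K * norm (fp + fm - 2 *\<^sub>R f) + norm r) / \<alpha>"
    by (rule energy_estimate[OF A e])
  also have "\<dots> \<le> (K * norm (fp + fm - 2 *\<^sub>R f) + \<delta> * norm (D (up - um))) / \<alpha>"
    using A pert[of "D (up - um)"] by (intro divide_right_mono) (auto simp: elliptic_def norm_minus_commute r_def)
  finally show ?thesis by (simp add: e_def up_def um_def u_def)
qed

definition adj :: "('g \<Rightarrow> 'g) \<Rightarrow> 'h \<Rightarrow> 'h \<Rightarrow> 'h" where
  "adj A u0 z = sol A (sol A z - u0)"

text \<open>With \<open>c = K / \<alpha>\<close> the factor in \<open>norm_D_sol\<close>, this is \<open>c * (1 + K * c)\<close>: one solve for the state, a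
return to the ambient norm by the Poincare inequality, and a second solve.\<close>

definition adj_const :: "real \<Rightarrow> real" where
  "adj_const \<alpha> = K / \<alpha> * (1 + K * (K / \<alpha>))"

lemma adj_const_pos: "0 < \<alpha> \<Longrightarrow> 0 < adj_const \<alpha>"
  using K_pos by (simp add: adj_const_def add_pos_pos)

lemma norm_D_adj:
  assumes A: "elliptic \<alpha> A"
  shows "norm (D (adj A u0 z)) \<le> adj_const \<alpha> * (norm z + norm u0)"
proof -
  have \<alpha>: "0 < \<alpha>" using A by (simp add: elliptic_def)
  have "norm (sol A z) \<le> K * (K * norm z / \<alpha>)"
    using order_trans[OF poincare[OF sol_in_V[OF A]] mult_left_mono[OF norm_D_sol[OF A]]] K_pos
    by simp
  then have f: "norm (sol A z - u0) \<le> K * (K * norm z / \<alpha>) + norm u0"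
    using norm_triangle_ineq4[of "sol A z" u0] by simp
  have "norm (D (adj A u0 z)) \<le> K * norm (sol A z - u0) / \<alpha>"
    unfolding adj_def by (rule norm_D_sol[OF A])
  also have "\<dots> \<le> K * (K * (K * norm z / \<alpha>) + norm u0) / \<alpha>"
    using f K_pos \<alpha> by (intro divide_right_mono mult_left_mono) auto
  also have "\<dots> \<le> K * (K * (K * norm z / \<alpha>) + norm u0 + norm z + K * (K * norm u0 / \<alpha>)) / \<alpha>"
    using K_pos \<alpha> by (intro divide_right_mono mult_left_mono) auto
  also have "\<dots> = adj_const \<alpha> * (norm z + norm u0)"
    using \<alpha> by (simp add: adj_const_def field_simps)
  finally show ?thesis .
qed

lemma norm_D_sol_diff_same_rhs:
  assumes A: "elliptic \<alpha> A" and A': "elliptic \<alpha> A'" and \<delta>: "0 \<le> \<delta>"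
    and pert: "\<And>g. norm (A' g - A g) \<le> \<delta> * norm g"
  shows "norm (D (sol A' z - sol A z)) \<le> \<delta> / \<alpha> * (K / \<alpha>) * norm z"
proof -
  have \<alpha>: "0 < \<alpha>" using A by (simp add: elliptic_def)
  have "norm (D (sol A' z - sol A z)) \<le> \<delta> * norm (D (sol A' z)) / \<alpha>"
    using norm_D_sol_diff[OF A A' pert, of z z] by simp
  also have "\<dots> \<le> \<delta> * (K * norm z / \<alpha>) / \<alpha>"
    using norm_D_sol[OF A', of z] \<alpha> \<delta> by (intro divide_right_mono mult_left_mono) auto
  finally show ?thesis by simp
qed

lemma norm_D_adj_diff:
  assumes A: "elliptic \<alpha> A" and A': "elliptic \<alpha> A'" and \<delta>: "0 \<le> \<delta>"
    and pert: "\<And>g. norm (A' g - A g) \<le> \<delta> * norm g"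
  shows "norm (D (adj A' u0 z - adj A u0 z)) \<le> 2 * (\<delta> / \<alpha>) * adj_const \<alpha> * (norm z + norm u0)"
proof -
  have \<alpha>: "0 < \<alpha>" using A by (simp add: elliptic_def)
  define d where "d = \<delta> / \<alpha>"
  define c where "c = K / \<alpha>"
  have d0: "0 \<le> d" and c0: "0 \<le> c" using \<delta> \<alpha> K_pos by (auto simp: d_def c_def)
  have du: "norm (sol A' z - sol A z) \<le> K * (d * c * norm z)"
    using order_trans[OF poincare[OF V_diff[OF sol_in_V[OF A'] sol_in_V[OF A]]]
        mult_left_mono[OF norm_D_sol_diff_same_rhs[OF A A' \<delta> pert]]] K_pos
    by (simp add: d_def c_def)
  have "norm (D (adj A' u0 z - adj A u0 z))
      \<le> (K * norm (sol A' z - sol A z) + \<delta> * norm (D (adj A' u0 z))) / \<alpha>"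
    using norm_D_sol_diff[OF A A' pert, of "sol A' z - u0" "sol A z - u0"] unfolding adj_def by simp
  also have "\<dots> = c * norm (sol A' z - sol A z) + d * norm (D (adj A' u0 z))"
    by (simp add: c_def d_def add_divide_distrib)
  also have "\<dots> \<le> c * (K * (d * c * norm z)) + d * (adj_const \<alpha> * (norm z + norm u0))"
    using du norm_D_adj[OF A'] c0 d0 by (intro add_mono mult_left_mono) auto
  also have "c * (K * (d * c * norm z)) \<le> d * (adj_const \<alpha> * (norm z + norm u0))"
  proof -
    have "c * (K * (d * c * norm z)) = d * ((c * (K * c)) * norm z)" by (simp add: mult_ac)
    also have "\<dots> \<le> d * (adj_const \<alpha> * (norm z + norm u0))"
      using c0 d0 K_pos by (intro mult_left_mono mult_mono) (auto simp: adj_const_def c_def algebra_simps)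
    finally show ?thesis .
  qed
  finally show ?thesis by (simp add: d_def)
qed

text \<open>The load of the adjoint problem depends on the parameter through the state, so second differences of the state
contribute as well; both contributions are quadratic in \<open>\<delta>\<close>.\<close>

lemma norm_D_adj_second_diff:
  assumes A: "elliptic \<alpha> A" and Ap: "elliptic \<alpha> Ap" and Am: "elliptic \<alpha> Am" and \<delta>: "0 \<le> \<delta>"
    and sym: "\<And>g. Ap g - A g = A g - Am g"
    and pert: "\<And>g. norm (Ap g - A g) \<le> \<delta> * norm g"
  shows "norm (D (adj Ap u0 z + adj Am u0 z - 2 *\<^sub>R adj A u0 z))
    \<le> 6 * (\<delta> / \<alpha>)\<^sup>2 * adj_const \<alpha> * (norm z + norm u0)"
proof -
  have \<alpha>: "0 < \<alpha>" using A by (simp add: elliptic_def)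
  define d where "d = \<delta> / \<alpha>"
  define c where "c = K / \<alpha>"
  define N where "N = norm z + norm u0"
  have d0: "0 \<le> d" and c0: "0 \<le> c" using \<delta> \<alpha> K_pos by (auto simp: d_def c_def)
  have pert2: "norm (Ap g - Am g) \<le> (2 * \<delta>) * norm g" for g
  proof -
    have "Ap g - Am g = (Ap g - A g) + (Ap g - A g)" using sym[of g] by (simp add: algebra_simps)
    then have "norm (Ap g - Am g) \<le> norm (Ap g - A g) + norm (Ap g - A g)"
      by (metis norm_triangle_ineq)
    then show ?thesis using pert[of g] by simp
  qed
  define s where "s = sol Ap z + sol Am z - 2 *\<^sub>R sol A z"
  have s: "s \<in> V"
    unfolding s_def by (intro V_diff V_add V_scaleR sol_in_V[OF A] sol_in_V[OF Ap] sol_in_V[OF Am])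
  have "norm (D s) \<le> (\<delta> * norm (D (sol Ap z - sol Am z))) / \<alpha>"
    using norm_D_sol_second_diff[OF A Ap Am sym pert, of z z z] by (simp add: s_def scaleR_2)
  also have "\<dots> \<le> (\<delta> * (2 * \<delta> / \<alpha> * (K / \<alpha>) * norm z)) / \<alpha>"
    using norm_D_sol_diff_same_rhs[OF Am Ap _ pert2, of z] \<delta> \<alpha>
    by (intro divide_right_mono mult_left_mono) auto
  also have "\<dots> = 2 * d\<^sup>2 * c * norm z" by (simp add: d_def c_def power2_eq_square)
  finally have Ds: "norm (D s) \<le> 2 * d\<^sup>2 * c * norm z" .
  have ns: "norm s \<le> K * (2 * d\<^sup>2 * c * norm z)"
    using order_trans[OF poincare[OF s] mult_left_mono[OF Ds]] K_pos by simp
  have "norm (D (adj Ap u0 z + adj Am u0 z - 2 *\<^sub>R adj A u0 z))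
      \<le> (K * norm s + \<delta> * norm (D (adj Ap u0 z - adj Am u0 z))) / \<alpha>"
    using norm_D_sol_second_diff[OF A Ap Am sym pert, of "sol Ap z - u0" "sol Am z - u0" "sol A z - u0"]
    unfolding adj_def s_def by (simp add: scaleR_2 algebra_simps)
  also have "\<dots> = c * norm s + d * norm (D (adj Ap u0 z - adj Am u0 z))"
    by (simp add: c_def d_def add_divide_distrib)
  also have "\<dots> \<le> c * (K * (2 * d\<^sup>2 * c * norm z)) + d * (2 * (2 * \<delta> / \<alpha>) * adj_const \<alpha> * N)"
    using ns norm_D_adj_diff[OF Am Ap _ pert2, of u0 z] c0 d0 \<delta>
    by (intro add_mono mult_left_mono) (auto simp: N_def)
  also have "d * (2 * (2 * \<delta> / \<alpha>) * adj_const \<alpha> * N) = 4 * d\<^sup>2 * (adj_const \<alpha> * N)"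
    by (simp add: d_def power2_eq_square)
  also have "c * (K * (2 * d\<^sup>2 * c * norm z)) \<le> 2 * d\<^sup>2 * (adj_const \<alpha> * N)"
  proof -
    have "c * (K * (2 * d\<^sup>2 * c * norm z)) = 2 * d\<^sup>2 * ((c * (K * c)) * norm z)" by (simp add: mult_ac)
    also have "\<dots> \<le> 2 * d\<^sup>2 * (adj_const \<alpha> * N)"
      using c0 d0 K_pos
      by (intro mult_left_mono mult_mono) (auto simp: adj_const_def c_def N_def algebra_simps)
    finally show ?thesis .
  qed
  finally show ?thesis by (simp add: d_def N_def algebra_simps)
qed

end

section \<open>Smooth bumps and the fundamental lemma of the calculus of variations\<close>

lemma C_k_Suc_derivative:
  "C_k (Suc k) f \<Longrightarrow> (f has_derivative frechet_derivative f (at x)) (at x)"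
  by (simp add: frechet_derivative_works)

lemma C_k_Suc_imp_C_k: "C_k (Suc k) f \<Longrightarrow> C_k k f"
proof (induction k arbitrary: f)
  case 0
  then show ?case
    by (auto intro!: continuous_at_imp_continuous_on differentiable_imp_continuous_within)
next
  case (Suc k)
  then show ?case by (metis C_k.simps(2))
qed

lemma C_k_const: "C_k k (\<lambda>x. c)"
proof (induction k arbitrary: c)
  case (Suc k)
  have "frechet_derivative (\<lambda>x. c) (at x) = (\<lambda>v. 0)" for x :: 'a
    by (metis frechet_derivative_at has_derivative_const)
  then show ?case using Suc[of 0] by simp
qed simp

lemma C_k_add:
  "C_k k f \<Longrightarrow> C_k k g \<Longrightarrow> C_k k (\<lambda>x. f x + g x)"
proof (induction k arbitrary: f g)
  case 0
  then show ?case by (simp add: continuous_on_add)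
next
  case (Suc k)
  have "frechet_derivative (\<lambda>x. f x + g x) (at x)
      = (\<lambda>v. frechet_derivative f (at x) v + frechet_derivative g (at x) v)" for x
    using has_derivative_add[OF C_k_Suc_derivative[OF Suc.prems(1)] C_k_Suc_derivative[OF Suc.prems(2)]]
    by (rule frechet_derivative_at[symmetric])
  then show ?case using Suc by simp
qed

lemma C_k_mult:
  "C_k k f \<Longrightarrow> C_k k g \<Longrightarrow> C_k k (\<lambda>x. f x * g x)"
proof (induction k arbitrary: f g)
  case 0
  then show ?case by (simp add: continuous_on_mult)
next
  case (Suc k)
  have "frechet_derivative (\<lambda>x. f x * g x) (at x)
      = (\<lambda>v. f x * frechet_derivative g (at x) v + frechet_derivative f (at x) v * g x)" for x
    using has_derivative_mult[OF C_k_Suc_derivative[OF Suc.prems(1)] C_k_Suc_derivative[OF Suc.prems(2)]]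
    by (rule frechet_derivative_at[symmetric])
  then show ?case using Suc C_k_Suc_imp_C_k[OF Suc.prems(1)] C_k_Suc_imp_C_k[OF Suc.prems(2)]
    by (auto intro!: C_k_add)
qed

lemma C_k_prod:
  assumes "finite I" "\<And>i. i \<in> I \<Longrightarrow> C_k k (f i)"
  shows "C_k k (\<lambda>x. \<Prod>i\<in>I. f i x)"
  using assms by (induction I rule: finite_induct) (auto simp: C_k_const intro!: C_k_mult)

text \<open>A sequence in which each function is the derivative of the preceding one encodes a smooth function together with all
its derivatives; composing with an affine functional shifts along this sequence and produces constant factors.\<close>

lemma C_k_ridge:
  fixes G :: "nat \<Rightarrow> real \<Rightarrow> real" and e :: "'a::euclidean_space"
  assumes G: "\<And>n t. (G n has_real_derivative G (Suc n) t) (at t)"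
  shows "C_k k (\<lambda>x. G n (b + c * (x \<bullet> e)))"
proof (induction k arbitrary: n)
  case 0
  have "continuous_on UNIV (G n)"
    using G by (auto intro!: continuous_at_imp_continuous_on DERIV_isCont)
  then have "continuous_on UNIV (\<lambda>x. G n (b + c * (x \<bullet> e)))"
    by (rule continuous_on_compose2) (auto intro!: continuous_intros)
  then show ?case by simp
next
  case (Suc k)
  have der: "((\<lambda>x. G n (b + c * (x \<bullet> e))) has_derivative
      (\<lambda>v. G (Suc n) (b + c * (x \<bullet> e)) * (c * (v \<bullet> e)))) (at x)" for x
  proof -
    have "((\<lambda>x. b + c * (x \<bullet> e)) has_derivative (\<lambda>v. c * (v \<bullet> e))) (at x)"
      by (auto intro!: derivative_eq_intros)
    from has_derivative_compose[OF this has_field_derivative_imp_has_derivative[OF G]]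
    show ?thesis by (simp add: mult.commute)
  qed
  then have "frechet_derivative (\<lambda>x. G n (b + c * (x \<bullet> e))) (at x)
      = (\<lambda>v. G (Suc n) (b + c * (x \<bullet> e)) * (c * (v \<bullet> e)))" for x
    by (metis frechet_derivative_at)
  moreover have "(\<lambda>x. G n (b + c * (x \<bullet> e))) differentiable at x" for x
    using der by (auto simp: differentiable_def)
  ultimately show ?case
    using Suc by (auto intro!: C_k_mult C_k_const)
qed

text \<open>These functions are flat at \<open>0\<close>, and the family is closed under differentiation, so that one induction
shows all of them, in particular \<open>exp (- 1 / t)\<close> extended by \<open>0\<close>, to be smooth.\<close>

definition flat_exp :: "real poly \<Rightarrow> real \<Rightarrow> real" where
  "flat_exp P t = (if 0 < t then poly P (1 / t) * exp (- (1 / t)) else 0)"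

lemma poly_times_exp_neg_tendsto_0: "((\<lambda>s::real. poly P s * exp (- s)) \<longlongrightarrow> 0) at_top"
proof -
  have "((\<lambda>s::real. \<Sum>i\<le>degree P. coeff P i * (s ^ i / exp s)) \<longlongrightarrow> (\<Sum>i\<le>degree P. coeff P i * 0)) at_top"
    by (intro tendsto_sum tendsto_mult tendsto_const tendsto_power_div_exp_0)
  then show ?thesis
    by (simp add: poly_altdef sum_distrib_right exp_minus divide_inverse mult.assoc)
qed

lemma flat_exp_tendsto_0: "(flat_exp P \<longlongrightarrow> 0) (at 0)"
proof -
  have "((\<lambda>t. poly P (1 / t) * exp (- (1 / t))) \<longlongrightarrow> 0) (at_right 0)"
    using filterlim_compose[OF poly_times_exp_neg_tendsto_0 filterlim_inverse_at_top_right]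
    by (simp add: divide_inverse)
  then have "(flat_exp P \<longlongrightarrow> 0) (at_right 0)"
    by (rule Lim_transform_eventually) (auto simp: flat_exp_def eventually_at_filter)
  moreover have "(flat_exp P \<longlongrightarrow> 0) (at_left 0)"
    by (rule Lim_transform_eventually[OF tendsto_const]) (auto simp: flat_exp_def eventually_at_filter)
  ultimately show ?thesis by (simp add: filterlim_split_at)
qed

text \<open>For \<open>t > 0\<close> the product and chain rules produce the factor \<open>1 / t\<^sup>2\<close>, which is the polynomial
\<open>[:0, 0, 1:]\<close> in \<open>1 / t\<close>. At \<open>0\<close> the difference quotient is again a member of the family, for
the polynomial \<open>[:0, 1:] * P\<close>, and tends to \<open>0\<close>.\<close>

lemma flat_exp_has_derivative:
  "(flat_exp P has_real_derivative flat_exp ([:0, 0, 1:] * (P - pderiv P)) t) (at t)"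
proof -
  consider "t > 0" | "t < 0" | "t = 0" by linarith
  then show ?thesis
  proof cases
    case 1
    have "((\<lambda>t. poly P (1 / t) * exp (- (1 / t))) has_real_derivative
        flat_exp ([:0, 0, 1:] * (P - pderiv P)) t) (at t)"
      using 1 by (auto intro!: derivative_eq_intros simp: flat_exp_def field_simps power2_eq_square)
    moreover have "\<forall>\<^sub>F s in nhds t. poly P (1 / s) * exp (- (1 / s)) = flat_exp P s"
      using eventually_nhds_in_open[of "{0<..}" t] 1 by (auto simp: flat_exp_def elim!: eventually_mono)
    ultimately show ?thesis by (subst DERIV_cong_ev[OF refl _ refl]) (auto elim: eventually_mono)
  next
    case 2
    have "\<forall>\<^sub>F s in nhds t. flat_exp P s = 0"
      using eventually_nhds_in_open[of "{..<0}" t] 2 by (auto simp: flat_exp_def elim!: eventually_mono)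
    then show ?thesis using 2 by (subst DERIV_cong_ev[OF refl _ refl]) (auto simp: flat_exp_def)
  next
    case 3
    have "((\<lambda>h. (flat_exp P (0 + h) - flat_exp P 0) / h) \<longlongrightarrow> 0) (at 0)"
      by (rule Lim_transform_eventually[OF flat_exp_tendsto_0[of "[:0, 1:] * P"]])
        (auto simp: flat_exp_def eventually_at_filter)
    then show ?thesis using 3 by (simp add: DERIV_def flat_exp_def)
  qed
qed

text \<open>The factor \<open>Suc n\<close> inside the exponentials makes these smooth functions increase with \<open>n\<close> to
the indicator of the open box, without enlarging the support.\<close>

definition box_bump :: "'a::euclidean_space \<Rightarrow> 'a \<Rightarrow> nat \<Rightarrow> 'a \<Rightarrow> real" where
  "box_bump a b n x = (\<Prod>i\<in>Basis. flat_exp 1 (real (Suc n) * (x \<bullet> i - a \<bullet> i))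
     * flat_exp 1 (real (Suc n) * (b \<bullet> i - x \<bullet> i)))"

lemma flat_exp_1_bounds: "0 \<le> flat_exp 1 t" "flat_exp 1 t \<le> 1"
  by (auto simp: flat_exp_def)

lemma box_bump_nonzero_iff: "box_bump a b n x \<noteq> 0 \<longleftrightarrow> x \<in> box a b"
  by (auto simp: box_bump_def mem_box flat_exp_def zero_less_mult_iff)

lemma box_bump_bounds: "0 \<le> box_bump a b n x" "box_bump a b n x \<le> 1"
  unfolding box_bump_def
  by (auto intro!: prod_nonneg prod_le_1 mult_nonneg_nonneg mult_le_one simp: flat_exp_1_bounds)

lemma C_k_box_bump: "C_k k (box_bump a b n)"
proof -
  \<comment> \<open>Entry \<open>m\<close> is the \<open>m\<close>-th derivative of \<open>exp (- 1 / t)\<close>.\<close>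
  define G where "G m = flat_exp (((\<lambda>P. [:0, 0, 1:] * (P - pderiv P)) ^^ m) 1)" for m
  have G: "(G m has_real_derivative G (Suc m) t) (at t)" for m t
    unfolding G_def by (simp only: funpow.simps(2) o_apply flat_exp_has_derivative)
  have "C_k k (\<lambda>x. flat_exp 1 (real (Suc n) * (x \<bullet> i - a \<bullet> i)))" for i
    using C_k_ridge[of G, OF G, of k 0 "- (real (Suc n) * (a \<bullet> i))" "real (Suc n)" i]
    by (simp add: G_def algebra_simps)
  moreover have "C_k k (\<lambda>x. flat_exp 1 (real (Suc n) * (b \<bullet> i - x \<bullet> i)))" for i
    using C_k_ridge[of G, OF G, of k 0 "real (Suc n) * (b \<bullet> i)" "- real (Suc n)" i]
    by (simp add: G_def algebra_simps)
  ultimately show ?thesis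
    unfolding box_bump_def[abs_def] by (intro C_k_prod C_k_mult) auto
qed

lemma box_bump_test_function:
  assumes "closure (box a b) \<subseteq> \<Omega>"
  shows "box_bump a b n \<in> test_functions \<Omega>"
  using assms unfolding test_functions_def
  by (simp add: box_bump_nonzero_iff C_k_box_bump compact_eq_bounded_closed bounded_closure bounded_box)

lemma box_bump_tendsto: "(\<lambda>n. box_bump a b n x) \<longlonglongrightarrow> indicat_real (box a b) x"
proof (cases "x \<in> box a b")
  case False
  then have "box_bump a b n x = 0" for n by (metis box_bump_nonzero_iff)
  then show ?thesis using False by simp
next
  case True
  have lim: "(\<lambda>n. flat_exp 1 (real (Suc n) * t)) \<longlonglongrightarrow> 1" if "t > 0" for t
  proof -
    have "(\<lambda>n. exp (- (inverse (real (Suc n)) * (1 / t)))) \<longlonglongrightarrow> exp (- (0 * (1 / t)))"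
      by (intro tendsto_intros LIMSEQ_inverse_real_of_nat)
    then show ?thesis using that by (simp add: flat_exp_def divide_inverse mult.commute)
  qed
  have "(\<lambda>n. box_bump a b n x) \<longlonglongrightarrow> (\<Prod>i\<in>(Basis::'a set). 1 * 1)"
    unfolding box_bump_def using True
    by (intro tendsto_prod tendsto_mult lim) (auto simp: mem_box)
  then show ?thesis using True by simp
qed

text \<open>Boxes generate the Borel sets and are stable under intersection, so the integrals of \<open>F\<close> over all
Borel sets vanish as well.\<close>

lemma AE_zero_if_box_integrals_zero:
  fixes F :: "'a::euclidean_space \<Rightarrow> real"
  assumes F: "integrable lebesgue F"
    and zero: "\<And>a b. (\<integral>x. indicat_real (box a b) x * F x \<partial>lebesgue) = 0"
    and total: "(\<integral>x. F x \<partial>lebesgue) = 0"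
  shows "AE x in lebesgue. F x = 0"
proof -
  \<comment> \<open>The Dynkin argument runs in the Borel sigma-algebra, so \<open>F\<close> is first replaced by a Borel version.\<close>
  obtain G where G[measurable]: "G \<in> borel_measurable lborel" and FG: "AE x in lborel. F x = G x"
    using completion_ex_borel_measurable_real[of F lborel] F by auto
  have meas: "F \<in> borel_measurable lebesgue" "G \<in> borel_measurable lebesgue"
    using F by (auto intro: measurable_completion)
  have FG': "AE x in lebesgue. F x = G x"
    using FG by (rule AE_completion)
  have "integrable lebesgue G"
    using FG' F by (subst integrable_cong_AE[of G _ F]) (auto intro: measurable_completion elim: eventually_mono)
  then have G_int: "integrable lborel G"
    by (simp add: integrable_completion)
  have transfer: "(\<integral>x. indicat_real A x * G x \<partial>lborel) = (\<integral>x. indicat_real A x * F x \<partial>lebesgue)"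
    if [measurable]: "A \<in> sets borel" for A
  proof -
    have indA: "indicat_real A \<in> borel_measurable lebesgue"
      by (rule measurable_completion) measurable
    have "(\<integral>x. indicat_real A x * G x \<partial>lborel) = (\<integral>x. indicat_real A x * G x \<partial>lebesgue)"
      by (rule integral_completion[symmetric]) measurable
    also have "\<dots> = (\<integral>x. indicat_real A x * F x \<partial>lebesgue)"
      using FG' meas by (intro integral_cong_AE borel_measurable_times indA) (auto elim: eventually_mono)
    finally show ?thesis .
  qed
  have total_G: "(\<integral>x. G x \<partial>lborel) = 0"
    using transfer[of UNIV] total by simp
  have "(LINT x:A|lborel. G x) = 0" if "A \<in> sets borel" for A
  proof -
    have "Int_stable (range (\<lambda>(a, b). box a b :: 'a set))"
      by (auto simp: Int_stable_def box_Int_box)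
    moreover have "range (\<lambda>(a, b). box a b :: 'a set) \<subseteq> Pow UNIV" by auto
    moreover have "A \<in> sigma_sets UNIV (range (\<lambda>(a, b). box a b))"
      using that unfolding borel_eq_box by simp
    ultimately show ?thesis
    proof (induction rule: sigma_sets_induct_disjoint)
      case (basic A)
      then show ?case using zero transfer by (auto simp: set_lebesgue_integral_def)
    next
      case empty
      then show ?case by (simp add: set_lebesgue_integral_def)
    next
      case (compl A)
      then have [measurable]: "A \<in> sets borel" unfolding borel_eq_box by simp
      have "(LINT x:UNIV - A|lborel. G x) = (\<integral>x. G x - indicat_real A x * G x \<partial>lborel)"
        unfolding set_lebesgue_integral_def
        by (intro Bochner_Integration.integral_cong) (auto simp: indicator_def)
      also have "\<dots> = 0"
        using G_int compl(2) integrable_mult_indicator[of A lborel G] total_G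
        by (subst Bochner_Integration.integral_diff) (auto simp: set_lebesgue_integral_def)
      finally show ?case .
    next
      case (union A)
      then have "A i \<in> sets borel" for i unfolding borel_eq_box by auto
      then have meas: "A i \<in> sets lborel" for i by simp
      have "(LINT x:(\<Union>i. A i)|lborel. G x) = (\<Sum>i. (LINT x:(A i)|lborel. G x))"
        using union(1) meas integrable_mult_indicator[OF _ G_int, of "\<Union>i. A i"]
        by (intro lebesgue_integral_countable_add)
          (auto simp: disjoint_family_on_def set_integrable_def)
      then show ?case using union by simp
    qed
  qed
  then have "AE x in lborel. G x = 0"
    using G_int by (intro density_unique_real) (auto simp: set_lebesgue_integral_def)
  then have "AE x in lebesgue. G x = 0"
    by (rule AE_completion)
  with FG' show ?thesis by eventually_elim simp
qed

text \<open>Testing with the bumps of a box whose closure lies in \<open>\<Omega>\<close> and passing to the limit annihilates the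
integral of \<open>f\<close> over this box. The intersection of such a box with any other box is again such a box, so \<open>f\<close>
vanishes almost everywhere on it, and countably many of them cover \<open>\<Omega>\<close> up to null sets.\<close>

lemma fundamental_lemma_calculus_of_variations:
  fixes f :: "'a::euclidean_space \<Rightarrow> real"
  assumes \<Omega>: "open \<Omega>" and f: "square_integrable f"
    and zero: "\<And>\<phi>. \<phi> \<in> test_functions \<Omega> \<Longrightarrow> (LINT x:\<Omega>|lebesgue. f x * \<phi> x) = 0"
  shows "AE x in lebesgue. x \<in> \<Omega> \<longrightarrow> f x = 0"
proof -
  have [measurable]: "f \<in> borel_measurable lebesgue" "\<Omega> \<in> sets lebesgue"
    using f \<Omega> by auto
  have ind_sq: "square_integrable (indicat_real (box a b))" for a b :: 'a
    using square_integrable_def[of "indicat_real (box a b)"] emeasure_bounded_finite[OF bounded_box[of a b]]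
      borel_measurable_indicator[of "box a b" lebesgue]
    by (auto simp: integrable_indicator_iff power2_eq_square simp flip: indicator_inter_arith)
  have int_box: "integrable lebesgue (\<lambda>x. indicat_real (box a b) x * f x)" for a b
    using square_integrable_inner[OF ind_sq f] by simp
  have box_zero: "(\<integral>x. indicat_real (box a b) x * f x \<partial>lebesgue) = 0"
    if cl: "closure (box a b) \<subseteq> \<Omega>" for a b
  proof -
    have sub: "box a b \<subseteq> \<Omega>" using cl closure_subset by blast
    have [measurable]: "box_bump a b n \<in> borel_measurable lebesgue" for n
      using C_k_box_bump[of 0 a b n]
      by (intro measurable_completion) (simp add: borel_measurable_continuous_onI)
    have "(\<lambda>n. \<integral>x. indicat_real \<Omega> x * (f x * box_bump a b n x) \<partial>lebesgue)
        \<longlonglongrightarrow> (\<integral>x. indicat_real (box a b) x * f x \<partial>lebesgue)"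
    proof (rule integral_dominated_convergence)
      show "integrable lebesgue (\<lambda>x. \<bar>indicat_real (box a b) x * f x\<bar>)"
        using int_box by (rule integrable_abs)
      show "(\<lambda>x. indicat_real \<Omega> x * (f x * box_bump a b n x)) \<in> borel_measurable lebesgue" for n
        by measurable
      show "AE x in lebesgue. (\<lambda>n. indicat_real \<Omega> x * (f x * box_bump a b n x))
          \<longlonglongrightarrow> indicat_real (box a b) x * f x"
      proof (rule AE_I2)
        fix x
        have "(\<lambda>n. indicat_real \<Omega> x * (f x * box_bump a b n x))
          \<longlonglongrightarrow> indicat_real \<Omega> x * (f x * indicat_real (box a b) x)"
          by (intro tendsto_intros box_bump_tendsto)
        also have "indicat_real \<Omega> x * (f x * indicat_real (box a b) x) = indicat_real (box a b) x * f x"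
          using sub by (auto simp: indicator_def)
        finally show "(\<lambda>n. indicat_real \<Omega> x * (f x * box_bump a b n x))
          \<longlonglongrightarrow> indicat_real (box a b) x * f x" .
      qed
      show "AE x in lebesgue. norm (indicat_real \<Omega> x * (f x * box_bump a b n x))
          \<le> \<bar>indicat_real (box a b) x * f x\<bar>" for n
      proof (rule AE_I2)
        fix x
        show "norm (indicat_real \<Omega> x * (f x * box_bump a b n x)) \<le> \<bar>indicat_real (box a b) x * f x\<bar>"
          using box_bump_bounds[of a b n x] box_bump_nonzero_iff[of a b n x] sub
          by (cases "x \<in> box a b") (auto simp: indicator_def abs_mult mult_left_le)
      qed
    qed (use int_box in auto)
    moreover have "(\<integral>x. indicat_real \<Omega> x * (f x * box_bump a b n x) \<partial>lebesgue) = 0" for n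
      using zero[OF box_bump_test_function[OF cl, of n]] by (simp add: set_lebesgue_integral_def)
    ultimately show ?thesis by (simp add: LIMSEQ_const_iff)
  qed
  have local: "AE x in lebesgue. x \<in> cbox c d \<longrightarrow> f x = 0" if sub: "cbox c d \<subseteq> \<Omega>" for c d
  proof -
    have cl: "closure (box c d) \<subseteq> \<Omega>"
      using sub closure_minimal[OF box_subset_cbox closed_cbox] by blast
    have "AE x in lebesgue. indicat_real (box c d) x * f x = 0"
    proof (rule AE_zero_if_box_integrals_zero[OF int_box])
      show "(\<integral>x. indicat_real (box c d) x * f x \<partial>lebesgue) = 0" by (rule box_zero[OF cl])
      fix a b :: 'a
      obtain p q where pq: "box a b \<inter> box c d = box p q" unfolding box_Int_box by blast
      have "closure (box p q) \<subseteq> \<Omega>"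
        using cl closure_mono[of "box p q" "box c d"] pq by auto
      from box_zero[OF this] show "(\<integral>x. indicat_real (box a b) x * (indicat_real (box c d) x * f x) \<partial>lebesgue) = 0"
        by (simp add: pq[symmetric] indicator_inter_arith mult.assoc)
    qed
    moreover have "AE x in lebesgue. x \<notin> cbox c d - box c d"
      using negligible_frontier_interval by (intro AE_not_in) (simp add: negligible_iff_null_sets)
    ultimately show ?thesis by eventually_elim (auto simp: indicator_def)
  qed
  obtain \<D> where D: "countable \<D>" "\<D> \<subseteq> Pow \<Omega>" "\<And>X. X \<in> \<D> \<Longrightarrow> \<exists>a b. X = cbox a b" "\<Union>\<D> = \<Omega>"
    using open_countable_Union_open_cbox[OF \<Omega>] by metis
  have "AE x in lebesgue. \<forall>X\<in>\<D>. x \<in> X \<longrightarrow> f x = 0"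
    using D local by (subst AE_ball_countable) (auto, metis Sup_upper)
  then show ?thesis using D(4) by (auto elim!: eventually_mono)
qed

section \<open>Integration by parts and weak gradients\<close>

lemma borel_measurable_imp_lebesgue:
  "f \<in> borel_measurable borel \<Longrightarrow> f \<in> borel_measurable lebesgue"
  by (rule measurable_completion) simp

lemma integrable_continuous_bounded_support:
  fixes F :: "'a::euclidean_space \<Rightarrow> 'b::euclidean_space"
  assumes cont: "continuous_on UNIV F" and supp: "\<And>x. R < norm x \<Longrightarrow> F x = 0"
  shows "integrable lborel F" and "integrable lebesgue F"
proof -
  have "compact (F ` cball 0 R)"
    by (intro compact_continuous_image continuous_on_subset[OF cont]) auto
  then obtain B where B: "\<And>x. x \<in> cball 0 R \<Longrightarrow> norm (F x) \<le> B"
    using compact_imp_bounded bounded_iff by (metis imageI)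
  show "integrable lborel F"
  proof (rule Bochner_Integration.integrable_bound)
    show "integrable lborel (\<lambda>x::'a. B * indicator (cball 0 R) x)"
      using emeasure_bounded_finite[OF bounded_cball[of "0::'a" R]] by simp
    show "F \<in> borel_measurable lborel"
      using cont by (simp add: borel_measurable_continuous_onI)
    show "AE x in lborel. norm (F x) \<le> norm (B * indicator (cball 0 R) x)"
    proof (rule AE_I2)
      fix x
      show "norm (F x) \<le> norm (B * indicator (cball 0 R) x)"
        using B[of x] supp[of x] by (cases "norm x \<le> R") (auto simp: abs_le_iff)
    qed
  qed
  then show "integrable lebesgue F"
    using cont by (subst integrable_completion) (auto simp: borel_measurable_continuous_onI)
qed

lemma square_integrable_continuous_bounded_support:
  fixes F :: "'a::euclidean_space \<Rightarrow> 'b::euclidean_space"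
  assumes cont: "continuous_on UNIV F" and supp: "\<And>x. R < norm x \<Longrightarrow> F x = 0"
  shows "square_integrable F"
  unfolding square_integrable_def
proof
  show "F \<in> borel_measurable lebesgue"
    using cont by (intro borel_measurable_imp_lebesgue borel_measurable_continuous_onI)
  show "integrable lebesgue (\<lambda>x. (norm (F x))\<^sup>2)"
    using cont supp by (intro integrable_continuous_bounded_support(2)[where R = R]) (auto intro!: continuous_intros)
qed

lemma frechet_derivative_zero_off_support:
  assumes "x \<notin> closure {x. F x \<noteq> (0::real)}"
  shows "frechet_derivative F (at x) v = 0"
proof -
  define S where "S = - closure {x. F x \<noteq> 0}"
  have "((\<lambda>x. 0) has_derivative (\<lambda>v. 0)) (at x)" by simp
  then have "(F has_derivative (\<lambda>v. 0)) (at x)"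
  proof (rule has_derivative_transform_within_open)
    show "open S" "x \<in> S" using assms by (auto simp: S_def)
    show "0 = F x'" if "x' \<in> S" for x'
      using that closure_subset[of "{x. F x \<noteq> 0}"] by (auto simp: S_def)
  qed
  then show ?thesis by (metis frechet_derivative_at)
qed

text \<open>The difference quotients of \<open>F\<close> have vanishing integral because Lebesgue measure is translation invariant. They
are bounded by the supremum of the derivative and live on a common ball, so dominated convergence applies. This
gives integration by parts without iterated integrals.\<close>

lemma integral_derivative_eq_0:
  fixes F :: "'a::euclidean_space \<Rightarrow> real"
  assumes C: "C_k (Suc 0) F" and supp: "\<And>x. R < norm x \<Longrightarrow> F x = 0"
  shows "(\<integral>x. frechet_derivative F (at x) v \<partial>lebesgue) = 0"
proof -
  define D where "D x = frechet_derivative F (at x) v" for x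
  have der: "(F has_derivative frechet_derivative F (at x)) (at x)" for x
    using C by (rule C_k_Suc_derivative)
  have cont_F: "continuous_on UNIV F" using C_k_Suc_imp_C_k[OF C] by simp
  have cont_D: "continuous_on UNIV D" using C by (simp add: D_def)
  have "closure {x. F x \<noteq> 0} \<subseteq> cball 0 R"
    using supp by (intro closure_minimal) (auto simp: not_less[symmetric])
  then have supp_D: "D x = 0" if "R < norm x" for x
    unfolding D_def using that by (intro frechet_derivative_zero_off_support) auto
  have "compact (D ` cball 0 R)"
    by (intro compact_continuous_image continuous_on_subset[OF cont_D]) auto
  then obtain B0 where B0: "\<And>x. x \<in> cball 0 R \<Longrightarrow> norm (D x) \<le> B0"
    using compact_imp_bounded bounded_iff by (metis imageI)
  define B where "B = max B0 0"
  have B: "\<bar>D x\<bar> \<le> B" for x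
    using B0[of x] supp_D[of x] by (cases "norm x \<le> R") (auto simp: B_def)
  have line: "((\<lambda>t. F (x + t *\<^sub>R v)) has_real_derivative D (x + t *\<^sub>R v)) (at t within S)" for x t S
  proof -
    have "((\<lambda>t. x + t *\<^sub>R v) has_derivative (\<lambda>h. h *\<^sub>R v)) (at t)"
      by (auto intro!: derivative_eq_intros)
    from has_derivative_compose[OF this der]
    have "((\<lambda>t. F (x + t *\<^sub>R v)) has_derivative (\<lambda>h. h * D (x + t *\<^sub>R v))) (at t)"
      using linear_scale[OF has_derivative_linear[OF der]] by (simp add: D_def)
    then show ?thesis
      by (simp add: has_field_derivative_def mult.commute[of _ "D _"] has_derivative_at_withinI)
  qed
  define h where "h n = inverse (real (Suc n))" for n
  have h: "0 < h n" "h n \<le> 1" for n by (auto simp: h_def field_simps)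
  \<comment> \<open>Difference quotients with step at most \<open>1\<close>, so that all supports lie in one ball.\<close>
  define s where "s n x = (F (x + h n *\<^sub>R v) - F x) / h n" for n x
  have F_int: "integrable lborel F"
    using cont_F supp by (rule integrable_continuous_bounded_support)
  have shift: "integrable lborel (\<lambda>x. F (x + c)) \<and> (\<integral>x. F (x + c) \<partial>lborel) = (\<integral>x. F x \<partial>lborel)" for c
  proof -
    have [measurable]: "F \<in> borel_measurable borel" using cont_F by (rule borel_measurable_continuous_onI)
    have "integrable (distr lborel borel ((+) c)) F" using F_int by (simp add: lborel_distr_plus)
    then have "integrable lborel (\<lambda>x. F (x + c))"
      by (subst (asm) integrable_distr_eq) (auto simp: add.commute)
    moreover have "(\<integral>x. F x \<partial>distr lborel borel ((+) c)) = (\<integral>x. F (x + c) \<partial>lborel)"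
      by (subst integral_distr) (auto simp: add.commute)
    ultimately show ?thesis by (simp add: lborel_distr_plus)
  qed
  have s_int: "(\<integral>x. s n x \<partial>lborel) = 0" for n
    unfolding s_def using shift[of "h n *\<^sub>R v"] F_int by simp
  have "(\<lambda>n. \<integral>x. s n x \<partial>lborel) \<longlonglongrightarrow> (\<integral>x. D x \<partial>lborel)"
  proof (rule integral_dominated_convergence)
    show "integrable lborel (\<lambda>x::'a. B * indicator (cball 0 (R + norm v)) x)"
      using emeasure_bounded_finite[OF bounded_cball[of "0::'a" "R + norm v"]] by simp
    show "D \<in> borel_measurable lborel" using cont_D by (simp add: borel_measurable_continuous_onI)
    show "s n \<in> borel_measurable lborel" for n
    proof -
      have "continuous_on UNIV (s n)" unfolding s_def
        by (intro continuous_intros continuous_on_compose2[OF cont_F]) (use h[of n] in auto)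
      then show ?thesis by (simp add: borel_measurable_continuous_onI)
    qed
    show "AE x in lborel. (\<lambda>n. s n x) \<longlonglongrightarrow> D x"
    proof (rule AE_I2)
      fix x
      have "((\<lambda>t. (F (x + t *\<^sub>R v) - F x) / t) \<longlongrightarrow> D x) (at 0)"
        using line[of x 0 UNIV] by (simp add: DERIV_def)
      moreover have "filterlim h (at 0) sequentially"
        using h LIMSEQ_inverse_real_of_nat unfolding filterlim_at h_def[abs_def]
        by (auto intro!: always_eventually)
      ultimately show "(\<lambda>n. s n x) \<longlonglongrightarrow> D x" unfolding s_def by (rule filterlim_compose)
    qed
    show "AE x in lborel. norm (s n x) \<le> B * indicator (cball 0 (R + norm v)) x" for n
    proof (rule AE_I2)
      fix x
      show "norm (s n x) \<le> B * indicator (cball 0 (R + norm v)) x"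
      proof (cases "norm x \<le> R + norm v")
        case True
        have "norm (F (x + h n *\<^sub>R v) - F (x + 0 *\<^sub>R v)) \<le> B * norm (h n - 0)"
          by (rule field_differentiable_bound[of UNIV]) (use line B in auto)
        then show ?thesis using True h[of n] by (simp add: s_def field_simps)
      next
        case False
        have "norm x \<le> norm (x + h n *\<^sub>R v) + norm (h n *\<^sub>R v)"
          using norm_triangle_ineq4[of "x + h n *\<^sub>R v" "h n *\<^sub>R v"] by simp
        also have "norm (h n *\<^sub>R v) \<le> norm v" using h[of n] by (simp add: mult_left_le_one_le)
        finally have "R < norm (x + h n *\<^sub>R v)" using False by simp
        moreover have "R < norm x" using False norm_ge_zero[of v] by linarith
        ultimately show ?thesis using supp False by (simp add: s_def)
      qed
    qed
  qed
  then have "(\<integral>x. D x \<partial>lborel) = 0" by (simp add: s_int LIMSEQ_const_iff)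
  then show ?thesis
    using cont_D by (subst integral_completion) (auto simp: D_def[abs_def] borel_measurable_continuous_onI)
qed

text \<open>Multiplication by a bounded function, as an operator on classes. With \<open>m\<close> the coefficient cut off outside the domain,
\<open>mult_op m (weak_grad \<Omega> w) \<bullet> weak_grad \<Omega> v\<close> is the bilinear form of the problem.\<close>

definition mult_op :: "('a::euclidean_space \<Rightarrow> real) \<Rightarrow> ('a, 'b::euclidean_space) L2 \<Rightarrow> ('a, 'b) L2" where
  "mult_op m g = L2_class (\<lambda>x. m x *\<^sub>R L2_fun g x)"

definition bounded_multiplier :: "real \<Rightarrow> ('a::euclidean_space \<Rightarrow> real) \<Rightarrow> bool" where
  "bounded_multiplier M m \<longleftrightarrow> 0 \<le> M \<and> m \<in> borel_measurable lebesgue \<and> (AE x in lebesgue. \<bar>m x\<bar> \<le> M)"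

lemma square_integrable_mult:
  assumes m: "bounded_multiplier M m" and g: "square_integrable g"
  shows "square_integrable (\<lambda>x. m x *\<^sub>R g x)"
proof (rule square_integrable_bound)
  have [measurable]: "m \<in> borel_measurable lebesgue" "g \<in> borel_measurable lebesgue"
    using m g by (auto simp: bounded_multiplier_def)
  show "(\<lambda>x. m x *\<^sub>R g x) \<in> borel_measurable lebesgue" by measurable
  show "integrable lebesgue (\<lambda>x. M\<^sup>2 * (norm (g x))\<^sup>2)"
    using g by (simp add: square_integrable_def)
  have "AE x in lebesgue. \<bar>m x\<bar> \<le> M" using m by (simp add: bounded_multiplier_def)
  then show "AE x in lebesgue. (norm (m x *\<^sub>R g x))\<^sup>2 \<le> M\<^sup>2 * (norm (g x))\<^sup>2"
    by eventually_elim (auto simp flip: power_mult_distrib intro!: power_mono mult_right_mono)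
qed

lemma L2_fun_mult_op:
  "bounded_multiplier M m \<Longrightarrow> AE x in lebesgue. L2_fun (mult_op m g) x = m x *\<^sub>R L2_fun g x"
  unfolding mult_op_def by (intro L2_fun_L2_class square_integrable_mult) simp_all

lemma inner_mult_op:
  assumes m: "bounded_multiplier M m"
  shows "mult_op m g \<bullet> h = (\<integral>x. m x * (L2_fun g x \<bullet> L2_fun h x) \<partial>lebesgue)"
  using inner_L2_class[OF square_integrable_mult[OF m square_integrable_L2_fun], of "L2_fun h" g]
  by (simp add: mult_op_def)

lemma inner_mult_op_commute:
  "bounded_multiplier M m \<Longrightarrow> mult_op m g \<bullet> h = g \<bullet> mult_op m h"
  by (simp add: inner_mult_op inner_commute[of g] inner_commute[of "L2_fun g _"])

lemma norm_mult_op_le: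
  assumes m: "bounded_multiplier M m"
  shows "norm (mult_op m g) \<le> M * norm g"
proof -
  have M: "0 \<le> M" and ae: "AE x in lebesgue. \<bar>m x\<bar> \<le> M"
    using m by (auto simp: bounded_multiplier_def)
  have "(norm (mult_op m g))\<^sup>2 = (\<integral>x. (norm (m x *\<^sub>R L2_fun g x))\<^sup>2 \<partial>lebesgue)"
    unfolding mult_op_def by (intro norm_L2_class square_integrable_mult[OF m]) simp
  also have "\<dots> \<le> (\<integral>x. M\<^sup>2 * (norm (L2_fun g x))\<^sup>2 \<partial>lebesgue)"
  proof (rule integral_mono_AE)
    show "integrable lebesgue (\<lambda>x. (norm (m x *\<^sub>R L2_fun g x))\<^sup>2)"
      using square_integrable_mult[OF m square_integrable_L2_fun[of g]] by (simp add: square_integrable_def)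
    show "integrable lebesgue (\<lambda>x. M\<^sup>2 * (norm (L2_fun g x))\<^sup>2)"
      using square_integrable_L2_fun[of g] by (simp add: square_integrable_def)
    show "AE x in lebesgue. (norm (m x *\<^sub>R L2_fun g x))\<^sup>2 \<le> M\<^sup>2 * (norm (L2_fun g x))\<^sup>2"
      using ae by eventually_elim (auto simp flip: power_mult_distrib intro!: power_mono mult_right_mono)
  qed
  also have "\<dots> = (M * norm g)\<^sup>2" by (simp add: norm_L2_fun power_mult_distrib)
  finally show ?thesis by (rule power2_le_imp_le) (simp add: M)
qed

lemma bounded_linear_mult_op:
  assumes m: "bounded_multiplier M m"
  shows "bounded_linear (mult_op m)"
proof (rule bounded_linear_intro)
  note sq = square_integrable_mult[OF m square_integrable_L2_fun]
  show "mult_op m (g + h) = mult_op m g + mult_op m h" for g h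
    using L2_fun_mult_op[OF m, of "g + h"] L2_fun_add[of g h] L2_fun_add[of "mult_op m g" "mult_op m h"]
      L2_fun_mult_op[OF m, of g] L2_fun_mult_op[OF m, of h]
    by (intro L2_eqI, eventually_elim) (simp add: scaleR_add_right)
  show "mult_op m (c *\<^sub>R g) = c *\<^sub>R mult_op m g" for c g
    using L2_fun_mult_op[OF m, of "c *\<^sub>R g"] L2_fun_scaleR[of c g] L2_fun_scaleR[of c "mult_op m g"]
      L2_fun_mult_op[OF m, of g]
    by (intro L2_eqI, eventually_elim) simp
  show "norm (mult_op m g) \<le> norm g * M" for g
    using norm_mult_op_le[OF m, of g] by (simp add: mult.commute)
qed

lemma bounded_multiplier_diff:
  assumes m: "bounded_multiplier M m" and m': "bounded_multiplier M' m'"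
  shows "bounded_multiplier (M + M') (\<lambda>x. m x - m' x)"
proof -
  have "AE x in lebesgue. \<bar>m x\<bar> \<le> M" "AE x in lebesgue. \<bar>m' x\<bar> \<le> M'"
    using m m' by (auto simp: bounded_multiplier_def)
  then have "AE x in lebesgue. \<bar>m x - m' x\<bar> \<le> M + M'"
    by eventually_elim simp
  then show ?thesis using m m' by (auto simp: bounded_multiplier_def)
qed

lemma mult_op_diff:
  assumes m: "bounded_multiplier M m" and m': "bounded_multiplier M' m'"
  shows "mult_op m g - mult_op m' g = mult_op (\<lambda>x. m x - m' x) g"
  using L2_fun_mult_op[OF m, of g] L2_fun_mult_op[OF m', of g] L2_fun_diff[of "mult_op m g" "mult_op m' g"]
    L2_fun_mult_op[OF bounded_multiplier_diff[OF m m'], of g]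
  by (intro L2_eqI, eventually_elim) (simp add: scaleR_diff_left)

lemma mult_op_cong_AE:
  assumes m: "bounded_multiplier M m" and m': "bounded_multiplier M' m'"
    and eq: "AE x in lebesgue. m x = m' x"
  shows "mult_op m g = mult_op m' g"
  using L2_fun_mult_op[OF m, of g] L2_fun_mult_op[OF m', of g] eq
  by (intro L2_eqI, eventually_elim) simp

lemma mult_op_coercive:
  assumes m: "bounded_multiplier M m" and g: "g \<in> L2_on \<Omega>"
    and lower: "AE x in lebesgue. x \<in> \<Omega> \<longrightarrow> c \<le> m x"
  shows "c * (norm g)\<^sup>2 \<le> mult_op m g \<bullet> g"
proof -
  have "c * (norm g)\<^sup>2 = (\<integral>x. c * (norm (L2_fun g x))\<^sup>2 \<partial>lebesgue)"
    by (simp add: norm_L2_fun)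
  also have "\<dots> \<le> (\<integral>x. m x * (L2_fun g x \<bullet> L2_fun g x) \<partial>lebesgue)"
  proof (rule integral_mono_AE)
    show "integrable lebesgue (\<lambda>x. c * (norm (L2_fun g x))\<^sup>2)"
      using square_integrable_L2_fun[of g] by (simp add: square_integrable_def)
    show "integrable lebesgue (\<lambda>x. m x * (L2_fun g x \<bullet> L2_fun g x))"
      using square_integrable_inner[OF square_integrable_mult[OF m square_integrable_L2_fun[of g]], of "L2_fun g"]
      by simp
    have "AE x in lebesgue. x \<notin> \<Omega> \<longrightarrow> L2_fun g x = 0" using g by (simp add: L2_on_def)
    with lower show "AE x in lebesgue. c * (norm (L2_fun g x))\<^sup>2 \<le> m x * (L2_fun g x \<bullet> L2_fun g x)"
    proof eventually_elim
      case (elim x)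
      then show ?case by (cases "x \<in> \<Omega>") (auto simp: power2_norm_eq_inner intro!: mult_right_mono)
    qed
  qed
  finally show ?thesis by (simp add: inner_mult_op[OF m])
qed

lemma bounded_multiplier_indicator:
  "A \<in> sets lebesgue \<Longrightarrow> bounded_multiplier 1 (indicat_real A)"
  by (simp add: bounded_multiplier_def)

text \<open>As the kernel of a continuous linear operator, \<open>L2_on \<Omega>\<close> is seen to be a closed subspace.\<close>

lemma L2_on_eq_kernel:
  assumes \<Omega>: "\<Omega> \<in> sets lebesgue"
  shows "L2_on \<Omega> = {g. mult_op (indicator (- \<Omega>)) g = 0}"
proof -
  have m: "bounded_multiplier 1 (indicat_real (- \<Omega>))"
    using \<Omega> by (intro bounded_multiplier_indicator) (simp add: Compl_in_sets_lebesgue)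
  have z: "AE x in lebesgue. L2_fun (0 :: ('a, 'b) L2) x = 0" by (rule L2_fun_zero)
  show ?thesis
  proof (intro set_eqI iffI; clarsimp)
    fix g :: "('a, 'b) L2" assume "g \<in> L2_on \<Omega>"
    then have "AE x in lebesgue. x \<notin> \<Omega> \<longrightarrow> L2_fun g x = 0" by (simp add: L2_on_def)
    then show "mult_op (indicator (- \<Omega>)) g = 0"
      using L2_fun_mult_op[OF m, of g] z by (intro L2_eqI, eventually_elim) (auto simp: indicator_def)
  next
    fix g :: "('a, 'b) L2" assume "mult_op (indicator (- \<Omega>)) g = 0"
    then have "AE x in lebesgue. x \<notin> \<Omega> \<longrightarrow> L2_fun g x = 0"
      using L2_fun_mult_op[OF m, of g] z by (simp, eventually_elim) (auto simp: indicator_def)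
    then show "g \<in> L2_on \<Omega>" by (simp add: L2_on_def)
  qed
qed

lemma closed_subspace_L2_on:
  fixes \<Omega> :: "'a::euclidean_space set"
  assumes \<Omega>: "\<Omega> \<in> sets lebesgue"
  shows "closed (L2_on \<Omega> :: ('a, 'b::euclidean_space) L2 set)"
    and "subspace (L2_on \<Omega> :: ('a, 'b) L2 set)"
proof -
  have "bounded_multiplier 1 (indicat_real (- \<Omega>))"
    using \<Omega> by (intro bounded_multiplier_indicator) (simp add: Compl_in_sets_lebesgue)
  then interpret T: bounded_linear "mult_op (indicat_real (- \<Omega>)) :: ('a, 'b) L2 \<Rightarrow> _"
    by (rule bounded_linear_mult_op)
  show "closed (L2_on \<Omega> :: ('a, 'b) L2 set)"
    unfolding L2_on_eq_kernel[OF \<Omega>] by (intro closed_Collect_eq T.continuous_on continuous_intros)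
  show "subspace (L2_on \<Omega> :: ('a, 'b) L2 set)"
    unfolding L2_on_eq_kernel[OF \<Omega>] subspace_def by (auto simp: T.add T.scaleR T.zero)
qed

lemma L2_class_in_L2_on:
  assumes "square_integrable f" "\<And>x. x \<notin> \<Omega> \<Longrightarrow> f x = 0"
  shows "L2_class f \<in> L2_on \<Omega>"
  using L2_fun_L2_class[OF assms(1)] assms(2) unfolding L2_on_def by (auto elim: eventually_mono)

definition grad :: "('a::euclidean_space \<Rightarrow> real) \<Rightarrow> 'a \<Rightarrow> 'a" where
  "grad \<phi> x = (\<Sum>i\<in>Basis. frechet_derivative \<phi> (at x) i *\<^sub>R i)"

lemma grad_inner_Basis: "i \<in> Basis \<Longrightarrow> grad \<phi> x \<bullet> i = frechet_derivative \<phi> (at x) i"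
  by (simp add: grad_def inner_sum_left_Basis)

lemma test_function_C_k: "\<phi> \<in> test_functions \<Omega> \<Longrightarrow> C_k k \<phi>"
  by (simp add: test_functions_def)

lemma test_function_zero_outside:
  assumes "\<phi> \<in> test_functions \<Omega>" "x \<notin> \<Omega>"
  shows "\<phi> x = 0" "frechet_derivative \<phi> (at x) v = 0" "grad \<phi> x = 0"
proof -
  have "x \<notin> closure {x. \<phi> x \<noteq> 0}" using assms by (auto simp: test_functions_def)
  then show "\<phi> x = 0" "frechet_derivative \<phi> (at x) v = 0" for v
    using closure_subset[of "{x. \<phi> x \<noteq> 0}"] frechet_derivative_zero_off_support by auto
  then show "grad \<phi> x = 0" by (simp add: grad_def)
qed

lemma test_function_bounded_support:
  fixes \<phi> :: "'a::euclidean_space \<Rightarrow> real"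
  assumes "\<phi> \<in> test_functions \<Omega>"
  obtains R where "\<And>x. R < norm x \<Longrightarrow> \<phi> x = 0"
    and "\<And>x v. R < norm x \<Longrightarrow> frechet_derivative \<phi> (at x) v = 0"
    and "\<And>x. R < norm x \<Longrightarrow> grad \<phi> x = 0"
proof -
  have "bounded (closure {x. \<phi> x \<noteq> 0})" using assms by (simp add: test_functions_def compact_imp_bounded)
  then obtain R where R: "\<And>x. x \<in> closure {x. \<phi> x \<noteq> 0} \<Longrightarrow> norm x \<le> R" by (auto simp: bounded_iff)
  have *: "x \<notin> closure {x. \<phi> x \<noteq> 0}" if "R < norm x" for x using R[of x] that by auto
  show ?thesis
  proof (rule that)
    fix x :: 'a assume x: "R < norm x"
    show "\<phi> x = 0" using *[OF x] closure_subset[of "{x. \<phi> x \<noteq> 0}"] by auto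
    show fr: "frechet_derivative \<phi> (at x) v = 0" for v
      using *[OF x] by (rule frechet_derivative_zero_off_support)
    show "grad \<phi> x = 0" by (simp add: grad_def fr)
  qed
qed

lemma test_function_continuous:
  assumes "\<phi> \<in> test_functions \<Omega>"
  shows "continuous_on UNIV \<phi>" "continuous_on UNIV (\<lambda>x. frechet_derivative \<phi> (at x) v)"
    "continuous_on UNIV (grad \<phi>)"
proof -
  show "continuous_on UNIV \<phi>" using test_function_C_k[OF assms, of 0] by simp
  show fr: "continuous_on UNIV (\<lambda>x. frechet_derivative \<phi> (at x) v)" for v
    using test_function_C_k[OF assms, of "Suc 0"] by simp
  show "continuous_on UNIV (grad \<phi>)"
    unfolding grad_def[abs_def] by (intro continuous_intros fr)
qed

lemma test_function_square_integrable:
  assumes "\<phi> \<in> test_functions \<Omega>"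
  shows "square_integrable \<phi>" "square_integrable (\<lambda>x. frechet_derivative \<phi> (at x) v)"
    "square_integrable (grad \<phi>)" "square_integrable (\<lambda>x. \<phi> x *\<^sub>R w)"
proof -
  obtain R where R: "\<And>x. R < norm x \<Longrightarrow> \<phi> x = 0"
    "\<And>x v. R < norm x \<Longrightarrow> frechet_derivative \<phi> (at x) v = 0" "\<And>x. R < norm x \<Longrightarrow> grad \<phi> x = 0"
    using test_function_bounded_support[OF assms] by metis
  note cont = test_function_continuous[OF assms]
  show "square_integrable \<phi>" "square_integrable (\<lambda>x. frechet_derivative \<phi> (at x) v)"
    "square_integrable (grad \<phi>)" "square_integrable (\<lambda>x. \<phi> x *\<^sub>R w)"
    by (rule square_integrable_continuous_bounded_support[where R = R];
        use cont R in \<open>auto intro!: continuous_intros\<close>)+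
qed

lemma test_functions_lincomb:
  assumes \<phi>: "\<phi> \<in> test_functions \<Omega>" and \<eta>: "\<eta> \<in> test_functions \<Omega>"
  shows "(\<lambda>x. \<phi> x + c * \<eta> x) \<in> test_functions \<Omega>"
    and "grad (\<lambda>x. \<phi> x + c * \<eta> x) = (\<lambda>x. grad \<phi> x + c *\<^sub>R grad \<eta> x)"
proof -
  let ?f = "\<lambda>x. \<phi> x + c * \<eta> x"
  have sub: "closure {x. ?f x \<noteq> 0} \<subseteq> closure {x. \<phi> x \<noteq> 0} \<union> closure {x. \<eta> x \<noteq> 0}"
    unfolding closure_Un[symmetric] by (intro closure_mono) auto
  have "compact (closure {x. \<phi> x \<noteq> 0} \<union> closure {x. \<eta> x \<noteq> 0})"
    using \<phi> \<eta> by (intro compact_Un) (auto simp: test_functions_def)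
  then have "compact (closure {x. ?f x \<noteq> 0})"
    using bounded_subset[OF compact_imp_bounded sub] by (simp add: compact_eq_bounded_closed)
  moreover have "C_k k ?f" for k
    by (rule C_k_add[OF test_function_C_k[OF \<phi>] C_k_mult[OF C_k_const test_function_C_k[OF \<eta>]]])
  moreover have "closure {x. ?f x \<noteq> 0} \<subseteq> \<Omega>"
    using sub \<phi> \<eta> by (auto simp: test_functions_def)
  ultimately show "?f \<in> test_functions \<Omega>" by (simp add: test_functions_def)
  have "frechet_derivative ?f (at x) i = frechet_derivative \<phi> (at x) i + c * frechet_derivative \<eta> (at x) i" for x i
  proof -
    have "(?f has_derivative (\<lambda>v. frechet_derivative \<phi> (at x) v + c * frechet_derivative \<eta> (at x) v)) (at x)"
      by (intro has_derivative_add has_derivative_mult_right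
          C_k_Suc_derivative[OF test_function_C_k[OF \<phi>]] C_k_Suc_derivative[OF test_function_C_k[OF \<eta>]])
    from frechet_derivative_at[OF this, symmetric] show ?thesis by simp
  qed
  then show "grad ?f = (\<lambda>x. grad \<phi> x + c *\<^sub>R grad \<eta> x)"
    by (simp add: fun_eq_iff grad_def scaleR_add_left sum.distrib scaleR_sum_right)
qed

lemma zero_test_function: "(\<lambda>x. 0) \<in> test_functions \<Omega>" "grad (\<lambda>x::'a::euclidean_space. 0) = (\<lambda>x. 0)"
  by (auto simp: test_functions_def C_k_const grad_def fun_eq_iff)

text \<open>In this form the defining identity is linear and continuous in the pair \<open>(w, g)\<close>. The integrals over \<open>\<Omega>\<close> are inner
products because test functions and their derivatives vanish off \<open>\<Omega>\<close>.\<close>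

lemma has_weak_gradient_iff_inner:
  "has_weak_gradient \<Omega> w g \<longleftrightarrow> (\<forall>\<phi>\<in>test_functions \<Omega>. \<forall>i\<in>Basis.
     w \<bullet> L2_class (\<lambda>x. frechet_derivative \<phi> (at x) i) = - (g \<bullet> L2_class (\<lambda>x. \<phi> x *\<^sub>R i)))"
proof -
  have "(LINT x:\<Omega>|lebesgue. L2_fun w x * frechet_derivative \<phi> (at x) i)
      = w \<bullet> L2_class (\<lambda>x. frechet_derivative \<phi> (at x) i)"
    and "(LINT x:\<Omega>|lebesgue. (L2_fun g x \<bullet> i) * \<phi> x) = g \<bullet> L2_class (\<lambda>x. \<phi> x *\<^sub>R i)"
    if \<phi>: "\<phi> \<in> test_functions \<Omega>" for \<phi> i
  proof -
    have "(LINT x:\<Omega>|lebesgue. L2_fun w x * frechet_derivative \<phi> (at x) i)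
        = (\<integral>x. L2_fun w x * frechet_derivative \<phi> (at x) i \<partial>lebesgue)"
      unfolding set_lebesgue_integral_def using test_function_zero_outside[OF \<phi>]
      by (intro Bochner_Integration.integral_cong) (auto simp: indicator_def)
    then show "(LINT x:\<Omega>|lebesgue. L2_fun w x * frechet_derivative \<phi> (at x) i)
      = w \<bullet> L2_class (\<lambda>x. frechet_derivative \<phi> (at x) i)"
      using inner_L2_class[of "L2_fun w" "\<lambda>x. frechet_derivative \<phi> (at x) i"]
      by (simp add: test_function_square_integrable[OF \<phi>])
    have "(LINT x:\<Omega>|lebesgue. (L2_fun g x \<bullet> i) * \<phi> x) = (\<integral>x. (L2_fun g x \<bullet> i) * \<phi> x \<partial>lebesgue)"
      unfolding set_lebesgue_integral_def using test_function_zero_outside[OF \<phi>]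
      by (intro Bochner_Integration.integral_cong) (auto simp: indicator_def)
    then show "(LINT x:\<Omega>|lebesgue. (L2_fun g x \<bullet> i) * \<phi> x) = g \<bullet> L2_class (\<lambda>x. \<phi> x *\<^sub>R i)"
      using inner_L2_class[of "L2_fun g" "\<lambda>x. \<phi> x *\<^sub>R i"]
      by (simp add: test_function_square_integrable[OF \<phi>] mult.commute)
  qed
  then show ?thesis unfolding has_weak_gradient_def by auto
qed

lemma weak_gradient_unique:
  assumes \<Omega>: "open \<Omega>" and g: "g \<in> L2_on \<Omega>" "has_weak_gradient \<Omega> w g"
    and h: "h \<in> L2_on \<Omega>" "has_weak_gradient \<Omega> w h"
  shows "g = h"
proof -
  have sets: "\<Omega> \<in> sets lebesgue" using \<Omega> by auto
  define d where "d = g - h"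
  have d_on: "d \<in> L2_on \<Omega>"
    unfolding d_def using g h closed_subspace_L2_on(2)[OF sets] by (intro subspace_diff)
  have "has_weak_gradient \<Omega> 0 d"
    using g(2) h(2) unfolding has_weak_gradient_iff_inner d_def by (auto simp: inner_diff_left)
  have "AE x in lebesgue. x \<in> \<Omega> \<longrightarrow> L2_fun d x \<bullet> i = 0" if i: "i \<in> Basis" for i
  proof (rule fundamental_lemma_calculus_of_variations[OF \<Omega>])
    have "square_integrable (\<lambda>x. (L2_fun d x \<bullet> i) *\<^sub>R (1::real))"
    proof (rule square_integrable_bound)
      show "(\<lambda>x. (L2_fun d x \<bullet> i) *\<^sub>R (1::real)) \<in> borel_measurable lebesgue" by measurable
      show "integrable lebesgue (\<lambda>x. (norm (L2_fun d x))\<^sup>2)"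
        using square_integrable_L2_fun[of d] by (simp add: square_integrable_def)
      show "AE x in lebesgue. (norm ((L2_fun d x \<bullet> i) *\<^sub>R (1::real)))\<^sup>2 \<le> (norm (L2_fun d x))\<^sup>2"
        using Basis_le_norm[OF i] by (intro AE_I2) (simp add: abs_le_square_iff[symmetric])
    qed
    then show "square_integrable (\<lambda>x. L2_fun d x \<bullet> i)" by simp
    fix \<phi> assume \<phi>: "\<phi> \<in> test_functions \<Omega>"
    have "(LINT x:\<Omega>|lebesgue. L2_fun 0 x * frechet_derivative \<phi> (at x) i) = (\<integral>x. 0 \<partial>(lebesgue :: 'a measure))"
      unfolding set_lebesgue_integral_def
      using L2_fun_zero[where ?'a = 'a and ?'b = real] sets test_function_square_integrable(2)[OF \<phi>, of i]
      by (intro integral_cong_AE) (auto elim!: eventually_mono)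
    then show "(LINT x:\<Omega>|lebesgue. (L2_fun d x \<bullet> i) * \<phi> x) = 0"
      using \<open>has_weak_gradient \<Omega> 0 d\<close> \<phi> i unfolding has_weak_gradient_def by auto
  qed
  then have "AE x in lebesgue. \<forall>i\<in>Basis. x \<in> \<Omega> \<longrightarrow> L2_fun d x \<bullet> i = 0"
    by (subst AE_finite_all) auto
  moreover have "AE x in lebesgue. x \<notin> \<Omega> \<longrightarrow> L2_fun d x = 0" using d_on by (simp add: L2_on_def)
  moreover have "AE x in lebesgue. L2_fun (0 :: ('a, 'a) L2) x = 0" by (rule L2_fun_zero)
  ultimately have "d = 0"
    by (intro L2_eqI, eventually_elim) (metis euclidean_eqI inner_zero_left)
  then show ?thesis by (simp add: d_def)
qed

lemma weak_grad_eqI: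
  assumes "open \<Omega>" "g \<in> L2_on \<Omega>" "has_weak_gradient \<Omega> w g"
  shows "weak_grad \<Omega> w = g"
  unfolding weak_grad_def using assms weak_gradient_unique by blast

lemma test_function_weak_gradient:
  assumes \<phi>: "\<phi> \<in> test_functions \<Omega>"
  shows "has_weak_gradient \<Omega> (L2_class \<phi>) (L2_class (grad \<phi>))"
  unfolding has_weak_gradient_iff_inner
proof (intro ballI)
  fix \<eta> i assume \<eta>: "\<eta> \<in> test_functions \<Omega>" and i: "(i::'a) \<in> Basis"
  let ?F = "\<lambda>x. \<phi> x * \<eta> x"
  obtain R where R: "\<And>x. R < norm x \<Longrightarrow> \<phi> x = 0"
    using test_function_bounded_support[OF \<phi>] by metis
  have "(?F has_derivative (\<lambda>v. \<phi> x * frechet_derivative \<eta> (at x) v + frechet_derivative \<phi> (at x) v * \<eta> x)) (at x)" for x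
    by (rule has_derivative_mult[OF C_k_Suc_derivative[OF test_function_C_k[OF \<phi>]]
          C_k_Suc_derivative[OF test_function_C_k[OF \<eta>]]])
  from frechet_derivative_at[OF this, symmetric]
  have der: "frechet_derivative ?F (at x) i = \<phi> x * frechet_derivative \<eta> (at x) i + frechet_derivative \<phi> (at x) i * \<eta> x" for x
    by simp
  note sq = test_function_square_integrable[OF \<phi>] test_function_square_integrable[OF \<eta>]
  have "0 = (\<integral>x. frechet_derivative ?F (at x) i \<partial>lebesgue)"
    using R C_k_mult[OF test_function_C_k[OF \<phi>] test_function_C_k[OF \<eta>]]
    by (intro integral_derivative_eq_0[where R = R, symmetric]) auto
  also have "\<dots> = (\<integral>x. \<phi> x * frechet_derivative \<eta> (at x) i \<partial>lebesgue) + (\<integral>x. frechet_derivative \<phi> (at x) i * \<eta> x \<partial>lebesgue)"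
    unfolding der using square_integrable_inner[OF sq(1) sq(6), of i] square_integrable_inner[OF sq(2) sq(5), of i]
    by (intro Bochner_Integration.integral_add) auto
  also have "(\<integral>x. \<phi> x * frechet_derivative \<eta> (at x) i \<partial>lebesgue) = L2_class \<phi> \<bullet> L2_class (\<lambda>x. frechet_derivative \<eta> (at x) i)"
    using sq by (simp add: inner_L2_class)
  also have "(\<integral>x. frechet_derivative \<phi> (at x) i * \<eta> x \<partial>lebesgue) = L2_class (grad \<phi>) \<bullet> L2_class (\<lambda>x. \<eta> x *\<^sub>R i)"
    using i by (simp add: inner_L2_class[OF sq(3) sq(8)] grad_inner_Basis mult.commute)
  finally show "L2_class \<phi> \<bullet> L2_class (\<lambda>x. frechet_derivative \<eta> (at x) i) = - (L2_class (grad \<phi>) \<bullet> L2_class (\<lambda>x. \<eta> x *\<^sub>R i))"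
    by simp
qed

section \<open>The Poincare inequality and completeness of the energy norm\<close>

lemma C_k_linear_coordinate: "C_k k (\<lambda>x. x \<bullet> e)"
proof -
  define G :: "nat \<Rightarrow> real \<Rightarrow> real" where "G n t = (if n = 0 then t else if n = 1 then 1 else 0)" for n t
  have "(G n has_real_derivative G (Suc n) t) (at t)" for n t
    by (cases "n = 0") (auto simp: G_def[abs_def])
  from C_k_ridge[of G, OF this, of k 0 0 1 e] show ?thesis by (simp add: G_def)
qed

text \<open>Integrate the derivative of \<open>(x \<bullet> i) * (\<phi> x)\<^sup>2\<close> in the direction \<open>i\<close>: this expresses the integral
of \<open>\<phi>\<^sup>2\<close> through \<open>2 * (x \<bullet> i) * \<phi> * \<partial>\<^sub>i \<phi>\<close>, where \<open>\<bar>x \<bullet> i\<bar> \<le> R\<close> on \<open>\<Omega>\<close>.\<close>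

lemma poincare_test_function:
  fixes \<Omega> :: "'a::euclidean_space set"
  assumes R: "\<Omega> \<subseteq> cball 0 R" "0 \<le> R" and \<phi>: "\<phi> \<in> test_functions \<Omega>"
  shows "norm (L2_class \<phi>) \<le> 2 * R * norm (L2_class (grad \<phi>))"
proof -
  obtain i :: 'a where i: "i \<in> Basis" using nonempty_Basis by blast
  define F where "F x = (x \<bullet> i) * (\<phi> x * \<phi> x)" for x
  define h where "h x = ((x \<bullet> i) * \<phi> x) *\<^sub>R i" for x
  obtain r where r: "\<And>x. r < norm x \<Longrightarrow> \<phi> x = 0"
    using test_function_bounded_support[OF \<phi>] by metis
  note sq = test_function_square_integrable[OF \<phi>]
  have sq_h: "square_integrable h"
    by (rule square_integrable_continuous_bounded_support[where R = r])
      (auto simp: h_def[abs_def] r intro!: continuous_intros test_function_continuous(1)[OF \<phi>])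
  have "(F has_derivative (\<lambda>v. (x \<bullet> i) * (\<phi> x * frechet_derivative \<phi> (at x) v + frechet_derivative \<phi> (at x) v * \<phi> x)
      + (v \<bullet> i) * (\<phi> x * \<phi> x))) (at x)" for x
    unfolding F_def[abs_def]
    by (intro has_derivative_mult C_k_Suc_derivative[OF test_function_C_k[OF \<phi>]]
        has_derivative_inner_left has_derivative_ident)
  from frechet_derivative_at[OF this, symmetric]
  have der: "frechet_derivative F (at x) i = 2 * (h x \<bullet> grad \<phi> x) + \<phi> x \<bullet> \<phi> x" for x
    using grad_inner_Basis[OF i, of \<phi> x] inner_commute[of i "grad \<phi> x"] i by (simp add: h_def algebra_simps)
  have "C_k (Suc 0) F"
    unfolding F_def[abs_def]
    by (rule C_k_mult[OF C_k_linear_coordinate C_k_mult[OF test_function_C_k[OF \<phi>] test_function_C_k[OF \<phi>]]])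
  then have "0 = (\<integral>x. frechet_derivative F (at x) i \<partial>lebesgue)"
    by (rule integral_derivative_eq_0[where R = r, symmetric]) (simp add: F_def r)
  also have "\<dots> = 2 * (\<integral>x. h x \<bullet> grad \<phi> x \<partial>lebesgue) + (\<integral>x. \<phi> x \<bullet> \<phi> x \<partial>lebesgue)"
    unfolding der using square_integrable_inner[OF sq_h sq(3)] square_integrable_inner[OF sq(1) sq(1)]
    by (subst Bochner_Integration.integral_add) auto
  also have "\<dots> = 2 * (L2_class h \<bullet> L2_class (grad \<phi>)) + (norm (L2_class \<phi>))\<^sup>2"
    using sq_h sq by (simp add: inner_L2_class power2_norm_eq_inner)
  finally have "(norm (L2_class \<phi>))\<^sup>2 \<le> 2 * \<bar>L2_class h \<bullet> L2_class (grad \<phi>)\<bar>" by linarith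
  also have "\<bar>L2_class h \<bullet> L2_class (grad \<phi>)\<bar> \<le> norm (L2_class h) * norm (L2_class (grad \<phi>))"
    by (rule Cauchy_Schwarz_ineq2)
  also have "norm (L2_class h) \<le> R * norm (L2_class \<phi>)"
  proof (rule power2_le_imp_le)
    have "(norm (L2_class h))\<^sup>2 = (\<integral>x. (norm (h x))\<^sup>2 \<partial>lebesgue)" by (rule norm_L2_class[OF sq_h])
    also have "\<dots> \<le> (\<integral>x. R\<^sup>2 * (norm (\<phi> x))\<^sup>2 \<partial>lebesgue)"
    proof (rule integral_mono)
      show "integrable lebesgue (\<lambda>x. (norm (h x))\<^sup>2)" using sq_h by (simp add: square_integrable_def)
      show "integrable lebesgue (\<lambda>x. R\<^sup>2 * (norm (\<phi> x))\<^sup>2)" using sq(1) by (simp add: square_integrable_def)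
      fix x
      show "(norm (h x))\<^sup>2 \<le> R\<^sup>2 * (norm (\<phi> x))\<^sup>2"
      proof (cases "x \<in> \<Omega>")
        case True
        then have "\<bar>x \<bullet> i\<bar> \<le> R" using R Basis_le_norm[OF i, of x] by auto
        then have "(x \<bullet> i)\<^sup>2 \<le> R\<^sup>2" using R(2) by (simp add: abs_le_square_iff[symmetric])
        then show ?thesis using i by (simp add: h_def power_mult_distrib mult_right_mono)
      next
        case False
        then show ?thesis using test_function_zero_outside[OF \<phi>] by (simp add: h_def)
      qed
    qed
    also have "\<dots> = (R * norm (L2_class \<phi>))\<^sup>2"
      using norm_L2_class[OF sq(1)] by (simp add: power_mult_distrib)
    finally show "(norm (L2_class h))\<^sup>2 \<le> (R * norm (L2_class \<phi>))\<^sup>2" .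
  qed (use R in simp)
  finally have "norm (L2_class \<phi>) * norm (L2_class \<phi>)
      \<le> norm (L2_class \<phi>) * (2 * R * norm (L2_class (grad \<phi>)))"
    by (simp add: power2_eq_square mult_right_mono algebra_simps)
  then show ?thesis
    using R(2) by (cases "norm (L2_class \<phi>) = 0") auto
qed

lemma subspace_closure:
  fixes T :: "'a::real_normed_vector set"
  assumes T: "subspace T"
  shows "subspace (closure T)"
  unfolding subspace_def
proof (intro conjI ballI allI)
  show "0 \<in> closure T"
    using subspace_0[OF T] closure_subset by blast
next
  fix u v assume "u \<in> closure T" "v \<in> closure T"
  then obtain f g where "\<And>n. f n \<in> T" "f \<longlonglongrightarrow> u" "\<And>n. g n \<in> T" "g \<longlonglongrightarrow> v"
    unfolding closure_sequential by blast
  then show "u + v \<in> closure T"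
    unfolding closure_sequential using subspace_add[OF T] tendsto_add
    by (intro exI[of _ "\<lambda>n. f n + g n"]) auto
next
  fix c u assume "u \<in> closure T"
  then obtain f where "\<And>n. f n \<in> T" "f \<longlonglongrightarrow> u"
    unfolding closure_sequential by blast
  then show "c *\<^sub>R u \<in> closure T"
    unfolding closure_sequential using subspace_scale[OF T]
    by (intro exI[of _ "\<lambda>n. c *\<^sub>R f n"]) (auto intro: tendsto_intros)
qed

text \<open>The closure of the graph of the gradient on test functions. Linearity, the Poincare inequality and the weak
gradient identity are closed conditions, so all of them pass from test functions to this set, and it is complete.\<close>

definition sobolev_graph :: "'a::euclidean_space set \<Rightarrow> (('a, real) L2 \<times> ('a, 'a) L2) set" where
  "sobolev_graph \<Omega> = closure ((\<lambda>\<phi>. (L2_class \<phi>, L2_class (grad \<phi>))) ` test_functions \<Omega>)"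

lemma subspace_sobolev_graph:
  fixes \<Omega> :: "'a::euclidean_space set"
  shows "subspace (sobolev_graph \<Omega>)"
proof -
  let ?T = "(\<lambda>\<phi>. (L2_class \<phi>, L2_class (grad \<phi>))) ` test_functions \<Omega>"
  have lin: "u + c *\<^sub>R v \<in> ?T" if mem: "u \<in> ?T" "v \<in> ?T" for u v c
  proof -
    obtain \<phi> \<eta> :: "'a \<Rightarrow> real" where t: "\<phi> \<in> test_functions \<Omega>" "\<eta> \<in> test_functions \<Omega>"
      and uv: "u = (L2_class \<phi>, L2_class (grad \<phi>))" "v = (L2_class \<eta>, L2_class (grad \<eta>))"
      using mem by blast
    note sq = test_function_square_integrable[OF t(1)] test_function_square_integrable[OF t(2)]
    note lc = test_functions_lincomb[OF t, of c]
    have "L2_class (\<lambda>x. \<phi> x + c * \<eta> x) = L2_class \<phi> + c *\<^sub>R L2_class \<eta>"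
      using L2_class_add[OF sq(1) square_integrable_scaleR[OF sq(5), of c]] L2_class_scaleR[OF sq(5), of c] by simp
    moreover have "L2_class (grad (\<lambda>x. \<phi> x + c * \<eta> x)) = L2_class (grad \<phi>) + c *\<^sub>R L2_class (grad \<eta>)"
      using L2_class_add[OF sq(3) square_integrable_scaleR[OF sq(7), of c]] L2_class_scaleR[OF sq(7), of c] lc(2) by simp
    ultimately show ?thesis
      using lc(1) uv by (intro image_eqI[where x = "\<lambda>x. \<phi> x + c * \<eta> x"]) auto
  qed
  have zero: "0 \<in> ?T"
    by (rule image_eqI[where x = "\<lambda>x. 0"]) (simp_all add: zero_test_function L2_class_0 zero_prod_def)
  have "subspace ?T"
  proof (rule subspaceI[OF zero])
    show "u + v \<in> ?T" if "u \<in> ?T" "v \<in> ?T" for u v using lin[OF that, of 1] by simp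
    show "c *\<^sub>R u \<in> ?T" if "u \<in> ?T" for u c using lin[OF zero that, of c] by simp
  qed
  then show ?thesis unfolding sobolev_graph_def by (rule subspace_closure)
qed

lemma sobolev_graph_weak_gradient:
  fixes \<Omega> :: "'a::euclidean_space set"
  assumes \<Omega>: "open \<Omega>" and wg: "(w, g) \<in> sobolev_graph \<Omega>"
  shows "w \<in> L2_on \<Omega>" "g \<in> L2_on \<Omega>" "has_weak_gradient \<Omega> w g"
proof -
  have sets: "\<Omega> \<in> sets lebesgue" using \<Omega> by auto
  define W where "W = {(w, g). w \<in> L2_on \<Omega> \<and> g \<in> L2_on \<Omega> \<and> has_weak_gradient \<Omega> w g}"
  have "W = (L2_on \<Omega> \<times> L2_on \<Omega>) \<inter> (\<Inter>\<phi>\<in>test_functions \<Omega>. \<Inter>i\<in>Basis.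
      {p. fst p \<bullet> L2_class (\<lambda>x. frechet_derivative \<phi> (at x) i) = - (snd p \<bullet> L2_class (\<lambda>x. \<phi> x *\<^sub>R i))})"
    unfolding W_def has_weak_gradient_iff_inner by auto
  moreover have "closed \<dots>"
    by (intro closed_Int closed_Times closed_subspace_L2_on sets closed_INT ballI closed_Collect_eq continuous_intros)
  ultimately have "closed W" by simp
  moreover have "(\<lambda>\<phi>. (L2_class \<phi>, L2_class (grad \<phi>))) ` test_functions \<Omega> \<subseteq> W"
    by (auto simp: W_def test_function_zero_outside test_function_square_integrable
        intro!: L2_class_in_L2_on test_function_weak_gradient)
  ultimately have "sobolev_graph \<Omega> \<subseteq> W"
    unfolding sobolev_graph_def by (intro closure_minimal)
  then show "w \<in> L2_on \<Omega>" "g \<in> L2_on \<Omega>" "has_weak_gradient \<Omega> w g"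
    using wg by (auto simp: W_def)
qed

text \<open>The norm of a pair in the product space is exactly \<open>H1_norm\<close>, which turns approximability by test functions
into membership in the closure.\<close>

lemma H10_iff_sobolev_graph:
  fixes \<Omega> :: "'a::euclidean_space set"
  assumes \<Omega>: "open \<Omega>"
  shows "w \<in> H10 \<Omega> \<longleftrightarrow> (w, weak_grad \<Omega> w) \<in> sobolev_graph \<Omega>"
    and "(w, g) \<in> sobolev_graph \<Omega> \<Longrightarrow> weak_grad \<Omega> w = g"
proof -
  have sets: "\<Omega> \<in> sets lebesgue" using \<Omega> by auto
  show grad_eq: "weak_grad \<Omega> w = g" if "(w, g) \<in> sobolev_graph \<Omega>" for w g
    using weak_grad_eqI[OF \<Omega>] sobolev_graph_weak_gradient[OF \<Omega> that] by blast
  have dist: "H1_norm \<Omega> (w - L2_class \<phi>) = dist (L2_class \<phi>, L2_class (grad \<phi>)) (w, weak_grad \<Omega> w)"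
    if w: "w \<in> H1 \<Omega>" and \<phi>: "\<phi> \<in> test_functions \<Omega>" for w \<phi>
  proof -
    obtain g where g: "g \<in> L2_on \<Omega>" "has_weak_gradient \<Omega> w g" using w by (auto simp: H1_def)
    have "(L2_class \<phi>, L2_class (grad \<phi>)) \<in> sobolev_graph \<Omega>"
      unfolding sobolev_graph_def using \<phi> by (intro closure_subset[THEN subsetD] imageI)
    note h = sobolev_graph_weak_gradient[OF \<Omega> this]
    have "weak_grad \<Omega> (w - L2_class \<phi>) = g - L2_class (grad \<phi>)"
    proof (rule weak_grad_eqI[OF \<Omega>])
      show "g - L2_class (grad \<phi>) \<in> L2_on \<Omega>"
        using g(1) h(2) by (intro subspace_diff closed_subspace_L2_on sets)
      show "has_weak_gradient \<Omega> (w - L2_class \<phi>) (g - L2_class (grad \<phi>))"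
        using g(2) h(3) unfolding has_weak_gradient_iff_inner by (simp add: inner_diff_left)
    qed
    then show ?thesis using weak_grad_eqI[OF \<Omega> g] by (simp add: H1_norm_def dist_norm norm_Pair norm_minus_commute[of w] norm_minus_commute[of g])
  qed
  show "w \<in> H10 \<Omega> \<longleftrightarrow> (w, weak_grad \<Omega> w) \<in> sobolev_graph \<Omega>"
  proof
    assume w: "w \<in> H10 \<Omega>"
    then have w1: "w \<in> H1 \<Omega>" by (simp add: H10_def)
    show "(w, weak_grad \<Omega> w) \<in> sobolev_graph \<Omega>"
      unfolding sobolev_graph_def closure_approachable
    proof (intro allI impI)
      fix e :: real assume "e > 0"
      then obtain \<phi> where "\<phi> \<in> test_functions \<Omega>" "H1_norm \<Omega> (w - L2_class \<phi>) < e"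
        using w by (auto simp: H10_def)
      then show "\<exists>y\<in>(\<lambda>\<phi>. (L2_class \<phi>, L2_class (grad \<phi>))) ` test_functions \<Omega>. dist y (w, weak_grad \<Omega> w) < e"
        using dist[OF w1] by auto
    qed
  next
    assume wg: "(w, weak_grad \<Omega> w) \<in> sobolev_graph \<Omega>"
    then have w1: "w \<in> H1 \<Omega>" using sobolev_graph_weak_gradient[OF \<Omega> wg] by (auto simp: H1_def)
    moreover have "\<exists>\<phi>\<in>test_functions \<Omega>. H1_norm \<Omega> (w - L2_class \<phi>) < e" if e: "e > 0" for e
    proof -
      obtain \<phi> where \<phi>: "\<phi> \<in> test_functions \<Omega>"
        and "dist (L2_class \<phi>, L2_class (grad \<phi>)) (w, weak_grad \<Omega> w) < e"
        using wg e unfolding sobolev_graph_def closure_approachable by blast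
      then have "H1_norm \<Omega> (w - L2_class \<phi>) < e"
        using dist[OF w1 \<phi>] by simp
      then show ?thesis using \<phi> by blast
    qed
    ultimately show "w \<in> H10 \<Omega>" by (simp add: H10_def)
  qed
qed

lemma weak_grad_in_L2_on:
  "open \<Omega> \<Longrightarrow> w \<in> H10 \<Omega> \<Longrightarrow> weak_grad \<Omega> w \<in> L2_on \<Omega>"
  using H10_iff_sobolev_graph(1) sobolev_graph_weak_gradient(2) by blast

lemma H10_energy_space:
  fixes \<Omega> :: "'a::euclidean_space set"
  assumes \<Omega>: "open \<Omega>" and R: "\<Omega> \<subseteq> cball 0 R" "0 < R"
  shows "energy_space (H10 \<Omega>) (weak_grad \<Omega>) (2 * R)"
proof
  note mem = H10_iff_sobolev_graph(1)[OF \<Omega>] and eq = H10_iff_sobolev_graph(2)[OF \<Omega>]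
  have in_H10: "w \<in> H10 \<Omega>" if "(w, g) \<in> sobolev_graph \<Omega>" for w g
    using that eq[OF that] by (simp add: mem)
  note sub = subspace_sobolev_graph[of \<Omega>]
  have add: "(u + v, weak_grad \<Omega> u + weak_grad \<Omega> v) \<in> sobolev_graph \<Omega>" if "u \<in> H10 \<Omega>" "v \<in> H10 \<Omega>" for u v
    using subspace_add[OF sub, of "(u, weak_grad \<Omega> u)" "(v, weak_grad \<Omega> v)"] that by (simp add: mem)
  have scale: "(c *\<^sub>R u, c *\<^sub>R weak_grad \<Omega> u) \<in> sobolev_graph \<Omega>" if "u \<in> H10 \<Omega>" for u c
    using subspace_scale[OF sub, of "(u, weak_grad \<Omega> u)" c] that by (simp add: mem)
  show "weak_grad \<Omega> (u + v) = weak_grad \<Omega> u + weak_grad \<Omega> v" if "u \<in> H10 \<Omega>" "v \<in> H10 \<Omega>" for u v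
    using add[OF that] by (rule eq)
  show "weak_grad \<Omega> (c *\<^sub>R u) = c *\<^sub>R weak_grad \<Omega> u" if "u \<in> H10 \<Omega>" for u c
    using scale[OF that] by (rule eq)
  show "subspace (H10 \<Omega>)"
    using in_H10[OF add] in_H10[OF scale] in_H10[of 0 0] subspace_0[OF sub]
    by (simp add: subspace_def zero_prod_def)
  show pc: "norm u \<le> 2 * R * norm (weak_grad \<Omega> u)" if "u \<in> H10 \<Omega>" for u
  proof -
    have "sobolev_graph \<Omega> \<subseteq> {p. norm (fst p) \<le> 2 * R * norm (snd p)}"
      unfolding sobolev_graph_def
      by (intro closure_minimal closed_Collect_le continuous_intros)
        (use R poincare_test_function[OF R(1)] in auto)
    then show ?thesis using that by (auto simp: mem)
  qed
  show "0 < 2 * R" using R by simp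
  fix x :: "nat \<Rightarrow> ('a, real) L2"
  assume x: "\<And>k. x k \<in> H10 \<Omega>" and cauchy: "Cauchy (\<lambda>k. weak_grad \<Omega> (x k))"
  have "Cauchy (\<lambda>k. x k)"
  proof (rule CauchyI)
    fix e :: real assume "e > 0"
    then have "e / (2 * R) > 0" using R by simp
    then obtain M where M: "\<And>m n. m \<ge> M \<Longrightarrow> n \<ge> M \<Longrightarrow> norm (weak_grad \<Omega> (x m) - weak_grad \<Omega> (x n)) < e / (2 * R)"
      using CauchyD[OF cauchy] by blast
    have "norm (x m - x n) < e" if "m \<ge> M" "n \<ge> M" for m n
    proof -
      have g: "(x m - x n, weak_grad \<Omega> (x m) - weak_grad \<Omega> (x n)) \<in> sobolev_graph \<Omega>"
        using subspace_diff[OF sub, of "(x m, weak_grad \<Omega> (x m))" "(x n, weak_grad \<Omega> (x n))"] x by (simp add: mem)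
      have "norm (x m - x n) \<le> 2 * R * norm (weak_grad \<Omega> (x m) - weak_grad \<Omega> (x n))"
        using pc[OF in_H10[OF g]] eq[OF g] by simp
      also have "\<dots> < e" using M[OF that] R by (simp add: field_simps)
      finally show ?thesis .
    qed
    then show "\<exists>M. \<forall>m\<ge>M. \<forall>n\<ge>M. norm (x m - x n) < e" by blast
  qed
  then obtain u where u: "x \<longlonglongrightarrow> u" using Cauchy_convergent convergent_def by blast
  obtain g where g: "(\<lambda>k. weak_grad \<Omega> (x k)) \<longlonglongrightarrow> g" using cauchy Cauchy_convergent convergent_def by blast
  have "(x k, weak_grad \<Omega> (x k)) \<in> sobolev_graph \<Omega>" for k
    using x by (simp add: mem)
  moreover have "closed (sobolev_graph \<Omega>)" by (simp add: sobolev_graph_def)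
  ultimately have "(u, g) \<in> sobolev_graph \<Omega>"
    using tendsto_Pair[OF u g] unfolding closed_sequential_limits
    by (elim allE[of _ "\<lambda>k. (x k, weak_grad \<Omega> (x k))"] allE[of _ "(u, g)"]) simp
  then show "\<exists>u\<in>H10 \<Omega>. (\<lambda>k. weak_grad \<Omega> (x k)) \<longlonglongrightarrow> weak_grad \<Omega> u"
    using in_H10 eq g by blast
qed

section \<open>Measurability and reflection of the parameters\<close>

lemma truncation_in_parameters: "y \<in> parameters \<Longrightarrow> truncation s y \<in> parameters"
  by (auto simp: parameters_def truncation_def)

lemma parameters_abs_diff_le:
  assumes "y \<in> parameters" "y' \<in> parameters"
  shows "\<bar>y j - y' j\<bar> \<le> 1"
  using assms[unfolded parameters_def mem_Collect_eq, THEN spec[of _ j]] by auto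

lemma summable_weighted_diff:
  assumes \<beta>: "summable \<beta>" "\<And>j. 0 \<le> \<beta> j" and y: "y \<in> parameters" "y' \<in> parameters"
  shows "summable (\<lambda>j. \<beta> j * \<bar>y j - y' j\<bar>)"
  by (rule summable_comparison_test'[OF \<beta>(1)])
    (use \<beta>(2) parameters_abs_diff_le[OF y] in \<open>auto simp: abs_mult intro: mult_left_le\<close>)

lemma coordinate_measurable_parameter_measure [measurable]:
  "(\<lambda>y. y j) \<in> borel_measurable parameter_measure"
proof -
  have "(\<lambda>y. y j) \<in> parameter_measure \<rightarrow>\<^sub>M restrict_space lborel {-1/2..1/2}"
    unfolding parameter_measure_def by measurable
  from measurable_restrict_space2_iff[THEN iffD1, OF this] show ?thesis by simp
qed

text \<open>The product sigma-algebra is the Borel sigma-algebra of the product topology, so continuity suffices. On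
\<open>parameters\<close> the weighted sum is dominated term by term by the summable sequence \<open>\<beta>\<close>, and Tannery's
theorem lets coordinatewise convergence pass through it.\<close>

lemma measurable_of_weighted_lipschitz:
  fixes f :: "(nat \<Rightarrow> real) \<Rightarrow> 'h::real_normed_vector"
  assumes \<beta>: "summable \<beta>" "\<And>j. 0 \<le> \<beta> j"
    and lip: "\<And>y y'. y \<in> parameters \<Longrightarrow> y' \<in> parameters
      \<Longrightarrow> norm (f y - f y') \<le> L * (\<Sum>j. \<beta> j * \<bar>y j - y' j\<bar>)"
  shows "f \<in> borel_measurable parameter_measure"
proof -
  have "continuous_on parameters f"
    unfolding continuous_on_def
  proof
    fix y assume y: "y \<in> parameters"
    show "(f \<longlongrightarrow> f y) (at y within parameters)"
    proof (cases "at y within parameters = bot")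
      case False
      have coord: "((\<lambda>x. x j) \<longlongrightarrow> y j) (at y within parameters)" for j
        using continuous_on_product_coordinates[of j] continuous_on_subset[of UNIV _ parameters] y
        unfolding continuous_on_def by blast
      have "((\<lambda>x. \<Sum>j. \<beta> j * \<bar>x j - y j\<bar>) \<longlongrightarrow> (\<Sum>j. 0)) (at y within parameters)"
      proof (rule tannerys_theorem[where M = \<beta>, THEN conjunct2, THEN conjunct2])
        have "((\<lambda>x. \<beta> j * \<bar>x j - y j\<bar>) \<longlongrightarrow> \<beta> j * \<bar>y j - y j\<bar>) (at y within parameters)" for j
          by (intro tendsto_intros coord)
        then show "((\<lambda>x. \<beta> j * \<bar>x j - y j\<bar>) \<longlongrightarrow> 0) (at y within parameters)" for j
          by simp
        have "\<forall>\<^sub>F x in at y within parameters. x \<in> parameters"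
          by (simp add: eventually_at_filter)
        then have "\<forall>\<^sub>F (k::nat, x) in at_top \<times>\<^sub>F (at y within parameters). x \<in> parameters"
          by (subst eventually_prod2) auto
        then show "\<forall>\<^sub>F (k, x) in at_top \<times>\<^sub>F (at y within parameters). norm (\<beta> k * \<bar>x k - y k\<bar>) \<le> \<beta> k"
          by (rule eventually_mono)
            (use \<beta>(2) parameters_abs_diff_le[OF _ y] in \<open>auto simp: abs_mult intro!: mult_left_le\<close>)
      qed (use \<beta> False in auto)
      then have "((\<lambda>x. L * (\<Sum>j. \<beta> j * \<bar>x j - y j\<bar>)) \<longlongrightarrow> 0) (at y within parameters)"
        by (intro tendsto_mult_right_zero) simp
      then have "((\<lambda>x. f x - f y) \<longlongrightarrow> 0) (at y within parameters)"
        by (rule Lim_null_comparison[rotated]) (use lip y in \<open>auto simp: eventually_at_filter\<close>)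
      then show ?thesis by (simp add: LIM_zero_iff)
    qed simp
  qed
  then have meas: "f \<in> borel_measurable (restrict_space borel parameters)"
    by (rule borel_measurable_continuous_on_restrict)
  have "(\<lambda>y. y) \<in> parameter_measure \<rightarrow>\<^sub>M restrict_space borel parameters"
  proof (rule measurable_restrict_space2)
    show "(\<lambda>y. y) \<in> space parameter_measure \<rightarrow> parameters" by (simp add: space_parameter_measure)
    have "(\<lambda>y. y) \<in> parameter_measure \<rightarrow>\<^sub>M Pi\<^sub>M UNIV (\<lambda>_. borel :: real measure)"
      by (rule measurable_PiM_single') auto
    then show "(\<lambda>y. y) \<in> borel_measurable parameter_measure"
      using measurable_cong_sets[OF refl sets_PiM_equal_borel] by blast
  qed
  from measurable_compose[OF this meas] show ?thesis .
qed

definition reflect :: "nat \<Rightarrow> (nat \<Rightarrow> real) \<Rightarrow> nat \<Rightarrow> real" where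
  "reflect n y = y(n := - y n)"

lemma reflect_in_parameters: "y \<in> parameters \<Longrightarrow> reflect n y \<in> parameters"
  by (auto simp: reflect_def parameters_def dest: spec[of _ n])

text \<open>Lebesgue measure on the symmetric interval is invariant under \<open>t \<mapsto> - t\<close>; on cylinder sets the
reflection therefore preserves the product measure, and these sets determine it.\<close>

lemma distr_reflect:
  shows "reflect n \<in> parameter_measure \<rightarrow>\<^sub>M parameter_measure"
    and "distr parameter_measure parameter_measure (reflect n) = parameter_measure"
proof -
  define U where "U = restrict_space lborel {-1/2..1/2::real}"
  have U: "prob_space U"
    unfolding U_def by (intro prob_spaceI) (simp add: space_restrict_space emeasure_restrict_space)
  have P: "parameter_measure = Pi\<^sub>M UNIV (\<lambda>_. U)" by (simp add: parameter_measure_def U_def)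
  have space_U: "space U = {-1/2..1/2}" by (simp add: U_def space_restrict_space)
  have neg: "uminus \<in> U \<rightarrow>\<^sub>M U"
    unfolding U_def by (rule measurable_restrict_space3) auto
  have neg_emeasure: "emeasure U (uminus -` A \<inter> space U) = emeasure U A" if A: "A \<in> sets U" for A
  proof -
    have A': "A \<in> sets borel" "A \<subseteq> {-1/2..1/2}"
      using A by (auto simp: U_def sets_restrict_space)
    have "emeasure U A = emeasure (distr lborel borel uminus) A"
      using A' by (simp add: U_def emeasure_restrict_space lborel_distr_uminus)
    also have "\<dots> = emeasure lborel (uminus -` A \<inter> space lborel)"
      using A' by (intro emeasure_distr) auto
    also have "uminus -` A \<inter> space lborel = uminus -` A \<inter> space U"
      using A' by (auto simp: space_U)
    also have "emeasure lborel (uminus -` A \<inter> space U) = emeasure U (uminus -` A \<inter> space U)"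
      by (simp add: space_U) (simp add: U_def emeasure_restrict_space)
    finally show ?thesis by simp
  qed
  show meas: "reflect n \<in> parameter_measure \<rightarrow>\<^sub>M parameter_measure"
    unfolding P
  proof (rule measurable_PiM_single')
    fix i :: nat
    have "(\<lambda>y. uminus (y i)) \<in> Pi\<^sub>M UNIV (\<lambda>_. U) \<rightarrow>\<^sub>M U" "(\<lambda>y. y i) \<in> Pi\<^sub>M UNIV (\<lambda>_. U) \<rightarrow>\<^sub>M U"
      using measurable_compose[OF measurable_component_singleton[of i UNIV "\<lambda>_. U"] neg] by auto
    then show "(\<lambda>y. reflect n y i) \<in> Pi\<^sub>M UNIV (\<lambda>_. U) \<rightarrow>\<^sub>M U"
      by (cases "i = n") (auto simp: reflect_def)
    show "reflect n \<in> space (Pi\<^sub>M UNIV (\<lambda>_. U)) \<rightarrow> UNIV \<rightarrow>\<^sub>E space U"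
      using reflect_in_parameters[of _ n] by (auto simp: space_PiM space_U parameters_def PiE_iff)
  qed
  show "distr parameter_measure parameter_measure (reflect n) = parameter_measure"
  proof (rule measure_eqI_PiM_infinite[symmetric, where I = UNIV and M = "\<lambda>_. U"])
    show "finite_measure parameter_measure"
      using prob_space_parameter_measure by (simp add: prob_space.axioms(1))
    fix A :: "nat \<Rightarrow> real set" and J
    assume J: "finite J" and A: "\<And>i. i \<in> J \<Longrightarrow> A i \<in> sets U"
    define B where "B i = (if i = n then uminus -` A i \<inter> space U else A i)" for i
    have B: "B i \<in> sets U" "emeasure U (B i) = emeasure U (A i)" if "i \<in> J" for i
      using A[OF that] measurable_sets[OF neg A[OF that]] neg_emeasure[OF A[OF that]] by (auto simp: B_def)
    let ?E = "\<lambda>X. prod_emb UNIV (\<lambda>_. U) J (Pi\<^sub>E J X)"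
    have E: "?E A \<in> sets parameter_measure"
      unfolding P using J A by (intro sets_PiM_I) auto
    have vim: "reflect n -` ?E A \<inter> space parameter_measure = ?E B"
    proof (intro set_eqI iffI)
      fix y :: "nat \<Rightarrow> real"
      have refl: "y i \<in> space U \<Longrightarrow> - y i \<in> space U" for i by (auto simp: space_U)
      {
        assume "y \<in> reflect n -` ?E A \<inter> space parameter_measure"
        then show "y \<in> ?E B"
          by (auto simp: prod_emb_iff P space_PiM PiE_iff reflect_def B_def split: if_splits)
      }
      {
        assume "y \<in> ?E B"
        then show "y \<in> reflect n -` ?E A \<inter> space parameter_measure"
          using refl by (auto simp: prod_emb_iff P space_PiM PiE_iff reflect_def B_def split: if_splits)
      }
    qed
    have "emeasure (distr parameter_measure parameter_measure (reflect n)) (?E A) = emeasure parameter_measure (?E B)"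
      by (subst emeasure_distr[OF meas E]) (simp add: vim)
    also have "\<dots> = (\<Prod>i\<in>J. emeasure U (B i))"
      unfolding P using J B U by (intro emeasure_PiM_emb) auto
    also have "\<dots> = (\<Prod>i\<in>J. emeasure U (A i))" using B by simp
    also have "\<dots> = emeasure parameter_measure (?E A)"
      unfolding P using J A U by (intro emeasure_PiM_emb[symmetric]) auto
    finally show "emeasure parameter_measure (?E A) = emeasure (distr parameter_measure parameter_measure (reflect n)) (?E A)"
      by simp
  qed (simp_all add: P)
qed

section \<open>Dimension truncation by symmetric second differences\<close>

text \<open>This is the substitute for the vanishing mean of \<open>y n\<close>: it removes the first-order part of \<open>f\<close> in
coordinate \<open>n\<close> without differentiating.\<close>

lemma reflection_symmetrization:
  fixes f :: "(nat \<Rightarrow> real) \<Rightarrow> 'h::{banach, second_countable_topology}"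
  assumes f: "integrable parameter_measure f"
  shows "integrable parameter_measure (\<lambda>y. f (reflect n y))"
    and "(\<integral>y. f y \<partial>parameter_measure) = (1/2) *\<^sub>R (\<integral>y. f y + f (reflect n y) \<partial>parameter_measure)"
proof -
  note distr = distr_reflect[of n]
  show f': "integrable parameter_measure (\<lambda>y. f (reflect n y))"
    using f by (subst integrable_distr_eq[OF distr(1), symmetric]) (simp_all add: distr(2))
  have "(\<integral>y. f (reflect n y) \<partial>parameter_measure) = (\<integral>y. f y \<partial>parameter_measure)"
    using integral_distr[OF distr(1), of f] f by (simp add: distr(2))
  then show "(\<integral>y. f y \<partial>parameter_measure) = (1/2) *\<^sub>R (\<integral>y. f y + f (reflect n y) \<partial>parameter_measure)"
    using f f' by (simp add: scaleR_2[symmetric])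
qed

lemma norm_integral_parameter_le:
  fixes f :: "(nat \<Rightarrow> real) \<Rightarrow> 'h::{banach, second_countable_topology}"
  assumes f: "integrable parameter_measure f" and B: "\<And>y. y \<in> parameters \<Longrightarrow> norm (f y) \<le> B"
  shows "norm (\<integral>y. f y \<partial>parameter_measure) \<le> B"
proof -
  interpret prob_space parameter_measure by (rule prob_space_parameter_measure)
  have "norm (\<integral>y. f y \<partial>parameter_measure) \<le> (\<integral>y. norm (f y) \<partial>parameter_measure)"
    by (rule integral_norm_bound)
  also have "\<dots> \<le> (\<integral>y. B \<partial>parameter_measure)"
    using f B by (intro integral_mono) (auto simp: space_parameter_measure)
  finally show ?thesis by (simp add: prob_space)
qed

text \<open>The Lipschitz bound only serves measurability and the limit of the telescoping sum. The size of the error comes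
from the second differences.\<close>

lemma dimension_truncation:
  fixes q :: "(nat \<Rightarrow> real) \<Rightarrow> 'h::{banach, second_countable_topology}"
  assumes \<beta>: "summable \<beta>" "\<And>j. 0 \<le> \<beta> j" "summable (\<lambda>j. (\<beta> j)\<^sup>2)" and L: "0 \<le> L"
    and lip: "\<And>y y'. y \<in> parameters \<Longrightarrow> y' \<in> parameters
      \<Longrightarrow> norm (q y - q y') \<le> L * (\<Sum>j. \<beta> j * \<bar>y j - y' j\<bar>)"
    and second: "\<And>y n. y \<in> parameters
      \<Longrightarrow> norm (q y + q (reflect n y) - 2 *\<^sub>R q (y(n := 0))) \<le> M * (\<beta> n)\<^sup>2"
  shows "integrable parameter_measure (\<lambda>y. q y - q (truncation s y))"
    and "norm (\<integral>y. q y - q (truncation s y) \<partial>parameter_measure) \<le> M / 2 * (\<Sum>j. (\<beta> (j + s))\<^sup>2)"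
proof -
  interpret prob_space parameter_measure by (rule prob_space_parameter_measure)
  have zero: "(\<lambda>_. 0) \<in> parameters" by (simp add: parameters_def)
  note summ = summable_weighted_diff[OF \<beta>(1,2)]
  have lip_trunc: "norm (q (truncation s y) - q (truncation s y')) \<le> L * (\<Sum>j. \<beta> j * \<bar>y j - y' j\<bar>)"
    if y: "y \<in> parameters" "y' \<in> parameters" for s y y'
  proof -
    note t = y[THEN truncation_in_parameters[of _ s]]
    have "(\<Sum>j. \<beta> j * \<bar>truncation s y j - truncation s y' j\<bar>) \<le> (\<Sum>j. \<beta> j * \<bar>y j - y' j\<bar>)"
      using \<beta>(2) by (intro suminf_le summ t y) (auto simp: truncation_def)
    then show ?thesis
      using lip[OF t] L by (meson mult_left_mono order_trans)
  qed
  have int: "integrable parameter_measure f"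
    if f: "\<And>y y'. y \<in> parameters \<Longrightarrow> y' \<in> parameters \<Longrightarrow> norm (f y - f y') \<le> L * (\<Sum>j. \<beta> j * \<bar>y j - y' j\<bar>)"
    for f :: "(nat \<Rightarrow> real) \<Rightarrow> 'h"
  proof (rule integrable_const_bound)
    show "f \<in> borel_measurable parameter_measure"
      by (rule measurable_of_weighted_lipschitz[OF \<beta>(1,2) f])
    show "AE y in parameter_measure. norm (f y) \<le> norm (f (\<lambda>_. 0)) + L * (\<Sum>j. \<beta> j)"
    proof (rule AE_I2)
      fix y assume "y \<in> space parameter_measure"
      then have y: "y \<in> parameters" by (simp add: space_parameter_measure)
      have "(\<Sum>j. \<beta> j * \<bar>y j - 0\<bar>) \<le> (\<Sum>j. \<beta> j)"
        using summ[OF y zero] \<beta> parameters_abs_diff_le[OF y zero]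
        by (intro suminf_le) (auto intro: mult_left_le)
      then have "norm (f y - f (\<lambda>_. 0)) \<le> L * (\<Sum>j. \<beta> j)"
        using f[OF y zero] L by (meson mult_left_mono order_trans)
      then show "norm (f y) \<le> norm (f (\<lambda>_. 0)) + L * (\<Sum>j. \<beta> j)"
        using norm_triangle_ineq[of "f y - f (\<lambda>_. 0)" "f (\<lambda>_. 0)"] by simp
    qed
  qed
  have int_q: "integrable parameter_measure q"
    by (rule int) (rule lip)
  have int_t: "integrable parameter_measure (\<lambda>y. q (truncation s y))" for s
    by (rule int) (rule lip_trunc)
  show "integrable parameter_measure (\<lambda>y. q y - q (truncation s y))"
    using int_q int_t by simp
  define F where "F n = (\<integral>y. q (truncation n y) \<partial>parameter_measure)" for n
  define I where "I = (\<integral>y. q y \<partial>parameter_measure)"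
  have step: "norm (F (Suc n) - F n) \<le> M / 2 * (\<beta> n)\<^sup>2" for n
  proof -
    let ?g = "\<lambda>y. q (truncation (Suc n) y)"
    \<comment> \<open>Truncation after coordinate \<open>n\<close> commutes with its reflection, and truncation before it sets it to \<open>0\<close>.\<close>
    have g': "?g (reflect n y) = q (reflect n (truncation (Suc n) y))"
      and t: "truncation n y = (truncation (Suc n) y)(n := 0)" for y
      by (auto simp: truncation_def reflect_def fun_eq_iff intro!: arg_cong[where f = q])
    note sym = reflection_symmetrization[OF int_t[of "Suc n"], of n]
    have "F (Suc n) - F n = (1/2) *\<^sub>R (\<integral>y. ?g y + ?g (reflect n y) \<partial>parameter_measure)
        - (1/2) *\<^sub>R (\<integral>y. 2 *\<^sub>R q (truncation n y) \<partial>parameter_measure)"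
      using sym(2) by (simp add: F_def)
    also have "\<dots> = (1/2) *\<^sub>R (\<integral>y. ?g y + ?g (reflect n y) - 2 *\<^sub>R q (truncation n y) \<partial>parameter_measure)"
      using int_t sym(1) by (simp add: scaleR_diff_right)
    finally have "norm (F (Suc n) - F n)
        = 1 / 2 * norm (\<integral>y. ?g y + ?g (reflect n y) - 2 *\<^sub>R q (truncation n y) \<partial>parameter_measure)"
      by simp
    also have "\<dots> \<le> 1 / 2 * (M * (\<beta> n)\<^sup>2)"
    proof (intro mult_left_mono norm_integral_parameter_le)
      show "integrable parameter_measure (\<lambda>y. ?g y + ?g (reflect n y) - 2 *\<^sub>R q (truncation n y))"
        using int_t sym(1) by simp
      show "norm (?g y + ?g (reflect n y) - 2 *\<^sub>R q (truncation n y)) \<le> M * (\<beta> n)\<^sup>2"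
        if "y \<in> parameters" for y
        unfolding g' t using that by (intro second truncation_in_parameters)
    qed simp
    finally show ?thesis by simp
  qed
  define T where "T = (\<Sum>j. (\<beta> (j + s))\<^sup>2)"
  have summ_T: "summable (\<lambda>j. (\<beta> (j + s))\<^sup>2)"
    using \<beta>(3) by (subst summable_iff_shift)
  have M: "0 \<le> M * (\<beta> n)\<^sup>2" for n
    by (rule order_trans[OF norm_ge_zero second[OF zero]])
  have partial: "norm (F (s + k) - F s) \<le> M / 2 * T" for k
  proof -
    have "F (s + k) - F s = (\<Sum>j<k. F (Suc (j + s)) - F (j + s))"
      by (subst sum_lessThan_telescope[of "\<lambda>j. F (j + s)" k, simplified]) (simp add: add.commute)
    also have "norm \<dots> \<le> (\<Sum>j<k. M / 2 * (\<beta> (j + s))\<^sup>2)"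
      by (intro order_trans[OF norm_sum] sum_mono step)
    also have "\<dots> \<le> (\<Sum>j. M / 2 * (\<beta> (j + s))\<^sup>2)"
      using M by (intro sum_le_suminf summable_mult summ_T) auto
    also have "\<dots> = M / 2 * T"
      unfolding T_def using summ_T by (rule suminf_mult)
    finally show ?thesis .
  qed
  have lim: "(\<lambda>k. F (s + k)) \<longlonglongrightarrow> I"
  proof -
    have bound: "norm (F n - I) \<le> L * (\<Sum>j. \<beta> (j + n))" for n
    proof -
      have "norm (F n - I) = norm (\<integral>y. q (truncation n y) - q y \<partial>parameter_measure)"
        using int_t int_q by (simp add: F_def I_def)
      also have "\<dots> \<le> L * (\<Sum>j. \<beta> (j + n))"
      proof (rule norm_integral_parameter_le)
        show "integrable parameter_measure (\<lambda>y. q (truncation n y) - q y)" using int_t int_q by simp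
        fix y assume y: "y \<in> parameters"
        note t = truncation_in_parameters[OF y, of n]
        have "(\<Sum>j. \<beta> j * \<bar>truncation n y j - y j\<bar>) = (\<Sum>j. \<beta> (j + n) * \<bar>truncation n y (j + n) - y (j + n)\<bar>)"
          by (subst suminf_split_initial_segment[OF summ[OF t y], of n]) (simp add: truncation_def)
        also have "\<dots> \<le> (\<Sum>j. \<beta> (j + n))"
          using summ[OF t y] \<beta> parameters_abs_diff_le[OF t y]
          by (intro suminf_le) (auto intro: mult_left_le simp: summable_iff_shift[of "\<lambda>j. \<beta> j * \<bar>truncation n y j - y j\<bar>" n] summable_iff_shift)
        finally show "norm (q (truncation n y) - q y) \<le> L * (\<Sum>j. \<beta> (j + n))"
          using lip[OF t y] L by (meson mult_left_mono order_trans)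
      qed
      finally show ?thesis .
    qed
    have "(\<lambda>n. L * (\<Sum>j. \<beta> (j + n))) \<longlonglongrightarrow> 0"
      by (intro tendsto_mult_right_zero suminf_exist_split2 \<beta>)
    then have "(\<lambda>n. F n - I) \<longlonglongrightarrow> 0"
      by (rule Lim_null_comparison[rotated]) (use bound in auto)
    then have "F \<longlonglongrightarrow> I" by (simp add: LIM_zero_iff)
    then show ?thesis by (subst add.commute) (rule LIMSEQ_ignore_initial_segment)
  qed
  have "(\<lambda>k. norm (F (s + k) - F s)) \<longlonglongrightarrow> norm (I - F s)"
    by (intro tendsto_intros lim)
  then have "norm (I - F s) \<le> M / 2 * T"
    by (rule LIMSEQ_le_const2) (use partial in auto)
  then show "norm (\<integral>y. q y - q (truncation s y) \<partial>parameter_measure) \<le> M / 2 * (\<Sum>j. (\<beta> (j + s))\<^sup>2)"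
    using int_q int_t by (simp add: I_def F_def T_def)
qed

text \<open>Monotonicity turns summability of \<open>\<beta> j powr p\<close> into decay: the first \<open>n\<close> terms are each at least
\<open>\<beta> j powr p\<close> when \<open>n \<le> j + 1\<close>, so \<open>n\<close> times this is at most the sum.\<close>

lemma tail_sum_squares_rate:
  fixes \<beta> :: "nat \<Rightarrow> real"
  assumes p: "0 < p" "p < 1" and nonneg: "\<And>j. 0 \<le> \<beta> j" and dec: "\<And>j. \<beta> (Suc j) \<le> \<beta> j"
    and summ: "summable (\<lambda>j. \<beta> j powr p)" and s: "1 \<le> s"
  shows "summable (\<lambda>j. (\<beta> j)\<^sup>2)"
    and "(\<Sum>j. (\<beta> (j + s))\<^sup>2) \<le> (\<Sum>j. \<beta> j powr p) powr (2 / p) * real s powr (- (2 / p - 1))"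
proof -
  define A where "A = (\<Sum>j. \<beta> j powr p)"
  have A0: "0 \<le> A" unfolding A_def by (intro suminf_nonneg summ) simp
  have anti: "\<beta> j \<le> \<beta> i" if "i \<le> j" for i j
    using that dec by (rule lift_Suc_antimono_le[rotated])
  have decay: "\<beta> j \<le> (A / n) powr (1 / p)" if n: "1 \<le> n" "n \<le> j + 1" for n j
  proof -
    have "real n * \<beta> j powr p = (\<Sum>i<n. \<beta> j powr p)" by simp
    also have "\<dots> \<le> (\<Sum>i<n. \<beta> i powr p)"
      using n p nonneg anti by (intro sum_mono powr_mono2) auto
    also have "\<dots> \<le> A" unfolding A_def by (intro sum_le_suminf summ) auto
    finally have "\<beta> j powr p \<le> A / n" using n by (simp add: field_simps)
    then have "(\<beta> j powr p) powr (1 / p) \<le> (A / n) powr (1 / p)"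
      using p by (intro powr_mono2) auto
    then show ?thesis using p nonneg[of j] by (simp add: powr_powr)
  qed
  have sq: "(\<beta> j)\<^sup>2 \<le> (A / n) powr ((2 - p) / p) * \<beta> j powr p" if n: "1 \<le> n" "n \<le> j + 1" for n j
  proof -
    have "(\<beta> j)\<^sup>2 = \<beta> j powr (2 - p) * \<beta> j powr p"
      using nonneg[of j] by (cases "\<beta> j = 0") (auto simp: powr_add[symmetric])
    also have "\<dots> \<le> ((A / n) powr (1 / p)) powr (2 - p) * \<beta> j powr p"
      using decay[OF n] nonneg[of j] p by (intro mult_right_mono powr_mono2) auto
    finally show ?thesis by (simp add: powr_powr)
  qed
  show sum2: "summable (\<lambda>j. (\<beta> j)\<^sup>2)"
    by (rule summable_comparison_test'[OF summable_mult[OF summ, of "A powr ((2 - p) / p)"]])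
      (use sq[of 1] in auto)
  have summ_s: "summable (\<lambda>j. \<beta> (j + s) powr p)" using summ by (subst summable_iff_shift)
  have "(\<Sum>j. (\<beta> (j + s))\<^sup>2) \<le> (\<Sum>j. (A / s) powr ((2 - p) / p) * \<beta> (j + s) powr p)"
    using sq[of s] s sum2 by (intro suminf_le summable_mult summ_s) (auto simp: summable_iff_shift[of "\<lambda>j. (\<beta> j)\<^sup>2"])
  also have "\<dots> = (A / s) powr ((2 - p) / p) * (\<Sum>j. \<beta> (j + s) powr p)"
    using summ_s by (rule suminf_mult)
  also have "(\<Sum>j. \<beta> (j + s) powr p) \<le> A"
    unfolding A_def using suminf_split_initial_segment[OF summ, of s]
    by (simp add: sum_nonneg)
  also have "(A / s) powr ((2 - p) / p) * A = A powr (2 / p) * real s powr (- (2 / p - 1))"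
  proof (cases "A = 0")
    case True
    then show ?thesis using p by simp
  next
    case False
    then have "A powr (2 / p) = A powr ((2 - p) / p) * A"
      using A0 p by (simp add: diff_divide_distrib powr_diff)
    moreover have "(2 - p) / p = 2 / p - 1" using p by (simp add: diff_divide_distrib)
    moreover have "(A / real s) powr e = A powr e * real s powr (- e)" for e
      using A0 by (simp add: powr_divide powr_minus_divide)
    ultimately show ?thesis by (simp only: mult_ac)
  qed
  finally show "(\<Sum>j. (\<beta> (j + s))\<^sup>2) \<le> (\<Sum>j. \<beta> j powr p) powr (2 / p) * real s powr (- (2 / p - 1))"
    by (simp add: A_def mult_left_mono)
qed

section \<open>The affine diffusion coefficient\<close>

lemma AE_le_Linf_norm:
  assumes "Linf \<Omega> f"
  shows "AE x in lebesgue_on \<Omega>. \<bar>f x\<bar> \<le> Linf_norm \<Omega> f"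
proof -
  let ?E = "esssup (lebesgue_on \<Omega>) (\<lambda>x. ereal \<bar>f x\<bar>)"
  have "?E < \<infinity>" using assms by (simp add: Linf_def)
  have "AE x in lebesgue_on \<Omega>. ereal \<bar>f x\<bar> \<le> ?E" by (rule esssup_AE)
  then show ?thesis
    by eventually_elim (use \<open>?E < \<infinity>\<close> in \<open>cases ?E; auto simp: Linf_norm_def\<close>)
qed

text \<open>A nonnegative function can lie below a negative bound almost everywhere only on a null set, and a nonempty open set
is not null.\<close>

lemma Linf_norm_nonneg:
  assumes \<Omega>: "open \<Omega>" "\<Omega> \<noteq> {}" and f: "Linf \<Omega> f"
  shows "0 \<le> Linf_norm \<Omega> f"
proof (rule ccontr)
  assume "\<not> 0 \<le> Linf_norm \<Omega> f"
  with AE_le_Linf_norm[OF f] have "AE x in lebesgue_on \<Omega>. False"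
    by (auto elim!: eventually_mono)
  moreover have sets: "\<Omega> \<in> sets lebesgue" using \<Omega> by auto
  ultimately have "AE x in lebesgue. x \<notin> \<Omega>"
    by (subst (asm) AE_restrict_space_iff) auto
  then have "\<Omega> \<in> null_sets lebesgue"
    using sets by (subst (asm) AE_iff_null_sets[symmetric]) auto
  then show False
    using open_not_negligible[OF \<Omega>] by (simp add: negligible_iff_null_sets)
qed

locale elliptic_diffusion =
  fixes \<Omega> :: "'a::euclidean_space set" and abar :: "'a \<Rightarrow> real" and \<psi> :: "nat \<Rightarrow> 'a \<Rightarrow> real"
    and amin amax :: real
  assumes domain: "open \<Omega>" "\<Omega> \<noteq> {}" "bounded \<Omega>"
    and abar: "Linf \<Omega> abar"
    and psi: "\<And>j. Linf \<Omega> (\<psi> j)"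
    and psi_summable: "summable (\<lambda>j. Linf_norm \<Omega> (\<psi> j))"
    and amin: "0 < amin"
    and ellipticity: "\<And>y. y \<in> parameters \<Longrightarrow>
        AE x in lebesgue_on \<Omega>. amin \<le> diffusion abar \<psi> y x \<and> diffusion abar \<psi> y x \<le> amax"
begin

definition \<beta> :: "nat \<Rightarrow> real" where
  "\<beta> j = Linf_norm \<Omega> (\<psi> j)"

definition coeff :: "(nat \<Rightarrow> real) \<Rightarrow> 'a \<Rightarrow> real" where
  "coeff y x = indicator \<Omega> x * diffusion abar \<psi> y x"

lemma beta_nonneg: "0 \<le> \<beta> j"
  unfolding \<beta>_def by (rule Linf_norm_nonneg[OF domain(1,2) psi])

lemma beta_summable: "summable \<beta>"
  using psi_summable by (simp add: \<beta>_def[abs_def])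

lemma domain_sets: "\<Omega> \<in> sets lebesgue"
  using domain(1) by auto

lemma AE_psi_le_beta: "AE x in lebesgue. x \<in> \<Omega> \<longrightarrow> (\<forall>j. \<bar>\<psi> j x\<bar> \<le> \<beta> j)"
proof -
  have "AE x in lebesgue_on \<Omega>. \<forall>j. \<bar>\<psi> j x\<bar> \<le> \<beta> j"
    unfolding AE_all_countable \<beta>_def using AE_le_Linf_norm[OF psi] by blast
  then show ?thesis using domain_sets by (subst (asm) AE_restrict_space_iff) auto
qed

text \<open>The exceptional null set depends on the \<open>\<psi> j\<close> alone, so it can be chosen before the parameters.\<close>

lemma diffusion_difference:
  assumes x: "\<forall>j. \<bar>\<psi> j x\<bar> \<le> \<beta> j" and y: "y \<in> parameters" "y' \<in> parameters"
  shows "diffusion abar \<psi> y x - diffusion abar \<psi> y' x = (\<Sum>j. (y j - y' j) * \<psi> j x)"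
    and "\<bar>\<Sum>j. (y j - y' j) * \<psi> j x\<bar> \<le> (\<Sum>j. \<beta> j * \<bar>y j - y' j\<bar>)"
proof -
  have zero: "(\<lambda>_. 0) \<in> parameters" by (simp add: parameters_def)
  have summ: "summable (\<lambda>j. \<bar>(v j - w j) * \<psi> j x\<bar>)" if "v \<in> parameters" "w \<in> parameters" for v w
    by (rule summable_comparison_test'[OF summable_weighted_diff[OF beta_summable beta_nonneg that]])
      (use x in \<open>auto simp: abs_mult mult.commute[of "\<beta> _"] intro!: mult_left_mono\<close>)
  have s: "summable (\<lambda>j. v j * \<psi> j x)" if "v \<in> parameters" for v
    using summable_rabs_cancel[OF summ[OF that zero]] by simp
  show "diffusion abar \<psi> y x - diffusion abar \<psi> y' x = (\<Sum>j. (y j - y' j) * \<psi> j x)"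
    using suminf_diff[OF s[OF y(1)] s[OF y(2)]] by (simp add: diffusion_def left_diff_distrib)
  have "\<bar>\<Sum>j. (y j - y' j) * \<psi> j x\<bar> \<le> (\<Sum>j. \<bar>(y j - y' j) * \<psi> j x\<bar>)"
    by (rule summable_rabs[OF summ[OF y]])
  also have "\<dots> \<le> (\<Sum>j. \<beta> j * \<bar>y j - y' j\<bar>)"
    by (intro suminf_le summ summable_weighted_diff beta_summable beta_nonneg y)
      (use x in \<open>auto simp: abs_mult mult.commute[of "\<beta> _"] intro!: mult_left_mono\<close>)
  finally show "\<bar>\<Sum>j. (y j - y' j) * \<psi> j x\<bar> \<le> (\<Sum>j. \<beta> j * \<bar>y j - y' j\<bar>)" .
qed

lemma coeff_measurable: "coeff y \<in> borel_measurable lebesgue"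
proof -
  have [measurable]: "abar \<in> borel_measurable (lebesgue_on \<Omega>)" "\<psi> j \<in> borel_measurable (lebesgue_on \<Omega>)" for j
    using abar psi by (auto simp: Linf_def)
  have "diffusion abar \<psi> y \<in> borel_measurable (lebesgue_on \<Omega>)"
    unfolding diffusion_def[abs_def] by measurable
  then show ?thesis
    using domain_sets by (subst (asm) borel_measurable_restrict_space_iff) (auto simp: coeff_def[abs_def])
qed

lemma AE_coeff_bounds:
  assumes "y \<in> parameters"
  shows "AE x in lebesgue. x \<in> \<Omega> \<longrightarrow> amin \<le> coeff y x \<and> coeff y x \<le> amax"
proof -
  have "AE x in lebesgue. x \<in> \<Omega> \<longrightarrow> amin \<le> diffusion abar \<psi> y x \<and> diffusion abar \<psi> y x \<le> amax"
    using ellipticity[OF assms] domain_sets by (subst (asm) AE_restrict_space_iff) auto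
  then show ?thesis by eventually_elim (simp add: coeff_def)
qed

lemma coeff_bounded_multiplier:
  assumes "y \<in> parameters"
  shows "bounded_multiplier \<bar>amax\<bar> (coeff y)"
  unfolding bounded_multiplier_def
proof (intro conjI coeff_measurable)
  show "AE x in lebesgue. \<bar>coeff y x\<bar> \<le> \<bar>amax\<bar>"
    using AE_coeff_bounds[OF assms]
  proof eventually_elim
    case (elim x)
    then show ?case using amin by (cases "x \<in> \<Omega>") (auto simp: coeff_def)
  qed
qed simp

lemma norm_mult_op_coeff_diff:
  assumes y: "y \<in> parameters" "y' \<in> parameters"
  shows "norm (mult_op (coeff y) g - mult_op (coeff y') g) \<le> (\<Sum>j. \<beta> j * \<bar>y j - y' j\<bar>) * norm g"
proof -
  note m = coeff_bounded_multiplier[OF y(1)] coeff_bounded_multiplier[OF y(2)]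
  have pos: "0 \<le> (\<Sum>j. \<beta> j * \<bar>y j - y' j\<bar>)"
    using beta_nonneg by (intro suminf_nonneg summable_weighted_diff beta_summable y) auto
  have "AE x in lebesgue. \<bar>coeff y x - coeff y' x\<bar> \<le> (\<Sum>j. \<beta> j * \<bar>y j - y' j\<bar>)"
    using AE_psi_le_beta
  proof eventually_elim
    case (elim x)
    then show ?case
      using diffusion_difference[OF _ y, of x] pos by (cases "x \<in> \<Omega>") (auto simp: coeff_def)
  qed
  then have "bounded_multiplier (\<Sum>j. \<beta> j * \<bar>y j - y' j\<bar>) (\<lambda>x. coeff y x - coeff y' x)"
    using pos coeff_measurable by (simp add: bounded_multiplier_def)
  then show ?thesis unfolding mult_op_diff[OF m] by (rule norm_mult_op_le)
qed

lemma zero_coordinate_in_parameters: "y \<in> parameters \<Longrightarrow> y(n := 0) \<in> parameters"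
  by (auto simp: parameters_def)

text \<open>The coefficient is affine in coordinate \<open>n\<close>, hence its value at \<open>y n = 0\<close> is midway between those at
\<open>y n\<close> and \<open>- y n\<close>.\<close>

lemma mult_op_coeff_reflect:
  assumes y: "y \<in> parameters"
  shows "mult_op (coeff y) g - mult_op (coeff (y(n := 0))) g
    = mult_op (coeff (y(n := 0))) g - mult_op (coeff (reflect n y)) g"
proof -
  note in_params = y zero_coordinate_in_parameters[OF y, of n] reflect_in_parameters[OF y, of n]
  note m = in_params[THEN coeff_bounded_multiplier]
  have same: "y j - (y(n := 0)) j = (y(n := 0)) j - reflect n y j" for j
    by (simp add: reflect_def)
  have "AE x in lebesgue. coeff y x - coeff (y(n := 0)) x = coeff (y(n := 0)) x - coeff (reflect n y) x"
    using AE_psi_le_beta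
  proof eventually_elim
    case (elim x)
    show ?case
    proof (cases "x \<in> \<Omega>")
      case True
      then have x: "\<forall>j. \<bar>\<psi> j x\<bar> \<le> \<beta> j" using elim by blast
      show ?thesis
        using True diffusion_difference(1)[OF x in_params(1,2)] diffusion_difference(1)[OF x in_params(2,3)]
        by (simp only: coeff_def same indicator_simps mult_1)
    qed (simp add: coeff_def)
  qed
  then show ?thesis
    unfolding mult_op_diff[OF m(1,2)] mult_op_diff[OF m(2,3)]
    by (rule mult_op_cong_AE[OF bounded_multiplier_diff[OF m(1,2)] bounded_multiplier_diff[OF m(2,3)]])
qed

lemma bform_eq_mult_op:
  "y \<in> parameters \<Longrightarrow> bform \<Omega> (diffusion abar \<psi> y) w v
    = mult_op (coeff y) (weak_grad \<Omega> w) \<bullet> weak_grad \<Omega> v"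
  unfolding bform_def set_lebesgue_integral_def
  by (subst inner_mult_op[OF coeff_bounded_multiplier]) (simp_all add: coeff_def mult.assoc)

text \<open>On \<open>H10 \<Omega>\<close> the state and the adjoint state are the abstract solutions for the operator \<open>mult_op (coeff y)\<close>, and
changing the parameter from \<open>y'\<close> to \<open>y\<close> perturbs this operator by at most \<open>\<Sum>j. \<beta> j * \<bar>y j - y' j\<bar>\<close>.\<close>

lemma adjoint_dimension_truncation:
  "\<exists>K>0. \<forall>u0 z s. summable (\<lambda>j. (\<beta> j)\<^sup>2) \<longrightarrow>
      integrable parameter_measure
        (\<lambda>y. adjoint_state \<Omega> (diffusion abar \<psi> y) u0 z
           - adjoint_state \<Omega> (diffusion abar \<psi> (truncation s y)) u0 z) \<and>
      norm (\<integral>y. adjoint_state \<Omega> (diffusion abar \<psi> y) u0 z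
           - adjoint_state \<Omega> (diffusion abar \<psi> (truncation s y)) u0 z \<partial>parameter_measure)
        \<le> K * (norm z + norm u0) * (\<Sum>j. (\<beta> (j + s))\<^sup>2)"
proof -
  obtain R where R: "0 < R" "\<Omega> \<subseteq> cball 0 R"
    using bounded_subset_ballD[OF domain(3), of 0] ball_subset_cball by blast
  interpret E: energy_space "H10 \<Omega>" "weak_grad \<Omega>" "2 * R"
    using domain(1) R by (intro H10_energy_space)
  define A where "A y = (mult_op (coeff y) :: ('a, 'a) L2 \<Rightarrow> _)" for y
  have ell: "E.elliptic amin (A y)" if y: "y \<in> parameters" for y
    unfolding E.elliptic_def
  proof (intro conjI allI ballI)
    note m = coeff_bounded_multiplier[OF y]
    show "0 < amin" by (rule amin)
    show "bounded_linear (A y)" unfolding A_def by (rule bounded_linear_mult_op[OF m])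
    show "A y g \<bullet> h = g \<bullet> A y h" for g h unfolding A_def by (rule inner_mult_op_commute[OF m])
    show "amin * (norm (weak_grad \<Omega> v))\<^sup>2 \<le> A y (weak_grad \<Omega> v) \<bullet> weak_grad \<Omega> v" if "v \<in> H10 \<Omega>" for v
      unfolding A_def using AE_coeff_bounds[OF y] weak_grad_in_L2_on[OF domain(1) that]
      by (intro mult_op_coercive[OF m]) (auto elim: eventually_mono)
  qed
  have pert: "norm (A y g - A y' g) \<le> (\<Sum>j. \<beta> j * \<bar>y j - y' j\<bar>) * norm g"
    if "y \<in> parameters" "y' \<in> parameters" for y y' g
    unfolding A_def by (rule norm_mult_op_coeff_diff[OF that])
  have state_eq: "state \<Omega> (diffusion abar \<psi> y) z = E.sol (A y) z" if "y \<in> parameters" for y z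
    using that by (simp add: state_def E.sol_def bform_eq_mult_op A_def)
  have adj_eq: "adjoint_state \<Omega> (diffusion abar \<psi> y) u0 z = E.adj (A y) u0 z"
    if "y \<in> parameters" for y u0 z
    using that by (simp add: adjoint_state_def E.adj_def E.sol_def[of _ "_ - _"] state_eq bform_eq_mult_op A_def)
  have adj_V: "E.adj (A y) u0 z \<in> H10 \<Omega>" if "y \<in> parameters" for y u0 z
    unfolding E.adj_def by (rule E.sol_in_V[OF ell[OF that]])
  define c where "c = E.adj_const amin"
  have c: "0 < c" unfolding c_def by (rule E.adj_const_pos[OF amin])
  define K where "K = 6 * R / amin\<^sup>2 * c"
  show ?thesis
  proof (intro exI[of _ K] conjI allI impI)
    show "0 < K" using R c amin by (simp add: K_def)
    fix u0 z :: "('a, real) L2" and s assume sq: "summable (\<lambda>j. (\<beta> j)\<^sup>2)"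
    let ?N = "norm z + norm u0"
    define q where "q y = adjoint_state \<Omega> (diffusion abar \<psi> y) u0 z" for y
    have q: "q y = E.adj (A y) u0 z" if "y \<in> parameters" for y
      unfolding q_def by (rule adj_eq[OF that])
    have lip: "norm (q y - q y') \<le> (2 * R * (2 / amin * c * ?N)) * (\<Sum>j. \<beta> j * \<bar>y j - y' j\<bar>)"
      if y: "y \<in> parameters" "y' \<in> parameters" for y y'
    proof -
      let ?\<delta> = "\<Sum>j. \<beta> j * \<bar>y j - y' j\<bar>"
      have \<delta>: "0 \<le> ?\<delta>"
        using beta_nonneg by (intro suminf_nonneg summable_weighted_diff beta_summable y) auto
      have "norm (q y - q y') \<le> 2 * R * norm (weak_grad \<Omega> (q y - q y'))"
        using y by (intro E.poincare E.V_diff) (simp_all add: q adj_V)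
      also have "\<dots> \<le> 2 * R * (2 * (?\<delta> / amin) * c * ?N)"
        using E.norm_D_adj_diff[OF ell[OF y(2)] ell[OF y(1)] \<delta> pert[OF y], of u0 z] R y
        by (intro mult_left_mono) (auto simp: q c_def)
      finally show ?thesis by (simp add: algebra_simps)
    qed
    have second: "norm (q y + q (reflect n y) - 2 *\<^sub>R q (y(n := 0))) \<le> 2 * K * ?N * (\<beta> n)\<^sup>2"
      if y: "y \<in> parameters" for y n
    proof -
      note z = zero_coordinate_in_parameters[OF y, of n] and r = reflect_in_parameters[OF y, of n]
      have "(\<Sum>j. \<beta> j * \<bar>y j - (y(n := 0)) j\<bar>) = (\<Sum>j\<in>{n}. \<beta> j * \<bar>y j - (y(n := 0)) j\<bar>)"
        by (intro suminf_finite) auto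
      also have "\<dots> \<le> \<beta> n"
        using beta_nonneg[of n] parameters_abs_diff_le[OF y z, of n] by (simp add: mult_left_le)
      \<comment> \<open>Only coordinate \<open>n\<close> differs, and its modulus is at most \<open>1 / 2\<close>; the bound \<open>1\<close> is enough.\<close>
      finally have p: "norm (A y g - A (y(n := 0)) g) \<le> \<beta> n * norm g" for g
        using pert[OF y z, of g] by (meson mult_right_mono norm_ge_zero order_trans)
      have "norm (q y + q (reflect n y) - 2 *\<^sub>R q (y(n := 0)))
          \<le> 2 * R * norm (weak_grad \<Omega> (q y + q (reflect n y) - 2 *\<^sub>R q (y(n := 0))))"
        using y z r by (intro E.poincare E.V_diff E.V_add E.V_scaleR) (simp_all add: q adj_V)
      also have "\<dots> \<le> 2 * R * (6 * (\<beta> n / amin)\<^sup>2 * c * ?N)"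
        using E.norm_D_adj_second_diff[OF ell[OF z] ell[OF y] ell[OF r] beta_nonneg _ p, of u0 z]
          mult_op_coeff_reflect[OF y] R y z r
        by (intro mult_left_mono) (auto simp: q c_def A_def)
      also have "\<dots> = 2 * K * ?N * (\<beta> n)\<^sup>2"
        by (simp add: K_def power_divide)
      finally show ?thesis .
    qed
    have L: "0 \<le> 2 * R * (2 / amin * c * ?N)" using R c amin by simp
    note trunc = dimension_truncation[where q = q and M = "2 * K * ?N" and s = s,
        OF beta_summable beta_nonneg sq L lip second]
    show "integrable parameter_measure
        (\<lambda>y. adjoint_state \<Omega> (diffusion abar \<psi> y) u0 z
           - adjoint_state \<Omega> (diffusion abar \<psi> (truncation s y)) u0 z)"
      using trunc(1) by (simp add: q_def)
    show "norm (\<integral>y. adjoint_state \<Omega> (diffusion abar \<psi> y) u0 z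
           - adjoint_state \<Omega> (diffusion abar \<psi> (truncation s y)) u0 z \<partial>parameter_measure)
        \<le> K * (norm z + norm u0) * (\<Sum>j. (\<beta> (j + s))\<^sup>2)"
      using trunc(2) by (simp add: q_def)
  qed
qed

end

section \<open>The truncation rate\<close>

theorem theorem5p2:
  fixes \<Omega> :: "(real ^ 'd) set"
    and abar :: "real ^ 'd \<Rightarrow> real"
    and \<psi> :: "nat \<Rightarrow> real ^ 'd \<Rightarrow> real"
    and amin amax p :: real
  assumes dim: "CARD('d) \<in> {1, 2, 3}"
    and dom: "bounded_lipschitz_domain \<Omega>"
    and abar: "Linf \<Omega> abar"
    and psi: "\<And>j. Linf \<Omega> (\<psi> j)"
    and psi_summable: "summable (\<lambda>j. Linf_norm \<Omega> (\<psi> j))"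
    and amin: "0 < amin"
    and ellipticity: "\<And>y. y \<in> parameters \<Longrightarrow>
        AE x in lebesgue_on \<Omega>. amin \<le> diffusion abar \<psi> y x \<and> diffusion abar \<psi> y x \<le> amax"
    and p: "0 < p" "p < 1"
    and psi_p_summable: "summable (\<lambda>j. Linf_norm \<Omega> (\<psi> j) powr p)"
    and psi_ordered: "\<And>j. Linf_norm \<Omega> (\<psi> (Suc j)) \<le> Linf_norm \<Omega> (\<psi> j)"
  shows "\<exists>C>0. \<forall>u0\<in>L2_on \<Omega>. \<forall>z\<in>L2_on \<Omega>. \<forall>s\<ge>1.
      integrable parameter_measure
        (\<lambda>y. adjoint_state \<Omega> (diffusion abar \<psi> y) u0 z
           - adjoint_state \<Omega> (diffusion abar \<psi> (truncation s y)) u0 z) \<and>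
      norm (\<integral>y. adjoint_state \<Omega> (diffusion abar \<psi> y) u0 z
           - adjoint_state \<Omega> (diffusion abar \<psi> (truncation s y)) u0 z \<partial>parameter_measure)
        \<le> C * (norm z + norm u0) * real s powr (- (2 / p - 1))"
proof -
  interpret elliptic_diffusion \<Omega> abar \<psi> amin amax
    using dom abar psi psi_summable amin ellipticity
    by unfold_locales (auto simp: bounded_lipschitz_domain_def)
  define B where "B = (\<Sum>j. \<beta> j powr p) powr (2 / p)"
  obtain K where K: "0 < K" and trunc: "\<And>u0 z s. summable (\<lambda>j. (\<beta> j)\<^sup>2) \<Longrightarrow>
      integrable parameter_measure
        (\<lambda>y. adjoint_state \<Omega> (diffusion abar \<psi> y) u0 z
           - adjoint_state \<Omega> (diffusion abar \<psi> (truncation s y)) u0 z) \<and>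
      norm (\<integral>y. adjoint_state \<Omega> (diffusion abar \<psi> y) u0 z
           - adjoint_state \<Omega> (diffusion abar \<psi> (truncation s y)) u0 z \<partial>parameter_measure)
        \<le> K * (norm z + norm u0) * (\<Sum>j. (\<beta> (j + s))\<^sup>2)"
    using adjoint_dimension_truncation by blast
  have summ: "summable (\<lambda>j. \<beta> j powr p)" and dec: "\<beta> (Suc j) \<le> \<beta> j" for j
    using psi_p_summable psi_ordered by (simp_all add: \<beta>_def)
  note rate = tail_sum_squares_rate[OF p beta_nonneg dec summ]
  show ?thesis
  \<comment> \<open>\<open>B\<close> vanishes when every \<open>\<psi> j\<close> does, and the constant has to be positive.\<close>
  proof (intro exI[of _ "K * (B + 1)"] conjI ballI allI impI)
    show "0 < K * (B + 1)" using K by (simp add: B_def add_nonneg_pos)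
    fix u0 z :: "(real ^ 'd, real) L2" and s :: nat assume s: "1 \<le> s"
    note t = trunc[OF rate(1)[OF s], of u0 z s]
    show "integrable parameter_measure
        (\<lambda>y. adjoint_state \<Omega> (diffusion abar \<psi> y) u0 z
           - adjoint_state \<Omega> (diffusion abar \<psi> (truncation s y)) u0 z)"
      using t by blast
    have "K * (norm z + norm u0) * (\<Sum>j. (\<beta> (j + s))\<^sup>2)
        \<le> K * (norm z + norm u0) * ((B + 1) * real s powr (- (2 / p - 1)))"
    proof (rule mult_left_mono)
      have "(\<Sum>j. (\<beta> (j + s))\<^sup>2) \<le> B * real s powr (- (2 / p - 1))"
        unfolding B_def by (rule rate(2)[OF s])
      also have "\<dots> \<le> (B + 1) * real s powr (- (2 / p - 1))"
        by (intro mult_right_mono) auto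
      finally show "(\<Sum>j. (\<beta> (j + s))\<^sup>2) \<le> (B + 1) * real s powr (- (2 / p - 1))" .
    qed (use K in simp)
    then show "norm (\<integral>y. adjoint_state \<Omega> (diffusion abar \<psi> y) u0 z
           - adjoint_state \<Omega> (diffusion abar \<psi> (truncation s y)) u0 z \<partial>parameter_measure)
        \<le> K * (B + 1) * (norm z + norm u0) * real s powr (- (2 / p - 1))"
      using t by (simp add: mult_ac)
  qed
qed

end
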